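(* Let $\hat\theta^{C=0}:=\hat\theta_{q(X)C}+\hat\omega^{C=0}\big(\hat\theta^f_{1-\pi(X)}-\hat\theta^f_{q(X)C}\big)$, with the components and influence functions $\phi,\phi^f$ defined in the context. Assume the data $(X_i,C_i,Y_i)_{i=1}^{n+N}$ are i.i.d. from $\mathbb Q^*$, that $C$ is conditionally independent of $Y$ given $X$, that $\epsilon<\pi(X)<1-\epsilon$ for some $\epsilon>0$, and that $\hat\omega^{C=0}\xrightarrow{p}\omega^{C=0}$, where $$\omega^{C=0}:=\frac{\operatorname{Cov}\Big(q(X_i)C_i\phi(X_i,Y_i),\ [q(X_i)C_i-(1-\pi(X_i))]\,\phi^f(X_i)\Big)}{\operatorname{Var}\Big([1-\pi(X_i)-q(X_i)C_i]\,\phi^f(X_i)\Big)}.$$ Then, as $n+N\to\infty$, $\sqrt{n+N}\,(\hat\theta^{C=0}-\theta_0^{C=0})\xrightarrow{d}N(0,\sigma^2_{C=0})$, where $$\sigma^2_{C=0}=\frac{\operatorname{Var}\big(q(X_i)C_i\phi(X_i,Y_i)\big)}{\Pr(C=0)^2}-\frac{\operatorname{Cov}\Big(q(X_i)C_i\phi(X_i,Y_i),\ [1-\pi(X_i)-q(X_i)C_i]\,\phi^f(X_i)\Big)^2}{\Pr(C=0)^2\,\operatorname{Var}\Big([1-\pi(X_i)-q(X_i)C_i]\,\phi^f(X_i)\Big)}.$$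
   Context: Setting: $(X,C,Y)\sim\mathbb Q^*$ with $X$ a real vector, $Y$ real, $C\in\{0,1\}$ the indicator that $Y$ is observed; observed data are $(X_i,C_i,C_iY_i)_{i=1}^{n+N}$. $\pi(X)=\Pr(C=1\mid X)$ is known, $q(X):=\Pr(C=0\mid X)/\Pr(C=1\mid X)=(1-\pi(X))/\pi(X)$, and $f$ is a fixed deterministic real-valued function of $X$. Inequalities between vectors are componentwise. $\Phi$ is a real-valued functional on cumulative distribution functions (CDFs), Hadamard differentiable with respect to the supremum norm (at the CDFs $F_0^{C=0}$ and $F_0^{C=0,f}$ below), with Gateaux derivative $\dot\Phi(F;h)$ at $F$ in direction $h$, linear in $h$. Let $F_0^{C=0}(x,y)=\mathbb Q^*(X\le x,Y\le y\mid C=0)$ and $F_0^{C=0,f}(x,y)=\mathbb Q^*(X\le x,f(X)\le y\mid C=0)$. The target is $\theta_0^{C=0}:=\Phi(F_0^{C=0})$ (unlabeled data distribution). With $\delta_{x,y}(u_1,u_2)=I(x\le u_1,y\le u_2)$, set $$\phi(x,y):=\dot\Phi(F_0^{C=0};\delta_{x,y}-F_0^{C=0}),\qquad \phi^f(x):=\dot\Phi(F_0^{C=0,f};\delta_{x,f(x)}-F_0^{C=0,f})$$ ($\phi^f(x)$ is written $\phi(x,f(x))$ in the paper). The estimators are $$\hat\theta_{q(X)C}:=\Phi\big(F^{C=0}_{q(X)C}\big),\quad F^{C=0}_{q(X)C}(x,y):=\frac{\sum_{i=1}^{n+N}q(X_i)C_iI(X_i\le x,Y_i\le y)}{\sum_{i=1}^{n+N}q(X_i)C_i},$$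 $$\hat\theta^f_{q(X)C}:=\Phi\big(F^{C=0,f}_{q(X)C}\big),\quad F^{C=0,f}_{q(X)C}(x,y):=\frac{\sum_{i=1}^{n+N}q(X_i)C_iI(X_i\le x,f(X_i)\le y)}{\sum_{i=1}^{n+N}q(X_i)C_i},$$ $$\hat\theta^f_{1-\pi(X)}:=\Phi\big(F^{C=0,f}_{1-\pi(X)}\big),\quad F^{C=0,f}_{1-\pi(X)}(x,y):=\frac{\sum_{i=1}^{n+N}(1-\pi(X_i))I(X_i\le x,f(X_i)\le y)}{\sum_{i=1}^{n+N}(1-\pi(X_i))}.$$ The variance in the denominator of $\omega^{C=0}$ is assumed positive. All covariances and variances are under $\mathbb Q^*$. *)

theory Defs
  imports "HOL-Probability.Probability"
begin

section \<open>Joint CDFs and functionals on CDFs\<close>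

text \<open>
  The order on \<^typ>\<open>real^'d\<close> and on pairs is the componentwise one, so
  \<open>(x, y) \<le> (u1, u2)\<close> means \<open>x \<le> u1 \<and> y \<le> u2\<close> and
  \<open>{..u}\<close> is a lower-left orthant.
\<close>

definition cdfs :: "((real^'d) \<times> real \<Rightarrow> real) set" where
  "cdfs = {(\<lambda>u. measure \<mu> {..u}) | \<mu>. prob_space \<mu> \<and> sets \<mu> = sets borel}"

definition bounded_fun :: "('a \<Rightarrow> real) \<Rightarrow> bool" where
  "bounded_fun h \<longleftrightarrow> bounded (range h)"

text \<open>Continuous linear functionals on the bounded functions with the supremum norm.\<close>

definition sup_norm_bounded_linear :: "(('a \<Rightarrow> real) \<Rightarrow> real) \<Rightarrow> bool" where
  "sup_norm_bounded_linear L \<longleftrightarrow>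
     (\<forall>g h. bounded_fun g \<longrightarrow> bounded_fun h \<longrightarrow> L (\<lambda>u. g u + h u) = L g + L h) \<and>
     (\<forall>c h. bounded_fun h \<longrightarrow> L (\<lambda>u. c * h u) = c * L h) \<and>
     (\<exists>K. \<forall>h. bounded_fun h \<longrightarrow> \<bar>L h\<bar> \<le> K * (SUP u. \<bar>h u\<bar>))"

text \<open>
  Hadamard differentiability at \<open>F\<close> of a functional with domain \<open>D\<close>. The perturbed
  functions \<open>F + t h\<close> are required to stay in the domain, and \<open>t\<close> decreases to \<open>0\<close>.
\<close>

definition hadamard_differentiable ::
    "(('a \<Rightarrow> real) \<Rightarrow> real) \<Rightarrow> ('a \<Rightarrow> real) set \<Rightarrow> ('a \<Rightarrow> real) \<Rightarrow> bool" where
  "hadamard_differentiable \<Phi> D F \<longleftrightarrow> F \<in> D \<and>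
     (\<exists>L. sup_norm_bounded_linear L \<and>
       (\<forall>(t :: nat \<Rightarrow> real) h h0.
          (\<forall>k. t k > 0) \<longrightarrow> t \<longlonglongrightarrow> 0 \<longrightarrow>
          (\<forall>k. bounded_fun (h k)) \<longrightarrow> bounded_fun h0 \<longrightarrow> uniform_limit UNIV h h0 sequentially \<longrightarrow>
          (\<forall>k. (\<lambda>u. F u + t k * h k u) \<in> D) \<longrightarrow>
          (\<lambda>k. (\<Phi> (\<lambda>u. F u + t k * h k u) - \<Phi> F) / t k) \<longlonglongrightarrow> L h0))"

text \<open>
  One-sided, since for \<open>h = \<delta> - F\<close> the function \<open>F + t h\<close> is a CDF for
  \<open>0 \<le> t \<le> 1\<close> but in general not for \<open>t < 0\<close>.
\<close>

definition gateaux_derivative ::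
    "(('a \<Rightarrow> real) \<Rightarrow> real) \<Rightarrow> ('a \<Rightarrow> real) \<Rightarrow> ('a \<Rightarrow> real) \<Rightarrow> real" where
  "gateaux_derivative \<Phi> F h = Lim (at_right 0) (\<lambda>t. (\<Phi> (\<lambda>u. F u + t * h u) - \<Phi> F) / t)"

definition influence_function ::
    "(('a::order \<Rightarrow> real) \<Rightarrow> real) \<Rightarrow> ('a \<Rightarrow> real) \<Rightarrow> 'a \<Rightarrow> real" where
  "influence_function \<Phi> F z = gateaux_derivative \<Phi> F (\<lambda>u. of_bool (z \<le> u) - F u)"


section \<open>Probability notions\<close>

definition covariance :: "'a measure \<Rightarrow> ('a \<Rightarrow> real) \<Rightarrow> ('a \<Rightarrow> real) \<Rightarrow> real" where
  "covariance M f g =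
     prob_space.expectation M
       (\<lambda>w. (f w - prob_space.expectation M f) * (g w - prob_space.expectation M g))"

definition converges_in_prob :: "'a measure \<Rightarrow> (nat \<Rightarrow> 'a \<Rightarrow> real) \<Rightarrow> real \<Rightarrow> bool" where
  "converges_in_prob M W a \<longleftrightarrow>
     (\<forall>e>0. (\<lambda>m. measure M {w \<in> space M. \<bar>W m w - a\<bar> > e}) \<longlonglongrightarrow> 0)"

text \<open>
  The normal law with mean \<open>a\<close> and variance \<open>v \<ge> 0\<close>; for \<open>v = 0\<close> it is the point
  mass at \<open>a\<close>, whereas \<^const>\<open>normal_density\<close> with standard deviation \<open>0\<close> is \<open>0\<close>.
\<close>

definition normal_law :: "real \<Rightarrow> real \<Rightarrow> real measure" where
  "normal_law a v = distr std_normal_distribution borel (\<lambda>z. a + sqrt v * z)"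

definition cond_indep_var ::
    "'a measure \<Rightarrow> 'a measure \<Rightarrow> 'b measure \<Rightarrow> ('a \<Rightarrow> 'b) \<Rightarrow> 'c measure \<Rightarrow> ('a \<Rightarrow> 'c) \<Rightarrow> bool" where
  "cond_indep_var M G S U T V \<longleftrightarrow>
     U \<in> measurable M S \<and> V \<in> measurable M T \<and>
     (\<forall>a \<in> sets S. \<forall>b \<in> sets T. AE w in M.
        real_cond_exp M G (\<lambda>w. indicator a (U w) * indicator b (V w)) w =
        real_cond_exp M G (\<lambda>w. indicator a (U w)) w * real_cond_exp M G (\<lambda>w. indicator b (V w)) w)"


section \<open>The missing-data model\<close>

text \<open>
  \<open>Q\<close> is the law of the complete triple \<open>(X, C, Y)\<close>, where \<open>C = True\<close> means that \<open>Y\<close>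
  is observed.
\<close>

definition triple_space :: "((real^'d) \<times> bool \<times> real) measure" where
  "triple_space = borel \<Otimes>\<^sub>M count_space UNIV \<Otimes>\<^sub>M borel"

definition sigma_X :: "((real^'d) \<times> bool \<times> real) measure \<Rightarrow> ((real^'d) \<times> bool \<times> real) measure" where
  "sigma_X Q = vimage_algebra (space Q) fst borel"

definition is_propensity ::
    "((real^'d) \<times> bool \<times> real) measure \<Rightarrow> (real^'d \<Rightarrow> real) \<Rightarrow> bool" where
  "is_propensity Q \<pi> \<longleftrightarrow> \<pi> \<in> borel_measurable borel \<and>
     (AE z in Q. real_cond_exp Q (sigma_X Q) (\<lambda>(x, c, y). of_bool c) z = \<pi> (fst z))"

definition odds :: "(real^'d \<Rightarrow> real) \<Rightarrow> real^'d \<Rightarrow> real" where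
  "odds \<pi> x = (1 - \<pi> x) / \<pi> x"

definition prob_unlabeled :: "((real^'d) \<times> bool \<times> real) measure \<Rightarrow> real" where
  "prob_unlabeled Q = \<P>(z in Q. \<not> fst (snd z))"

definition target_cdf :: "((real^'d) \<times> bool \<times> real) measure \<Rightarrow> (real^'d) \<times> real \<Rightarrow> real" where
  "target_cdf Q u = \<P>(z in Q. (fst z, snd (snd z)) \<le> u \<bar> \<not> fst (snd z))"

definition target_cdf_f ::
    "((real^'d) \<times> bool \<times> real) measure \<Rightarrow> (real^'d \<Rightarrow> real) \<Rightarrow> (real^'d) \<times> real \<Rightarrow> real" where
  "target_cdf_f Q f u = \<P>(z in Q. (fst z, f (fst z)) \<le> u \<bar> \<not> fst (snd z))"

definition phi ::
    "(((real^'d) \<times> real \<Rightarrow> real) \<Rightarrow> real) \<Rightarrow> ((real^'d) \<times> bool \<times> real) measure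
      \<Rightarrow> real^'d \<Rightarrow> real \<Rightarrow> real" where
  "phi \<Phi> Q x y = influence_function \<Phi> (target_cdf Q) (x, y)"

definition phi_f ::
    "(((real^'d) \<times> real \<Rightarrow> real) \<Rightarrow> real) \<Rightarrow> ((real^'d) \<times> bool \<times> real) measure
      \<Rightarrow> (real^'d \<Rightarrow> real) \<Rightarrow> real^'d \<Rightarrow> real" where
  "phi_f \<Phi> Q f x = influence_function \<Phi> (target_cdf_f Q f) (x, f x)"

definition omega ::
    "(((real^'d) \<times> real \<Rightarrow> real) \<Rightarrow> real) \<Rightarrow> ((real^'d) \<times> bool \<times> real) measure
      \<Rightarrow> (real^'d \<Rightarrow> real) \<Rightarrow> (real^'d \<Rightarrow> real) \<Rightarrow> real" where
  "omega \<Phi> Q \<pi> f =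
     covariance Q (\<lambda>(x, c, y). odds \<pi> x * of_bool c * phi \<Phi> Q x y)
                  (\<lambda>(x, c, y). (odds \<pi> x * of_bool c - (1 - \<pi> x)) * phi_f \<Phi> Q f x) /
     prob_space.variance Q (\<lambda>(x, c, y). (1 - \<pi> x - odds \<pi> x * of_bool c) * phi_f \<Phi> Q f x)"

definition asymptotic_variance ::
    "(((real^'d) \<times> real \<Rightarrow> real) \<Rightarrow> real) \<Rightarrow> ((real^'d) \<times> bool \<times> real) measure
      \<Rightarrow> (real^'d \<Rightarrow> real) \<Rightarrow> (real^'d \<Rightarrow> real) \<Rightarrow> real" where
  "asymptotic_variance \<Phi> Q \<pi> f =
     prob_space.variance Q (\<lambda>(x, c, y). odds \<pi> x * of_bool c * phi \<Phi> Q x y) / (prob_unlabeled Q)\<^sup>2 -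
     (covariance Q (\<lambda>(x, c, y). odds \<pi> x * of_bool c * phi \<Phi> Q x y)
                   (\<lambda>(x, c, y). (1 - \<pi> x - odds \<pi> x * of_bool c) * phi_f \<Phi> Q f x))\<^sup>2 /
     ((prob_unlabeled Q)\<^sup>2 *
       prob_space.variance Q (\<lambda>(x, c, y). (1 - \<pi> x - odds \<pi> x * of_bool c) * phi_f \<Phi> Q f x))"


section \<open>Estimators\<close>

text \<open>
  \<open>X\<close>, \<open>C\<close>, \<open>Y\<close> are here the realised data, indexed from \<open>0\<close>, and \<open>m\<close> is the
  total sample size \<open>n + N\<close>. If all weights vanish the value is \<open>0\<close>.
\<close>

definition weighted_ecdf ::
    "(nat \<Rightarrow> real) \<Rightarrow> (nat \<Rightarrow> (real^'d) \<times> real) \<Rightarrow> nat \<Rightarrow> (real^'d) \<times> real \<Rightarrow> real" where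
  "weighted_ecdf v z m u = (\<Sum>i<m. v i * of_bool (z i \<le> u)) / (\<Sum>i<m. v i)"

definition theta_qC ::
    "(((real^'d) \<times> real \<Rightarrow> real) \<Rightarrow> real) \<Rightarrow> (real^'d \<Rightarrow> real)
      \<Rightarrow> (nat \<Rightarrow> real^'d) \<Rightarrow> (nat \<Rightarrow> bool) \<Rightarrow> (nat \<Rightarrow> real) \<Rightarrow> nat \<Rightarrow> real" where
  "theta_qC \<Phi> \<pi> X C Y m =
     \<Phi> (weighted_ecdf (\<lambda>i. odds \<pi> (X i) * of_bool (C i)) (\<lambda>i. (X i, Y i)) m)"

definition theta_f_qC ::
    "(((real^'d) \<times> real \<Rightarrow> real) \<Rightarrow> real) \<Rightarrow> (real^'d \<Rightarrow> real) \<Rightarrow> (real^'d \<Rightarrow> real)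
      \<Rightarrow> (nat \<Rightarrow> real^'d) \<Rightarrow> (nat \<Rightarrow> bool) \<Rightarrow> nat \<Rightarrow> real" where
  "theta_f_qC \<Phi> \<pi> f X C m =
     \<Phi> (weighted_ecdf (\<lambda>i. odds \<pi> (X i) * of_bool (C i)) (\<lambda>i. (X i, f (X i))) m)"

definition theta_f_pi ::
    "(((real^'d) \<times> real \<Rightarrow> real) \<Rightarrow> real) \<Rightarrow> (real^'d \<Rightarrow> real) \<Rightarrow> (real^'d \<Rightarrow> real)
      \<Rightarrow> (nat \<Rightarrow> real^'d) \<Rightarrow> nat \<Rightarrow> real" where
  "theta_f_pi \<Phi> \<pi> f X m =
     \<Phi> (weighted_ecdf (\<lambda>i. 1 - \<pi> (X i)) (\<lambda>i. (X i, f (X i))) m)"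

end

theory Submission
  imports Defs "HOL-Complex_Analysis.Great_Picard"
begin

text \<open>
  Write each estimator as a plug-in \<open>\<Phi> (F\<^sub>m)\<close> of a weighted empirical CDF with bounded weights
  \<open>v\<close> of mean \<open>p = Pr (C = 0)\<close>. With \<open>t = 1 / (sqrt m * mean weight)\<close> one has exactly
  \<open>F\<^sub>m = F + t h\<^sub>m\<close>, where \<open>h\<^sub>m = (1 / sqrt m) * (\<Sum>i<m. v\<^sub>i (\<delta>\<^sub>i - F))\<close>, and linearity of the
  Hadamard derivative \<open>L\<close> gives \<open>L h\<^sub>m = (1 / sqrt m) * (\<Sum>i<m. v\<^sub>i \<phi>\<^sub>i)\<close>. No Gaussian limit process is
  needed: orthants have polynomially many brackets, so chaining with Bernstein's inequality makes
  \<open>h\<^sub>m\<close> asymptotically equicontinuous over finite partitions, hence with high probability close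
  to a compact set, on which the Hadamard difference quotients converge uniformly to \<open>L\<close>. All
  events are finite unions of tail events, so that measurability of suprema never matters.

  An arbitrary bounded functional \<open>L\<close> need not commute with integration, but
  \<open>v \<phi>\<close> has mean zero because \<open>L h\<^sub>m\<close> is stochastically bounded. By conditional
  independence all three weighted laws are the target laws. The linear expansions, Slutsky's lemma
  and the central limit theorem then yield the limit, and inserting \<open>\<omega>\<close> its variance.
\<close>

section \<open>Stochastic order symbols\<close>

text \<open>The scales of the chaining are tied together. At level \<open>j\<close> the brackets
  have mass at most \<open>(1/4) ^ j\<close>, so the increments have second moments of that order;
  the exponential parameter \<open>2 ^ j\<close> and the threshold \<open>(2/3) ^ j\<close> then
  keep the variance term in Bernstein's exponent at \<open>2\<close>, while the deviation term is
  \<open>(4/3) ^ j\<close>. Hence the thresholds are summable, and the failure probabilities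
  outweigh the number of links, which grows only like a power of \<open>4 ^ j\<close>.

  A second obstacle is the domain: difference quotients are controlled only while
  \<open>F + t h\<close> stays in \<open>cdfs\<close>. The random step \<open>t\<close> is chosen so
  that \<open>F + t h\<close> is the weighted empirical CDF itself, which meets this exactly.

  The order of choices also matters. The starting level and the bound \<open>R\<close> come from the
  failure probabilities, and only then does compactness supply a last level \<open>N\<close>.
  Equicontinuity is therefore stated for every \<open>N\<close> with one starting level.\<close>

text \<open>\<open>P\<close> holds with probability at least \<open>1 - \<eta>\<close> in the sense of inner measure, so that \<open>P\<close>
  need not be measurable.\<close>

definition likely :: "'a measure \<Rightarrow> real \<Rightarrow> ('a \<Rightarrow> bool) \<Rightarrow> bool" where
  "likely M \<eta> P \<longleftrightarrow> (\<exists>A\<in>sets M. measure M A \<le> \<eta> \<and> (\<forall>w\<in>space M - A. P w))"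

text \<open>\<open>prob_null\<close> and \<open>prob_bounded\<close> are o_P(1) and O_P(1) in inner
  probability, so that they apply to plug-in values whose measurability is unknown.\<close>

definition prob_null :: "'a measure \<Rightarrow> (nat \<Rightarrow> 'a \<Rightarrow> real) \<Rightarrow> bool" where
  "prob_null M Z \<longleftrightarrow>
     (\<forall>e>0. \<forall>\<eta>>0. \<forall>\<^sub>F m in sequentially. likely M \<eta> (\<lambda>w. \<bar>Z m w\<bar> \<le> e))"

definition prob_bounded :: "'a measure \<Rightarrow> (nat \<Rightarrow> 'a \<Rightarrow> real) \<Rightarrow> bool" where
  "prob_bounded M Z \<longleftrightarrow>
     (\<forall>\<eta>>0. \<exists>R. \<forall>\<^sub>F m in sequentially. likely M \<eta> (\<lambda>w. \<bar>Z m w\<bar> \<le> R))"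

lemma prob_nullD: "prob_null M Z \<Longrightarrow> e > 0 \<Longrightarrow> \<eta> > 0 \<Longrightarrow>
    \<forall>\<^sub>F m in sequentially. likely M \<eta> (\<lambda>w. \<bar>Z m w\<bar> \<le> e)"
  by (auto simp: prob_null_def)

lemma prob_boundedE:
  assumes "prob_bounded M Z" "\<eta> > 0"
  obtains R where "R > 0" "\<forall>\<^sub>F m in sequentially. likely M \<eta> (\<lambda>w. \<bar>Z m w\<bar> \<le> R)"
proof -
  obtain R where R: "\<forall>\<^sub>F m in sequentially. likely M \<eta> (\<lambda>w. \<bar>Z m w\<bar> \<le> R)"
    using assms by (auto simp: prob_bounded_def)
  have "\<forall>\<^sub>F m in sequentially. likely M \<eta> (\<lambda>w. \<bar>Z m w\<bar> \<le> max R 1)"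
    using R by eventually_elim (auto simp: likely_def le_max_iff_disj)
  then show ?thesis using that[of "max R 1"] by auto
qed

lemma likely_mono:
  assumes "likely M a P" "a \<le> b" "\<And>w. w \<in> space M \<Longrightarrow> P w \<Longrightarrow> R w"
  shows "likely M b R"
  using assms unfolding likely_def by (meson DiffD1 order_trans)

context prob_space
begin

lemma likely_conj:
  assumes "likely M a P" "likely M b R"
  shows "likely M (a + b) (\<lambda>w. P w \<and> R w)"
proof -
  obtain A B where A: "A \<in> events" "prob A \<le> a" "\<forall>w\<in>space M - A. P w"
    and B: "B \<in> events" "prob B \<le> b" "\<forall>w\<in>space M - B. R w"
    using assms by (auto simp: likely_def)
  have "prob (A \<union> B) \<le> a + b"
    using measure_Un_le[of A M B] A B by simp
  then show ?thesis
    unfolding likely_def using A B by (intro bexI[of _ "A \<union> B"]) auto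
qed

lemma likely_ball:
  assumes "finite I" "\<And>i. i \<in> I \<Longrightarrow> likely M (a i) (P i)"
  shows "likely M (\<Sum>i\<in>I. a i) (\<lambda>w. \<forall>i\<in>I. P i w)"
  using assms
proof (induction I rule: finite_induct)
  case empty
  then show ?case by (auto simp: likely_def intro!: bexI[of _ "{}"])
next
  case (insert i I)
  then have "likely M (a i + (\<Sum>i\<in>I. a i)) (\<lambda>w. P i w \<and> (\<forall>i\<in>I. P i w))"
    by (intro likely_conj) auto
  then show ?case using insert by (auto elim!: likely_mono)
qed

lemma AE_likely:
  assumes "AE w in M. P w" "a \<ge> 0"
  shows "likely M a P"
proof -
  obtain N where "{w \<in> space M. \<not> P w} \<subseteq> N" "N \<in> events" "emeasure M N = 0"
    using assms(1) by (rule AE_E)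
  then show ?thesis unfolding likely_def using assms(2)
    by (intro bexI[of _ N]) (auto simp: measure_def)
qed

lemma prob_null_imp_bounded: "prob_null M Z \<Longrightarrow> prob_bounded M Z"
  unfolding prob_bounded_def by (auto intro!: exI[of _ 1] prob_nullD)

lemma prob_bounded_const: "prob_bounded M (\<lambda>m w. c)"
  unfolding prob_bounded_def likely_def
  by (auto intro!: exI[of _ "\<bar>c\<bar>"] bexI[of _ "{}"])

lemma prob_null_add:
  assumes "prob_null M Y" "prob_null M Z"
  shows "prob_null M (\<lambda>m w. Y m w + Z m w)"
  unfolding prob_null_def
proof (intro allI impI)
  fix e \<eta> :: real assume "e > 0" "\<eta> > 0"
  then have "\<forall>\<^sub>F m in sequentially. likely M (\<eta>/2) (\<lambda>w. \<bar>Y m w\<bar> \<le> e/2)"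
    "\<forall>\<^sub>F m in sequentially. likely M (\<eta>/2) (\<lambda>w. \<bar>Z m w\<bar> \<le> e/2)"
    using assms by (simp_all only: prob_nullD half_gt_zero)
  then show "\<forall>\<^sub>F m in sequentially. likely M \<eta> (\<lambda>w. \<bar>Y m w + Z m w\<bar> \<le> e)"
    by eventually_elim (erule (1) likely_mono[OF likely_conj], auto)
qed

lemma prob_null_minus: "prob_null M Z \<Longrightarrow> prob_null M (\<lambda>m w. - Z m w)"
  by (simp add: prob_null_def)

lemma prob_null_diff:
  "prob_null M Y \<Longrightarrow> prob_null M Z \<Longrightarrow> prob_null M (\<lambda>m w. Y m w - Z m w)"
  using prob_null_add[OF _ prob_null_minus] by simp

lemma prob_bounded_add:
  assumes "prob_bounded M Y" "prob_bounded M Z"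
  shows "prob_bounded M (\<lambda>m w. Y m w + Z m w)"
  unfolding prob_bounded_def
proof (intro allI impI)
  fix \<eta> :: real assume "\<eta> > 0"
  then obtain R S where "\<forall>\<^sub>F m in sequentially. likely M (\<eta>/2) (\<lambda>w. \<bar>Y m w\<bar> \<le> R)"
    "\<forall>\<^sub>F m in sequentially. likely M (\<eta>/2) (\<lambda>w. \<bar>Z m w\<bar> \<le> S)"
    using assms by (metis prob_boundedE half_gt_zero)
  then have "\<forall>\<^sub>F m in sequentially. likely M \<eta> (\<lambda>w. \<bar>Y m w + Z m w\<bar> \<le> R + S)"
    by eventually_elim (erule (1) likely_mono[OF likely_conj], auto)
  then show "\<exists>R. \<forall>\<^sub>F m in sequentially. likely M \<eta> (\<lambda>w. \<bar>Y m w + Z m w\<bar> \<le> R)" ..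
qed

lemma prob_bounded_minus: "prob_bounded M Z \<Longrightarrow> prob_bounded M (\<lambda>m w. - Z m w)"
  by (simp add: prob_bounded_def)

lemma prob_bounded_diff:
  "prob_bounded M Y \<Longrightarrow> prob_bounded M Z \<Longrightarrow> prob_bounded M (\<lambda>m w. Y m w - Z m w)"
  using prob_bounded_add[OF _ prob_bounded_minus] by simp

lemma prob_null_mult:
  assumes "prob_null M Y" "prob_bounded M Z"
  shows "prob_null M (\<lambda>m w. Y m w * Z m w)"
  unfolding prob_null_def
proof (intro allI impI)
  fix e \<eta> :: real assume "e > 0" "\<eta> > 0"
  then obtain R where R: "R > 0" "\<forall>\<^sub>F m in sequentially. likely M (\<eta>/2) (\<lambda>w. \<bar>Z m w\<bar> \<le> R)"
    using assms by (metis prob_boundedE half_gt_zero)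
  have "\<forall>\<^sub>F m in sequentially. likely M (\<eta>/2) (\<lambda>w. \<bar>Y m w\<bar> \<le> e/R)"
    using assms(1) \<open>e > 0\<close> \<open>\<eta> > 0\<close> R(1) by (intro prob_nullD) auto
  then show "\<forall>\<^sub>F m in sequentially. likely M \<eta> (\<lambda>w. \<bar>Y m w * Z m w\<bar> \<le> e)"
    using R(2)
  proof eventually_elim
    case (elim m)
    show ?case
    proof (rule likely_mono[OF likely_conj[OF elim]])
      fix w assume "\<bar>Y m w\<bar> \<le> e / R \<and> \<bar>Z m w\<bar> \<le> R"
      then have "\<bar>Y m w\<bar> * \<bar>Z m w\<bar> \<le> e / R * R" using R(1) \<open>e > 0\<close> by (intro mult_mono) auto
      then show "\<bar>Y m w * Z m w\<bar> \<le> e" using R(1) by (simp add: abs_mult)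
    qed simp
  qed
qed

lemma prob_bounded_mult:
  assumes "prob_bounded M Y" "prob_bounded M Z"
  shows "prob_bounded M (\<lambda>m w. Y m w * Z m w)"
  unfolding prob_bounded_def
proof (intro allI impI)
  fix \<eta> :: real assume "\<eta> > 0"
  then obtain R S where RS: "R > 0" "\<forall>\<^sub>F m in sequentially. likely M (\<eta>/2) (\<lambda>w. \<bar>Y m w\<bar> \<le> R)"
    "\<forall>\<^sub>F m in sequentially. likely M (\<eta>/2) (\<lambda>w. \<bar>Z m w\<bar> \<le> S)"
    using assms by (metis prob_boundedE half_gt_zero)
  from RS(2,3) have "\<forall>\<^sub>F m in sequentially. likely M \<eta> (\<lambda>w. \<bar>Y m w * Z m w\<bar> \<le> R * S)"
    by eventually_elim
      (erule (1) likely_mono[OF likely_conj], use RS(1) in \<open>auto simp: abs_mult intro!: mult_mono\<close>)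
  then show "\<exists>R. \<forall>\<^sub>F m in sequentially. likely M \<eta> (\<lambda>w. \<bar>Y m w * Z m w\<bar> \<le> R)" ..
qed

lemma prob_null_tendsto:
  assumes "c \<longlonglongrightarrow> 0"
  shows "prob_null M (\<lambda>m w. c m)"
  unfolding prob_null_def
proof (intro allI impI)
  fix e \<eta> :: real assume "e > 0" "\<eta> > 0"
  then have "\<forall>\<^sub>F m in sequentially. dist (c m) 0 < e" using assms by (intro tendstoD)
  then show "\<forall>\<^sub>F m in sequentially. likely M \<eta> (\<lambda>w. \<bar>c m\<bar> \<le> e)"
    by eventually_elim (use \<open>\<eta> > 0\<close> in \<open>auto simp: likely_def intro!: bexI[of _ "{}"]\<close>)
qed

text \<open>For identities that fail on an event of small but possibly positive probability, such as
  a division by a random mean weight that may vanish.\<close>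

lemma prob_null_cong_likely:
  assumes "prob_null M Y" "\<And>\<eta>. \<eta> > 0 \<Longrightarrow> \<forall>\<^sub>F m in sequentially. likely M \<eta> (\<lambda>w. Z m w = Y m w)"
  shows "prob_null M Z"
  unfolding prob_null_def
proof (intro allI impI)
  fix e \<eta> :: real assume "e > 0" "\<eta> > 0"
  then have "\<forall>\<^sub>F m in sequentially. likely M (\<eta>/2) (\<lambda>w. \<bar>Y m w\<bar> \<le> e)"
    "\<forall>\<^sub>F m in sequentially. likely M (\<eta>/2) (\<lambda>w. Z m w = Y m w)"
    using assms by (auto intro!: prob_nullD)
  then show "\<forall>\<^sub>F m in sequentially. likely M \<eta> (\<lambda>w. \<bar>Z m w\<bar> \<le> e)"
    by eventually_elim (erule (1) likely_mono[OF likely_conj], auto)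
qed

lemma prob_null_inverse:
  assumes "prob_null M (\<lambda>m w. Z m w - p)" "p > 0"
  shows "prob_null M (\<lambda>m w. inverse (Z m w) - inverse p)"
  unfolding prob_null_def
proof (intro allI impI)
  fix e \<eta> :: real assume e: "e > 0" and "\<eta> > 0"
  \<comment> \<open>The bound \<open>p / 2\<close> keeps \<open>Z m w\<close> above
    \<open>p / 2\<close>; the second bound makes the deviation divided by \<open>(p / 2) * p\<close>
    at most \<open>e\<close>.\<close>
  define d where "d = min (p / 2) (e * (p * p / 2))"
  have d: "d > 0" using assms e by (simp add: d_def)
  have "\<forall>\<^sub>F m in sequentially. likely M \<eta> (\<lambda>w. \<bar>Z m w - p\<bar> \<le> d)"
    using assms(1) d \<open>\<eta> > 0\<close> by (rule prob_nullD)
  then show "\<forall>\<^sub>F m in sequentially. likely M \<eta> (\<lambda>w. \<bar>inverse (Z m w) - inverse p\<bar> \<le> e)"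
  proof eventually_elim
    case (elim m)
    show ?case
    proof (rule likely_mono[OF elim])
      fix w assume a: "\<bar>Z m w - p\<bar> \<le> d"
      then have z: "Z m w \<ge> p / 2" and b: "\<bar>Z m w - p\<bar> \<le> e * (p * p / 2)"
        unfolding d_def by linarith+
      have "inverse (Z m w) - inverse p = (p - Z m w) / (Z m w * p)"
        using z \<open>p > 0\<close> by (simp add: field_simps)
      then have "\<bar>inverse (Z m w) - inverse p\<bar> = \<bar>Z m w - p\<bar> / (Z m w * p)"
        using z \<open>p > 0\<close> by (simp add: abs_divide abs_mult abs_minus_commute)
      also have "\<dots> \<le> (e * (p * p / 2)) / ((p / 2) * p)"
        using z \<open>p > 0\<close> e b by (intro frac_le mult_right_mono) auto
      also have "\<dots> = e" using \<open>p > 0\<close> by simp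
      finally show "\<bar>inverse (Z m w) - inverse p\<bar> \<le> e" .
    qed simp
  qed
qed

lemma converges_in_prob_imp_null:
  assumes "converges_in_prob M W a" "\<And>m. W m \<in> borel_measurable M"
  shows "prob_null M (\<lambda>m w. W m w - a)"
  unfolding prob_null_def
proof (intro allI impI)
  fix e \<eta> :: real assume e: "e > 0" and \<eta>: "\<eta> > 0"
  have "(\<lambda>m. prob {w \<in> space M. \<bar>W m w - a\<bar> > e}) \<longlonglongrightarrow> 0"
    using assms(1) e by (simp add: converges_in_prob_def)
  then have "\<forall>\<^sub>F m in sequentially. prob {w \<in> space M. \<bar>W m w - a\<bar> > e} < \<eta>"
    using \<eta> by (rule order_tendstoD)
  then show "\<forall>\<^sub>F m in sequentially. likely M \<eta> (\<lambda>w. \<bar>W m w - a\<bar> \<le> e)"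
  proof eventually_elim
    case (elim m)
    have [measurable]: "W m \<in> borel_measurable M" by fact
    have "{w \<in> space M. \<bar>W m w - a\<bar> > e} \<in> events" by measurable
    then show ?case unfolding likely_def using elim
      by (intro bexI[of _ "{w \<in> space M. \<bar>W m w - a\<bar> > e}"]) auto
  qed
qed

text \<open>Through characteristic functions: at \<open>t\<close> they differ by at most
  \<open>\<bar>t\<bar> * e\<close> from the event where the variables are \<open>e\<close>-close,
  plus twice the mass of the exceptional event. Levy's theorem passes between characteristic
  functions and weak convergence in both directions.\<close>

lemma slutsky:
  assumes [measurable]: "\<And>m. Y m \<in> borel_measurable M" "\<And>m. Z m \<in> borel_measurable M"
    and N: "real_distribution N"
    and Z: "weak_conv_m (\<lambda>m. distr M borel (Z m)) N"
    and null: "prob_null M (\<lambda>m w. Y m w - Z m w)"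
  shows "weak_conv_m (\<lambda>m. distr M borel (Y m)) N"
proof (rule levy_continuity[OF _ N])
  show rdY: "real_distribution (distr M borel (Y m))" for m by (rule real_distribution_distr) simp
  have rdZ: "real_distribution (distr M borel (Z m))" for m by (rule real_distribution_distr) simp
  fix t :: real
  have cZ: "(\<lambda>m. char (distr M borel (Z m)) t) \<longlonglongrightarrow> char N t"
    by (rule levy_continuity1[OF rdZ N Z])
  have "(\<lambda>m. char (distr M borel (Y m)) t - char (distr M borel (Z m)) t) \<longlonglongrightarrow> 0"
  proof (rule LIMSEQ_I)
    fix r :: real assume r: "r > 0"
    \<comment> \<open>The good event contributes at most \<open>r / 4\<close> and an exceptional
      event of mass \<open>r / 8\<close> at most another \<open>r / 4\<close>; the
      \<open>+ 1\<close> covers \<open>t = 0\<close>.\<close>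
    define e where "e = r / (4 * (\<bar>t\<bar> + 1))"
    have e: "e > 0" "\<bar>t\<bar> * e \<le> r / 4" using r by (auto simp: e_def field_simps)
    have "\<forall>\<^sub>F m in sequentially. likely M (r/8) (\<lambda>w. \<bar>Y m w - Z m w\<bar> \<le> e)"
      using null e r by (intro prob_nullD) auto
    then have "\<forall>\<^sub>F m in sequentially. norm (char (distr M borel (Y m)) t - char (distr M borel (Z m)) t - 0) < r"
    proof eventually_elim
      case (elim m)
      then obtain A where A[measurable]: "A \<in> events" and pA: "prob A \<le> r/8"
        and bd: "\<forall>w\<in>space M - A. \<bar>Y m w - Z m w\<bar> \<le> e" by (auto simp: likely_def)
      have iY: "integrable M (\<lambda>w. iexp (t * Y m w))" and iZ: "integrable M (\<lambda>w. iexp (t * Z m w))"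
        by (auto intro!: integrable_const_bound[where B=1])
      have "char (distr M borel (Y m)) t - char (distr M borel (Z m)) t
        = (CLINT w|M. iexp (t * Y m w) - iexp (t * Z m w))"
        using iY iZ by (simp add: char_def integral_distr)
      also have "norm \<dots> \<le> (LINT w|M. r/4 + 2 * indicator A w)"
      proof (rule order_trans[OF integral_norm_bound integral_mono])
        show "integrable M (\<lambda>w. norm (iexp (t * Y m w) - iexp (t * Z m w)))" using iY iZ by simp
        show "integrable M (\<lambda>w. r/4 + 2 * indicator A w)"
          by (intro Bochner_Integration.integrable_add integrable_const integrable_mult_right
              integrable_real_indicator) (auto simp: emeasure_eq_measure)
        fix w assume w: "w \<in> space M"
        show "norm (iexp (t * Y m w) - iexp (t * Z m w)) \<le> r/4 + 2 * indicator A w"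
        proof (cases "w \<in> A")
          case True
          have "norm (iexp (t * Y m w) - iexp (t * Z m w)) \<le> 1 + 1"
            by (rule order_trans[OF norm_triangle_ineq4]) simp
          then show ?thesis using True r by simp
        next
          case False
          have "\<i> * of_real (t * Y m w) = \<i> * of_real (t * Z m w) + \<i> * of_real (t * (Y m w - Z m w))"
            by (simp add: algebra_simps)
          then have "iexp (t * Y m w) - iexp (t * Z m w)
            = iexp (t * Z m w) * (iexp (t * (Y m w - Z m w)) - 1)"
            by (simp only: exp_add) (simp add: algebra_simps)
          then have "norm (iexp (t * Y m w) - iexp (t * Z m w)) = norm (iexp (t * (Y m w - Z m w)) - 1)"
            by (simp add: norm_mult)
          also have "\<dots> \<le> \<bar>t * (Y m w - Z m w)\<bar>"
            using iexp_approx1[of "t * (Y m w - Z m w)" 0] by simp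
          also have "\<dots> \<le> \<bar>t\<bar> * e" using bd False w by (auto simp: abs_mult intro!: mult_left_mono)
          finally show ?thesis using e False by simp
        qed
      qed
      also have "\<dots> = r/4 + 2 * prob A"
        by (subst Bochner_Integration.integral_add) (auto simp: prob_space emeasure_eq_measure)
      also have "\<dots> < r" using pA r by simp
      finally show ?case by simp
    qed
    then show "\<exists>no. \<forall>n\<ge>no. norm (char (distr M borel (Y n)) t - char (distr M borel (Z n)) t - 0) < r"
      by (simp add: eventually_sequentially)
  qed
  from tendsto_add[OF this cZ] show "(\<lambda>m. char (distr M borel (Y m)) t) \<longlonglongrightarrow> char N t" by simp
qed

end

section \<open>Exponential bounds for i.i.d. sums\<close>

text \<open>Feeds the bound on moment generating functions: for a centred variable the linear term
  integrates to zero and the quadratic one to a variance. For \<open>x = - y < 0\<close>, the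
  product of \<open>1 - y + y^2\<close> with the quadratic Taylor minorant of \<open>exp y\<close>
  is \<open>1\<close> plus positive terms.\<close>

lemma exp_le_quadratic:
  fixes x :: real
  assumes "\<bar>x\<bar> \<le> 1"
  shows "exp x \<le> 1 + x + x\<^sup>2"
proof (cases "x \<ge> 0")
  case True
  then show ?thesis using assms by (intro exp_bound) auto
next
  case False
  define y where "y = - x"
  have y: "y > 0" using False by (simp add: y_def)
  have "1 \<le> (1 - y + y\<^sup>2) * (1 + y + y\<^sup>2 / 2)"
  proof -
    have "(1 - y + y\<^sup>2) * (1 + y + y\<^sup>2 / 2) = 1 + (y^2 + y^3 + y^4) / 2"
      by (simp add: field_simps power2_eq_square power3_eq_cube power4_eq_xxxx)
    then show ?thesis using y by simp
  qed
  also have "\<dots> \<le> (1 - y + y\<^sup>2) * exp y"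
  proof (rule mult_left_mono)
    show "1 + y + y\<^sup>2 / 2 \<le> exp y" using y by (intro exp_lower_Taylor_quadratic) auto
    have "0 \<le> (y - 1)\<^sup>2 + y" using y by simp
    then show "0 \<le> 1 - y + y\<^sup>2" by (simp add: power2_diff)
  qed
  finally have "exp (- y) \<le> 1 - y + y\<^sup>2" by (simp add: exp_minus divide_simps mult.commute)
  then show ?thesis by (simp add: y_def)
qed

locale iid_sample = prob_space M for M :: "'w measure" +
  fixes P :: "'s measure" and W :: "nat \<Rightarrow> 'w \<Rightarrow> 's"
  assumes indep: "indep_vars (\<lambda>_. P) W UNIV"
    and distr_W: "\<And>i. distr M P (W i) = P"
begin

lemma W_measurable [measurable]: "W i \<in> measurable M P"
  using indep by (auto simp: indep_vars_def)

lemma W_space: "w \<in> space M \<Longrightarrow> W i w \<in> space P"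
  using measurable_space[OF W_measurable] .

lemma prob_space_P: "prob_space P"
  using prob_space_distr[OF W_measurable] by (simp add: distr_W)

sublocale P: prob_space P by (rule prob_space_P)

lemma integral_W:
  fixes h :: "'s \<Rightarrow> real"
  shows "h \<in> borel_measurable P \<Longrightarrow> (LINT w|M. h (W i w)) = (LINT z|P. h z)"
  using integral_distr[OF W_measurable, where f=h] by (metis distr_W)

text \<open>The empirical process: \<open>sqrt m\<close> times the difference of empirical and true
  mean of \<open>g\<close>. At \<open>m = 0\<close> its value is \<open>0\<close>.\<close>

definition emp :: "('s \<Rightarrow> real) \<Rightarrow> nat \<Rightarrow> 'w \<Rightarrow> real" where
  "emp g m w = (\<Sum>i<m. g (W i w) - (LINT z|P. g z)) / sqrt m"

lemma emp_measurable [measurable]: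
  assumes [measurable]: "g \<in> borel_measurable P"
  shows "emp g m \<in> borel_measurable M"
  unfolding emp_def[abs_def] by measurable

lemma integrable_bounded:
  fixes g :: "'s \<Rightarrow> real"
  assumes "g \<in> borel_measurable P" "\<And>z. z \<in> space P \<Longrightarrow> \<bar>g z\<bar> \<le> B"
  shows "integrable P g"
  using assms by (intro P.integrable_const_bound[where B=B]) auto

text \<open>Chernoff's method in Bernstein form. As \<open>\<bar>g z - c\<bar> \<le> 2\<close>, the
  condition \<open>2 * l \<le> sqrt m\<close> brings the scaled centred summands into the range of
  \<open>exp_le_quadratic\<close>. The parameter \<open>l\<close> stays free: chaining takes
  \<open>2 ^ j\<close>, boundedness takes \<open>1\<close>.\<close>

lemma emp_upper_tail:
  assumes g[measurable]: "g \<in> borel_measurable P" and bd: "\<And>z. z \<in> space P \<Longrightarrow> \<bar>g z\<bar> \<le> 1"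
    and s: "(LINT z|P. (g z)\<^sup>2) \<le> s" and l: "l > 0" "2 * l \<le> sqrt m"
  shows "prob {w \<in> space M. emp g m w \<ge> x} \<le> exp (l\<^sup>2 * s - l * x)"
proof -
  define c where "c = (LINT z|P. g z)"
  define a where "a = l / sqrt m"
  have m: "real m > 0" using l by (cases m) auto
  have a: "0 \<le> a" "2 * a \<le> 1" using l m by (auto simp: a_def field_simps)
  have ig: "integrable P g" using g bd by (rule integrable_bounded)
  have ig2: "integrable P (\<lambda>z. (g z)\<^sup>2)"
    by (rule integrable_bounded[where B=1]) (use bd in \<open>auto simp: abs_square_le_1\<close>)
  have c: "\<bar>c\<bar> \<le> 1"
  proof -
    have "\<bar>c\<bar> \<le> (LINT z|P. \<bar>g z\<bar>)" unfolding c_def by simp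
    also have "\<dots> \<le> (LINT z|P. 1)" using ig bd by (intro integral_mono) auto
    finally show ?thesis by (simp add: P.prob_space)
  qed
  have bd2: "\<bar>a * (g z - c)\<bar> \<le> 1" if "z \<in> space P" for z
  proof -
    have "\<bar>a * (g z - c)\<bar> \<le> a * 2"
      using a bd[OF that] c by (auto simp: abs_mult intro!: mult_left_mono)
    then show ?thesis using a by simp
  qed
  have iexp: "integrable P (\<lambda>z. exp (a * (g z - c)))"
    by (rule integrable_bounded[where B="exp 1"]) (use bd2 in \<open>auto simp: abs_le_iff\<close>)
  have one: "(LINT z|P. exp (a * (g z - c))) \<le> exp (a\<^sup>2 * s)"
  proof -
    have "(LINT z|P. exp (a * (g z - c))) \<le> (LINT z|P. 1 + a * (g z - c) + (a * (g z - c))\<^sup>2)"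
    proof (rule integral_mono[OF iexp])
      show "integrable P (\<lambda>z. 1 + a * (g z - c) + (a * (g z - c))\<^sup>2)"
        by (intro Bochner_Integration.integrable_add integrable_bounded[where B=1])
          (use bd2 in \<open>auto simp: abs_square_le_1\<close>)
    qed (use bd2 exp_le_quadratic in auto)
    also have "\<dots> = (LINT z|P. (1 - a * c + a\<^sup>2 * c\<^sup>2) + (a - 2 * a\<^sup>2 * c) * g z + a\<^sup>2 * (g z)\<^sup>2)"
      by (intro Bochner_Integration.integral_cong) (auto simp: power2_eq_square algebra_simps)
    also have "\<dots> = (1 - a * c + a\<^sup>2 * c\<^sup>2) + (a - 2 * a\<^sup>2 * c) * c + a\<^sup>2 * (LINT z|P. (g z)\<^sup>2)"
      using ig ig2 by (simp add: c_def P.prob_space)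
    \<comment> \<open>The squared mean enters with a negative sign, so a bound on the raw second
      moment can serve as a bound on the variance.\<close>
    also have "\<dots> = 1 - a\<^sup>2 * c\<^sup>2 + a\<^sup>2 * (LINT z|P. (g z)\<^sup>2)"
      by (simp add: power2_eq_square algebra_simps)
    also have "\<dots> \<le> 1 + a\<^sup>2 * s"
      using mult_left_mono[OF s, of "a\<^sup>2"] mult_nonneg_nonneg[of "a\<^sup>2" "c\<^sup>2"] by (simp del: mult_nonneg_nonneg mult_le_cancel_left)
    also have "\<dots> \<le> exp (a\<^sup>2 * s)" by (rule exp_ge_add_one_self)
    finally show ?thesis .
  qed
  have le: "l * emp g m w = (\<Sum>i<m. a * (g (W i w) - c))" for w
    by (simp add: emp_def a_def c_def sum_distrib_left sum_divide_distrib)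
  have ind: "indep_vars (\<lambda>_. borel) (\<lambda>i w. exp (a * (g (W i w) - c))) {..<m}"
    by (rule indep_vars_compose2[OF indep_vars_subset[OF indep]]) auto
  have intM: "integrable M (\<lambda>w. exp (a * (g (W i w) - c)))" for i
    by (rule integrable_distr[OF W_measurable]) (simp add: distr_W iexp)
  have prod: "integrable M (\<lambda>w. \<Prod>i<m. exp (a * (g (W i w) - c)))"
    "(LINT w|M. (\<Prod>i<m. exp (a * (g (W i w) - c)))) = (\<Prod>i<m. LINT w|M. exp (a * (g (W i w) - c)))"
    using intM ind by (auto intro!: indep_vars_integrable indep_vars_lebesgue_integral)
  have "prob {w \<in> space M. emp g m w \<ge> x} \<le> exp (- l * x) * (LINT w|M. exp (l * emp g m w))"
  proof -
    have i: "integrable M (\<lambda>w. exp (l * emp g m w))" using prod(1) by (simp add: le exp_sum)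
    then have "set_integrable M (space M) (\<lambda>w. exp (l * emp g m w))"
      unfolding set_integrable_def by (intro integrable_mult_indicator) auto
    from Chernoff_ineq_ge[OF l(1) this sets.top] show ?thesis
      by (simp add: set_integral_space[OF i])
  qed
  also have "(LINT w|M. exp (l * emp g m w)) = (\<Prod>i<m. LINT w|M. exp (a * (g (W i w) - c)))"
    by (simp add: le exp_sum prod(2))
  also have "\<dots> = (LINT z|P. exp (a * (g z - c))) ^ m"
    using integral_W[where h="\<lambda>z. exp (a * (g z - c))"] by simp
  also have "\<dots> \<le> exp (a\<^sup>2 * s) ^ m"
    by (intro power_mono one) auto
  also have "\<dots> = exp (l\<^sup>2 * s)"
    using m by (simp add: a_def power_divide flip: exp_of_nat_mult)
  finally show ?thesis by (simp add: exp_diff exp_minus divide_simps mult.commute)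
qed

lemma emp_uminus: "emp (\<lambda>z. - g z) m w = - emp g m w"
  by (simp add: emp_def sum_subtractf sum_negf minus_divide_left)

lemma emp_tail:
  assumes g[measurable]: "g \<in> borel_measurable P" and bd: "\<And>z. z \<in> space P \<Longrightarrow> \<bar>g z\<bar> \<le> 1"
    and s: "(LINT z|P. (g z)\<^sup>2) \<le> s" and l: "l > 0" "2 * l \<le> sqrt m"
  shows "likely M (2 * exp (l\<^sup>2 * s - l * x)) (\<lambda>w. \<bar>emp g m w\<bar> \<le> x)"
proof -
  have tail: "likely M (exp (l\<^sup>2 * s - l * x)) (\<lambda>w. emp h m w \<le> x)"
    if "prob {w \<in> space M. emp h m w \<ge> x} \<le> exp (l\<^sup>2 * s - l * x)"
      and [measurable]: "h \<in> borel_measurable P" for h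
    unfolding likely_def using that(1) by (intro bexI[of _ "{w \<in> space M. emp h m w \<ge> x}"]) auto
  have "likely M (exp (l\<^sup>2 * s - l * x) + exp (l\<^sup>2 * s - l * x))
      (\<lambda>w. emp g m w \<le> x \<and> emp (\<lambda>z. - g z) m w \<le> x)"
    using bd s l by (intro likely_conj tail emp_upper_tail) auto
  then show ?thesis by (rule likely_mono) (auto simp: emp_uminus)
qed

lemma emp_diff:
  assumes "integrable P g" "integrable P h"
  shows "emp (\<lambda>z. g z - h z) m w = emp g m w - emp h m w"
  using assms by (simp add: emp_def sum_subtractf diff_divide_distrib right_diff_distrib)

lemma emp_cmult: "emp (\<lambda>z. c * g z) m w = c * emp g m w"
  by (simp add: emp_def sum_distrib_left flip: right_diff_distrib)

lemma emp_bounded: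
  assumes g[measurable]: "g \<in> borel_measurable P" and bd: "\<And>z. z \<in> space P \<Longrightarrow> \<bar>g z\<bar> \<le> B"
  shows "prob_bounded M (emp g)"
proof -
  define B' where "B' = \<bar>B\<bar> + 1"
  have B': "B' > 0" "\<And>z. z \<in> space P \<Longrightarrow> \<bar>g z\<bar> \<le> B'" unfolding B'_def using bd by fastforce+
  define h where "h = (\<lambda>z. (1 / B') * g z)"
  have [measurable]: "h \<in> borel_measurable P" by (simp add: h_def)
  have h1: "\<bar>h z\<bar> \<le> 1" if "z \<in> space P" for z
    using B' that by (simp add: h_def abs_mult field_simps)
  have h2: "(LINT z|P. (h z)\<^sup>2) \<le> 1"
  proof -
    have "(LINT z|P. (h z)\<^sup>2) \<le> (LINT z|P. 1)"
      by (intro integral_mono integrable_bounded[where B=1]) (use h1 in \<open>auto simp: abs_square_le_1\<close>)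
    then show ?thesis by (simp add: P.prob_space)
  qed
  have "prob_bounded M (emp h)"
    unfolding prob_bounded_def
  proof (intro allI impI)
    fix \<eta> :: real assume \<eta>: "\<eta> > 0"
    \<comment> \<open>Solves \<open>2 * exp (1 - x) = \<eta>\<close>, the tail bound at
      \<open>l = 1\<close> and \<open>s = 1\<close>; for this \<open>l\<close>,
      \<open>m \<ge> 4\<close> is the condition \<open>2 * l \<le> sqrt m\<close>.\<close>
    define x where "x = 1 - ln (\<eta> / 2)"
    have x: "2 * exp (1\<^sup>2 * 1 - 1 * x) = \<eta>" using \<eta> by (simp add: x_def)
    have "likely M \<eta> (\<lambda>w. \<bar>emp h m w\<bar> \<le> x)" if "m \<ge> 4" for m
    proof -
      have "2 * 1 \<le> sqrt m" using that by (intro real_le_rsqrt) simp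
      then show ?thesis
        using emp_tail[of h 1 1 m x] h1 h2 unfolding x by auto
    qed
    then show "\<exists>R. \<forall>\<^sub>F m in sequentially. likely M \<eta> (\<lambda>w. \<bar>emp h m w\<bar> \<le> R)"
      by (auto simp: eventually_sequentially)
  qed
  from prob_bounded_mult[OF prob_bounded_const[of B'] this]
  show ?thesis using B'(1) unfolding h_def emp_cmult by simp
qed

end

section \<open>Brackets for orthants\<close>

text \<open>By inner regularity it is enough to test nonempty compact subsets. These attain their
  least and greatest elements, which the set between two brackets need not do.\<close>

lemma compact_regular_measure_le:
  fixes \<nu> :: "'e::polish_space measure"
  assumes "prob_space \<nu>" "sets \<nu> = sets borel" "B \<in> sets borel" "c \<ge> 0"
    and "\<And>K. compact K \<Longrightarrow> K \<subseteq> B \<Longrightarrow> K \<noteq> {} \<Longrightarrow> measure \<nu> K \<le> c"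
  shows "measure \<nu> B \<le> c"
proof -
  interpret prob_space \<nu> by fact
  have "emeasure \<nu> B = (SUP K\<in>{K. K \<subseteq> B \<and> compact K}. emeasure \<nu> K)"
    using assms by (intro inner_regular) auto
  also have "\<dots> \<le> ennreal c"
  proof (rule SUP_least)
    fix K assume "K \<in> {K. K \<subseteq> B \<and> compact K}"
    then have "measure \<nu> K \<le> c" using assms(4,5) by (cases "K = {}") auto
    then show "emeasure \<nu> K \<le> ennreal c" by (simp add: emeasure_eq_measure ennreal_leI)
  qed
  finally show ?thesis using assms(4) by (simp add: emeasure_eq_measure)
qed

text \<open>The brackets follow the levels of the distribution function. Atoms cause no loss: a
  point where \<open>F\<close> jumps past a level is outside \<open>Hi\<close> of the classes below
  that level and inside \<open>Lo\<close> of the classes above it. A compact part of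
  \<open>Hi n - Lo n\<close> lies between some \<open>a\<close> and \<open>b\<close> with
  \<open>F b < (n + 1) / N\<close>, while some \<open>s < a\<close> already has
  \<open>F s \<ge> n / N\<close>.\<close>

lemma real_half_line_brackets:
  fixes \<nu> :: "real measure" and N :: nat
  assumes \<nu>: "prob_space \<nu>" and sets_\<nu>[measurable_cong]: "sets \<nu> = sets borel" and N: "N > 0"
  obtains lo hi :: "real \<Rightarrow> real set" where
    "finite (range (\<lambda>t. (lo t, hi t)))" "card (range (\<lambda>t. (lo t, hi t))) \<le> N + 1"
    "\<And>t. lo t \<in> sets borel" "\<And>t. hi t \<in> sets borel"
    "\<And>t. lo t \<subseteq> {..t}" "\<And>t. {..t} \<subseteq> hi t" "\<And>t. measure \<nu> (hi t - lo t) \<le> 1 / N"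
proof -
  interpret prob_space \<nu> by fact
  define F where "F t = measure \<nu> {..t}" for t
  have F01: "0 \<le> F t" "F t \<le> 1" for t by (auto simp: F_def)
  have mono: "mono F" unfolding F_def by (intro monoI finite_measure_mono) auto
  have [measurable]: "F \<in> borel_measurable borel" using mono by (rule borel_measurable_mono)
  \<comment> \<open>The class of \<open>t\<close>, with
    \<open>n / N \<le> F t < (n + 1) / N\<close>. The value \<open>N\<close> occurs when
    \<open>F t = 1\<close>, hence \<open>N + 1\<close> classes.\<close>
  define idx where "idx t = nat \<lfloor>N * F t\<rfloor>" for t
  have idx_le: "real (idx t) / N \<le> F t" and idx_gt: "F t < (real (idx t) + 1) / N" for t
  proof -
    have nn: "0 \<le> N * F t" using F01(1)[of t] by simp
    have "real (idx t) \<le> N * F t" "N * F t < real (idx t) + 1"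
      unfolding idx_def using nn by linarith+
    then show "real (idx t) / N \<le> F t" "F t < (real (idx t) + 1) / N"
      using N by (auto simp: field_simps)
  qed
  have idx_N: "idx t \<le> N" for t
  proof -
    have "real (idx t) \<le> N * F t" using idx_le[of t] N by (simp add: field_simps)
    also have "\<dots> \<le> N" using F01(2)[of t] by (simp add: mult_left_le)
    finally show ?thesis by simp
  qed
  \<comment> \<open>The half-line up to the \<open>n / N\<close>-quantile. For \<open>n = 0\<close>
    the intersection runs over all \<open>s\<close> and is empty; if no \<open>s\<close> reaches the
    level, it is the whole line.\<close>
  define Lo where "Lo n = (\<Inter>s\<in>{s. real n / N \<le> F s}. {..s})" for n
  define Hi where "Hi n = {x. F x < (real n + 1) / N}" for n
  have [measurable]: "Lo n \<in> sets borel" for n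
    unfolding Lo_def by (intro borel_closed closed_INT) auto
  have [measurable]: "Hi n \<in> sets borel" for n
    unfolding Hi_def by measurable
  have range: "range (\<lambda>t. (Lo (idx t), Hi (idx t))) \<subseteq> (\<lambda>n. (Lo n, Hi n)) ` {..N}"
    using idx_N by auto
  have meas: "measure \<nu> (Hi n - Lo n) \<le> 1 / N" for n
  proof (rule compact_regular_measure_le[OF \<nu> sets_\<nu>])
    fix K assume K: "compact K" "K \<subseteq> Hi n - Lo n" "K \<noteq> {}"
    obtain a where a: "a \<in> K" "\<forall>x\<in>K. a \<le> x" using compact_attains_inf K by blast
    obtain b where b: "b \<in> K" "\<forall>x\<in>K. x \<le> b" using compact_attains_sup K by blast
    obtain s where s: "s < a" "real n / N \<le> F s" using a(1) K(2) by (auto simp: Lo_def subset_eq not_le)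
    have Fb: "F b < (real n + 1) / N" using b K(2) by (auto simp: Hi_def)
    have "measure \<nu> K \<le> measure \<nu> ({..b} - {..s})"
      using a(2) b(2) s(1) by (intro finite_measure_mono) (auto intro: less_le_trans simp: not_le)
    also have "\<dots> = F b - F s" unfolding F_def
      using a b(2) s(1) by (intro finite_measure_Diff) (auto intro: order_trans less_imp_le)
    also have "\<dots> \<le> 1 / N" using Fb s(2) by (simp add: add_divide_distrib)
    finally show "measure \<nu> K \<le> 1 / N" .
  qed auto
  show ?thesis
  proof (rule that[of "\<lambda>t. Lo (idx t)" "\<lambda>t. Hi (idx t)"])
    show "finite (range (\<lambda>t. (Lo (idx t), Hi (idx t))))"
      by (rule finite_subset[OF range]) simp
    have "card (range (\<lambda>t. (Lo (idx t), Hi (idx t)))) \<le> card ((\<lambda>n. (Lo n, Hi n)) ` {..N})"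
      by (rule card_mono[OF _ range]) simp
    also have "\<dots> \<le> N + 1" using card_image_le[of "{..N}"] by simp
    finally show "card (range (\<lambda>t. (Lo (idx t), Hi (idx t)))) \<le> N + 1" .
    show "Lo (idx t) \<subseteq> {..t}" for t using idx_le[of t] by (auto simp: Lo_def)
    show "{..t} \<subseteq> Hi (idx t)" for t
      using idx_gt[of t] by (auto simp: Hi_def intro: le_less_trans[OF monoD[OF mono]])
  qed (use meas in auto)
qed

text \<open>Boxes built from the brackets of the coordinate marginals. A point of
  \<open>hi u - lo u\<close> lies in the gap between the two brackets of at least one coordinate, so
  the mass is at most the sum of the \<open>DIM('e)\<close> gaps.\<close>

lemma orthant_brackets:
  fixes \<mu> :: "'e::ordered_euclidean_space measure" and N :: nat
  assumes \<mu>: "prob_space \<mu>" and sets_\<mu>[measurable_cong]: "sets \<mu> = sets borel" and N: "N > 0"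
  obtains lo hi :: "'e \<Rightarrow> 'e set" where
    "finite (range (\<lambda>u. (lo u, hi u)))" "card (range (\<lambda>u. (lo u, hi u))) \<le> (N + 1) ^ DIM('e)"
    "\<And>u. lo u \<in> sets borel" "\<And>u. hi u \<in> sets borel"
    "\<And>u. lo u \<subseteq> {..u}" "\<And>u. {..u} \<subseteq> hi u" "\<And>u. measure \<mu> (hi u - lo u) \<le> DIM('e) / N"
proof -
  interpret prob_space \<mu> by fact
  define good where "good b p \<longleftrightarrow> finite (range p) \<and> card (range p) \<le> N + 1 \<and>
    (\<forall>t. fst (p t) \<in> sets borel \<and> snd (p t) \<in> sets borel \<and> fst (p t) \<subseteq> {..t} \<and> {..t} \<subseteq> snd (p t) \<and>
       measure \<mu> {x. x \<bullet> b \<in> snd (p t) - fst (p t)} \<le> 1 / N)"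
    for b :: 'e and p :: "real \<Rightarrow> real set \<times> real set"
  have "\<exists>p. good b p" for b
  proof -
    interpret \<nu>: prob_space "distr \<mu> borel (\<lambda>x. x \<bullet> b)"
      by (rule prob_space_distr) measurable
    obtain l h :: "real \<Rightarrow> real set" where lh:
      "finite (range (\<lambda>t. (l t, h t)))" "card (range (\<lambda>t. (l t, h t))) \<le> N + 1"
      "\<And>t. l t \<in> sets borel" "\<And>t. h t \<in> sets borel" "\<And>t. l t \<subseteq> {..t}" "\<And>t. {..t} \<subseteq> h t"
      "\<And>t. measure (distr \<mu> borel (\<lambda>x. x \<bullet> b)) (h t - l t) \<le> 1 / N"
      by (rule real_half_line_brackets[OF \<nu>.prob_space_axioms sets_distr N]) (rule that)
    have "measure \<mu> {x. x \<bullet> b \<in> h t - l t} \<le> 1 / N" for t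
      using lh(7)[of t] lh(3,4)
      by (subst (asm) measure_distr) (auto simp: vimage_def sets_eq_imp_space_eq[OF sets_\<mu>])
    with lh(1-6) have "good b (\<lambda>t. (l t, h t))" by (simp add: good_def)
    then show ?thesis by blast
  qed
  then obtain p where p: "\<And>b. good b (p b)" by metis
  define l h where "l b t = fst (p b t)" and "h b t = snd (p b t)" for b t
  have p_eq: "(\<lambda>t. (l b t, h b t)) = p b" for b by (simp add: l_def h_def fun_eq_iff)
  have fin: "finite (range (\<lambda>t. (l b t, h b t)))"
    and cd: "card (range (\<lambda>t. (l b t, h b t))) \<le> N + 1" for b
    using p[of b] unfolding p_eq good_def by auto
  have [measurable]: "l b t \<in> sets borel" "h b t \<in> sets borel"
    and sub: "l b t \<subseteq> {..t}" "{..t} \<subseteq> h b t"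
    and m: "measure \<mu> {x. x \<bullet> b \<in> h b t - l b t} \<le> 1 / N" for b t
    using p[of b] unfolding l_def h_def good_def by auto
  define lo where "lo u = {x. \<forall>b\<in>Basis. x \<bullet> b \<in> l b (u \<bullet> b)}" for u :: 'e
  define hi where "hi u = {x. \<forall>b\<in>Basis. x \<bullet> b \<in> h b (u \<bullet> b)}" for u :: 'e
  \<comment> \<open>The pair of boxes depends on \<open>u\<close> only through its coordinate
    brackets: \<open>dec\<close> recovers it from \<open>enc u\<close>, an element of a finite
    product, and this gives the cardinality bound.\<close>
  define enc where "enc u = (\<lambda>b\<in>Basis. (l b (u \<bullet> b), h b (u \<bullet> b)))" for u :: 'e
  define dec where "dec e = ({x. \<forall>b\<in>Basis. x \<bullet> b \<in> fst (e b)}, {x. \<forall>b\<in>Basis. x \<bullet> b \<in> snd (e b)})"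
    for e :: "'e \<Rightarrow> real set \<times> real set"
  let ?P = "PiE Basis (\<lambda>b::'e. range (\<lambda>t. (l b t, h b t)))"
  have dec: "(lo u, hi u) = dec (enc u)" for u by (auto simp: lo_def hi_def dec_def enc_def)
  have range: "range (\<lambda>u. (lo u, hi u)) \<subseteq> dec ` ?P"
    by (auto simp: dec enc_def)
  have finP: "finite ?P" using fin by (intro finite_PiE) auto
  have "card (range (\<lambda>u. (lo u, hi u))) \<le> card (dec ` ?P)"
    using range finP by (intro card_mono) auto
  also have "\<dots> \<le> card ?P" using finP by (rule card_image_le)
  also have "\<dots> = (\<Prod>b\<in>(Basis::'e set). card (range (\<lambda>t. (l b t, h b t))))" by (simp add: card_PiE)
  also have "\<dots> \<le> (\<Prod>b\<in>(Basis::'e set). N + 1)" using cd by (intro prod_mono) auto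
  finally have card: "card (range (\<lambda>u. (lo u, hi u))) \<le> (N + 1) ^ DIM('e)" by simp
  have [measurable]: "lo u \<in> sets borel" "hi u \<in> sets borel" for u
    unfolding lo_def hi_def by measurable
  have meas: "measure \<mu> (hi u - lo u) \<le> DIM('e) / N" for u
  proof -
    have "measure \<mu> (hi u - lo u) \<le> measure \<mu> (\<Union>b\<in>Basis. {x. x \<bullet> b \<in> h b (u \<bullet> b) - l b (u \<bullet> b)})"
      by (intro finite_measure_mono) (auto simp: hi_def lo_def)
    also have "\<dots> \<le> (\<Sum>b\<in>(Basis::'e set). measure \<mu> {x. x \<bullet> b \<in> h b (u \<bullet> b) - l b (u \<bullet> b)})"
      by (intro measure_UNION_le) auto
    also have "\<dots> \<le> (\<Sum>b\<in>(Basis::'e set). 1 / N)" using m by (intro sum_mono) auto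
    finally show ?thesis by simp
  qed
  show ?thesis
  proof (rule that[OF finite_subset[OF range finite_imageI[OF finP]] card])
    show "lo u \<subseteq> {..u}" for u 
    proof
      fix x assume "x \<in> lo u"
      then have "\<forall>b\<in>Basis. x \<bullet> b \<le> u \<bullet> b" using sub(1) by (auto simp: lo_def)
      then show "x \<in> {..u}" by (simp add: eucl_le[of x u])
    qed
    show "{..u} \<subseteq> hi u" for u 
    proof
      fix x assume "x \<in> {..u}"
      then have "\<forall>b\<in>Basis. x \<bullet> b \<le> u \<bullet> b" by (simp add: eucl_le[of x u])
      then show "x \<in> hi u" using sub(2) by (auto simp: hi_def)
    qed
  qed (use meas in auto)
qed

section \<open>Chaining\<close>

text \<open>Mass \<open>(1/4) ^ j\<close> means width \<open>(1/2) ^ j\<close> in mean square, and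
  weights in \<open>[0, 1]\<close> do not enlarge it. The counts \<open>K\<close> are abstract,
  because they enter the final estimate only through \<open>level_prob\<close>.\<close>

locale bracketed_orthants = iid_sample M P W
  for M :: "'w measure" and P :: "'s measure" and W +
  fixes v :: "'s \<Rightarrow> real" and \<zeta> :: "'s \<Rightarrow> 'e::ordered_euclidean_space"
    and lo hi :: "nat \<Rightarrow> 'e \<Rightarrow> 'e set" and K :: "nat \<Rightarrow> nat"
  assumes v_meas [measurable]: "v \<in> borel_measurable P"
    and v01: "\<And>z. z \<in> space P \<Longrightarrow> 0 \<le> v z" "\<And>z. z \<in> space P \<Longrightarrow> v z \<le> 1"
    and \<zeta>_meas [measurable]: "\<zeta> \<in> borel_measurable P"
    and brackets_finite: "\<And>j. finite (range (\<lambda>u. (lo j u, hi j u)))"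
    and brackets_card: "\<And>j. card (range (\<lambda>u. (lo j u, hi j u))) \<le> K j"
    and lo_meas [measurable]: "\<And>j u. lo j u \<in> sets borel"
    and hi_meas [measurable]: "\<And>j u. hi j u \<in> sets borel"
    and lo_sub: "\<And>j u. lo j u \<subseteq> {..u}" and hi_sup: "\<And>j u. {..u} \<subseteq> hi j u"
    and brackets_measure: "\<And>j u. measure (distr P borel \<zeta>) (hi j u - lo j u) \<le> (1/4) ^ j"
begin

definition wgt :: "'e set \<Rightarrow> 's \<Rightarrow> real" where
  "wgt A z = v z * indicator A (\<zeta> z)"

definition wemp :: "'e set \<Rightarrow> nat \<Rightarrow> 'w \<Rightarrow> real" where
  "wemp A = emp (wgt A)"

lemma wgt_measurable [measurable]:
  assumes [measurable]: "A \<in> sets borel"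
  shows "wgt A \<in> borel_measurable P"
  unfolding wgt_def[abs_def] by measurable

lemma wgt_bounds: "z \<in> space P \<Longrightarrow> 0 \<le> wgt A z" "z \<in> space P \<Longrightarrow> wgt A z \<le> 1"
  using v01[of z] by (auto simp: wgt_def indicator_def)

lemma wgt_mono: "A \<subseteq> B \<Longrightarrow> z \<in> space P \<Longrightarrow> wgt A z \<le> wgt B z"
  using v01[of z] by (auto simp: wgt_def indicator_def)

lemma wgt_integrable: "A \<in> sets borel \<Longrightarrow> integrable P (wgt A)"
  by (rule integrable_bounded[where B=1]) (use wgt_bounds in \<open>auto simp: abs_le_iff intro: order_trans[of _ 0]\<close>)

lemma wgt_diff_bound:
  assumes "A \<subseteq> B" "z \<in> space P"
  shows "\<bar>wgt B z - wgt A z\<bar> \<le> indicator (B - A) (\<zeta> z)"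
  using v01[OF assms(2)] assms(1) by (auto simp: wgt_def indicator_def)

lemma integral_indicator_\<zeta>:
  "A \<in> sets borel \<Longrightarrow> (LINT z|P. indicator A (\<zeta> z)) = measure (distr P borel \<zeta>) A"
  using integral_distr[of \<zeta> P borel "indicator A :: 'e \<Rightarrow> real"] by simp

lemma wgt_integral_diff:
  assumes "A \<subseteq> B" and [measurable]: "A \<in> sets borel" "B \<in> sets borel"
  shows "(LINT z|P. wgt B z) - (LINT z|P. wgt A z) \<le> measure (distr P borel \<zeta>) (B - A)"
proof -
  have "(LINT z|P. wgt B z) - (LINT z|P. wgt A z) = (LINT z|P. wgt B z - wgt A z)"
    by (simp add: wgt_integrable)
  also have "\<dots> \<le> (LINT z|P. indicator (B - A) (\<zeta> z))"
  proof (rule integral_mono)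
    show "wgt B z - wgt A z \<le> indicator (B - A) (\<zeta> z)" if "z \<in> space P" for z
      using wgt_diff_bound[OF assms(1) that] by simp
    show "integrable P (\<lambda>z. wgt B z - wgt A z)" by (simp add: wgt_integrable)
    show "integrable P (\<lambda>z. indicator (B - A) (\<zeta> z) :: real)"
      by (rule integrable_bounded[where B=1]) auto
  qed
  finally show ?thesis by (simp add: integral_indicator_\<zeta>)
qed

text \<open>The tail bound with \<open>l = 2 ^ j\<close> and \<open>s = 2 * (1/4) ^ j\<close>;
  \<open>4 ^ Suc j \<le> m\<close> is then the condition \<open>2 * l \<le> sqrt m\<close>. Two sets
  \<open>C\<close> and \<open>D\<close> appear because lower brackets of successive levels need not
  be nested: their difference is covered by the two bracket gaps together.\<close>

lemma wemp_diff_tail: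
  assumes [measurable]: "A \<in> sets borel" "B \<in> sets borel" and m: "4 ^ Suc j \<le> m"
    and d: "\<And>z. z \<in> space P \<Longrightarrow> \<bar>wgt B z - wgt A z\<bar> \<le> indicator C (\<zeta> z) + indicator D (\<zeta> z)"
    and [measurable]: "C \<in> sets borel" "D \<in> sets borel"
    and CD: "measure (distr P borel \<zeta>) C \<le> (1/4) ^ j" "measure (distr P borel \<zeta>) D \<le> (1/4) ^ j"
  shows "likely M (2 * exp (2 - (4/3) ^ j)) (\<lambda>w. \<bar>wemp B m w - wemp A m w\<bar> \<le> (2/3) ^ j)"
proof -
  define s :: real where "s = 2 * (1/4) ^ j"
  let ?g = "\<lambda>z. wgt B z - wgt A z"
  have g1: "\<bar>?g z\<bar> \<le> 1" if "z \<in> space P" for z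
    using wgt_bounds[OF that, of A] wgt_bounds[OF that, of B] by linarith
  have "(LINT z|P. (?g z)\<^sup>2) \<le> (LINT z|P. indicator C (\<zeta> z) + indicator D (\<zeta> z))"
  proof (rule integral_mono)
    show "(?g z)\<^sup>2 \<le> indicator C (\<zeta> z) + indicator D (\<zeta> z)" if "z \<in> space P" for z
    proof -
      have "(?g z)\<^sup>2 = \<bar>?g z\<bar> * \<bar>?g z\<bar>" by (simp add: power2_eq_square)
      also have "\<dots> \<le> \<bar>?g z\<bar> * 1" using g1[OF that] by (intro mult_left_mono) auto
      finally show ?thesis using d[OF that] by simp
    qed
    show "integrable P (\<lambda>z. (?g z)\<^sup>2)"
      by (rule integrable_bounded[where B=1]) (use g1 in \<open>auto simp: abs_square_le_1\<close>)
    show "integrable P (\<lambda>z. indicator C (\<zeta> z) + indicator D (\<zeta> z) :: real)"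
      by (rule integrable_bounded[where B=2]) (auto simp: indicator_def)
  qed
  also have "\<dots> = (LINT z|P. indicator C (\<zeta> z)) + (LINT z|P. indicator D (\<zeta> z))"
    by (intro Bochner_Integration.integral_add integrable_bounded[where B=1]) auto
  also have "\<dots> \<le> s" using CD by (simp add: integral_indicator_\<zeta> s_def)
  finally have g2: "(LINT z|P. (?g z)\<^sup>2) \<le> s" .
  have "real (4 ^ Suc j) \<le> real m" using m by (rule of_nat_mono)
  then have "(2 * 2 ^ j)\<^sup>2 \<le> real m" by (simp add: power2_eq_square flip: power_mult_distrib)
  then have l: "2 * 2 ^ j \<le> sqrt m" by (rule real_le_rsqrt)
  have e1: "(2 ^ j)\<^sup>2 * s = 2"
    by (simp add: s_def power2_eq_square flip: power_mult_distrib)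
  have e2: "2 ^ j * (2/3) ^ j = (4/3 :: real) ^ j" by (simp flip: power_mult_distrib)
  have "likely M (2 * exp ((2 ^ j)\<^sup>2 * s - 2 ^ j * (2/3) ^ j)) (\<lambda>w. \<bar>emp ?g m w\<bar> \<le> (2/3) ^ j)"
    using g1 g2 l by (intro emp_tail) auto
  then show ?thesis unfolding e1 e2 by (simp add: emp_diff wgt_integrable wemp_def)
qed

text \<open>A union bound: \<open>K j\<close> pairs of lower and upper bracket and at most
  \<open>K j * K (Suc j)\<close> links between successive lower brackets, each with the failure
  probability of \<open>wemp_diff_tail\<close>.\<close>

definition level_prob :: "nat \<Rightarrow> real" where
  "level_prob j = (K j + K j * K (Suc j)) * (2 * exp (2 - (4/3) ^ j))"

text \<open>Although \<open>u\<close> ranges over a continuum, only the finitely many pairs of sets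
  in \<open>R\<close> and \<open>T\<close> occur, so the exceptional event is a finite
  union.\<close>

lemma level_bound:
  assumes m: "4 ^ Suc j \<le> m"
  shows "likely M (level_prob j) (\<lambda>w. \<forall>u. \<bar>wemp (hi j u) m w - wemp (lo j u) m w\<bar> \<le> (2/3) ^ j \<and>
    \<bar>wemp (lo (Suc j) u) m w - wemp (lo j u) m w\<bar> \<le> (2/3) ^ j)"
proof -
  define R where "R = range (\<lambda>u. (lo j u, hi j u))"
  define S where "S = (\<lambda>(p, q). (fst p, fst q)) ` (R \<times> range (\<lambda>u. (lo (Suc j) u, hi (Suc j) u)))"
  define T where "T = range (\<lambda>u. (lo j u, lo (Suc j) u))"
  have finR: "finite R" and cR: "card R \<le> K j" using brackets_finite brackets_card by (auto simp: R_def)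
  have TS: "T \<subseteq> S" by (force simp: T_def S_def R_def)
  have finR2: "finite (R \<times> range (\<lambda>u. (lo (Suc j) u, hi (Suc j) u)))"
    using finR brackets_finite by (rule finite_cartesian_product)
  then have finS: "finite S" unfolding S_def by (rule finite_imageI)
  have "card T \<le> card S" using TS finS by (rule card_mono[rotated])
  also have "\<dots> \<le> card (R \<times> range (\<lambda>u. (lo (Suc j) u, hi (Suc j) u)))"
    unfolding S_def using finR2 by (rule card_image_le)
  also have "\<dots> \<le> K j * K (Suc j)"
    using cR brackets_card[of "Suc j"] by (auto simp: card_cartesian_product intro!: mult_mono)
  finally have cT: "card T \<le> K j * K (Suc j)" .
  have finRT: "finite (R \<union> T)" using finR TS finS finite_subset by auto
  have "card (R \<union> T) \<le> K j + K j * K (Suc j)" using card_Un_le[of R T] cR cT by linarith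
  then have cRT: "real (card (R \<union> T)) \<le> K j + K j * K (Suc j)" by (metis of_nat_le_iff of_nat_add of_nat_mult)
  have "likely M (\<Sum>p\<in>R \<union> T. 2 * exp (2 - (4/3) ^ j))
    (\<lambda>w. \<forall>p\<in>R \<union> T. \<bar>wemp (snd p) m w - wemp (fst p) m w\<bar> \<le> (2/3) ^ j)"
  proof (rule likely_ball[OF finRT])
    fix p assume "p \<in> R \<union> T"
    then consider u where "p = (lo j u, hi j u)" | u where "p = (lo j u, lo (Suc j) u)"
      by (auto simp: R_def T_def)
    then show "likely M (2 * exp (2 - (4/3) ^ j)) (\<lambda>w. \<bar>wemp (snd p) m w - wemp (fst p) m w\<bar> \<le> (2/3) ^ j)"
    proof cases
      case 1
      have "\<bar>wgt (hi j u) z - wgt (lo j u) z\<bar> \<le> indicator (hi j u - lo j u) (\<zeta> z) + indicator {} (\<zeta> z)"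
        if "z \<in> space P" for z
        using wgt_diff_bound[OF order_trans[OF lo_sub hi_sup] that] by simp
      from wemp_diff_tail[OF _ _ m this] 1 show ?thesis using brackets_measure by simp
    next
      case 2
      have d: "\<bar>wgt (lo (Suc j) u) z - wgt (lo j u) z\<bar>
          \<le> indicator (hi j u - lo j u) (\<zeta> z) + indicator (hi (Suc j) u - lo (Suc j) u) (\<zeta> z)"
        if "z \<in> space P" for z
        using v01[OF that] lo_sub[of j u] lo_sub[of "Suc j" u] hi_sup[of u j] hi_sup[of u "Suc j"]
        by (auto simp: wgt_def indicator_def)
      have b: "measure (distr P borel \<zeta>) (hi (Suc j) u - lo (Suc j) u) \<le> (1/4) ^ j"
        by (rule order_trans[OF brackets_measure]) (simp add: power_decreasing)
      show ?thesis unfolding 2 fst_conv snd_conv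
        by (rule wemp_diff_tail[OF _ _ m d _ _ brackets_measure b]) auto
    qed
  qed
  then show ?thesis
  proof (rule likely_mono)
    show "(\<Sum>p\<in>R \<union> T. 2 * exp (2 - (4/3) ^ j)) \<le> level_prob j"
      using cRT by (simp add: level_prob_def mult_right_mono)
    fix w assume a: "\<forall>p\<in>R \<union> T. \<bar>wemp (snd p) m w - wemp (fst p) m w\<bar> \<le> (2/3) ^ j"
    show "\<forall>u. \<bar>wemp (hi j u) m w - wemp (lo j u) m w\<bar> \<le> (2/3) ^ j \<and>
      \<bar>wemp (lo (Suc j) u) m w - wemp (lo j u) m w\<bar> \<le> (2/3) ^ j"
    proof
      fix u
      have "(lo j u, hi j u) \<in> R \<union> T" "(lo j u, lo (Suc j) u) \<in> R \<union> T" by (auto simp: R_def T_def)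
      from a[rule_format, OF this(1)] a[rule_format, OF this(2)]
      show "\<bar>wemp (hi j u) m w - wemp (lo j u) m w\<bar> \<le> (2/3) ^ j \<and>
        \<bar>wemp (lo (Suc j) u) m w - wemp (lo j u) m w\<bar> \<le> (2/3) ^ j" by simp
    qed
  qed
qed

text \<open>Sums and means of the weights are both monotone in the set. Centring costs the
  difference of the means, at most the mass of the gap, times \<open>sqrt m\<close>.\<close>

lemma wemp_sandwich:
  assumes "A \<subseteq> U" "U \<subseteq> B" and [measurable]: "A \<in> sets borel" "U \<in> sets borel" "B \<in> sets borel"
    and w: "w \<in> space M"
  shows "\<bar>wemp U m w - wemp A m w\<bar> \<le> \<bar>wemp B m w - wemp A m w\<bar>
           + sqrt m * measure (distr P borel \<zeta>) (B - A)"
proof -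
  define I where "I A = (LINT z|P. wgt A z)" for A
  define T where "T A = (\<Sum>i<m. wgt A (W i w))" for A
  have e: "wemp A m w = T A / sqrt m - sqrt m * I A" for A
    by (simp add: wemp_def emp_def T_def I_def sum_subtractf diff_divide_distrib real_div_sqrt
        flip: times_divide_eq_left)
  have "I A \<le> I U" "I U \<le> I B"
    unfolding I_def using assms(1,2) by (auto intro!: integral_mono wgt_integrable wgt_mono)
  then have 1: "sqrt m * I A \<le> sqrt m * I U" "sqrt m * I U \<le> sqrt m * I B"
    by (auto intro: mult_left_mono)
  have "T A \<le> T U" "T U \<le> T B"
    unfolding T_def using assms(1,2) by (auto intro!: sum_mono wgt_mono W_space w)
  then have 2: "T A / sqrt m \<le> T U / sqrt m" "T U / sqrt m \<le> T B / sqrt m"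
    by (auto intro: divide_right_mono)
  have "I B - I A \<le> measure (distr P borel \<zeta>) (B - A)"
    unfolding I_def using assms(1,2) by (intro wgt_integral_diff) auto
  then have "sqrt m * (I B - I A) \<le> sqrt m * measure (distr P borel \<zeta>) (B - A)"
    by (rule mult_left_mono) simp
  then show ?thesis using 1 2 unfolding e right_diff_distrib by linarith
qed

text \<open>Bernstein's inequality controls the increments down to the level \<open>J\<close> with mesh
  \<open>4\<^sup>-\<^sup>J\<close> of order \<open>1/m\<close>; below it, monotonicity of \<open>A \<mapsto> wgt A\<close> suffices,
  because \<open>sqrt m * 4\<^sup>-\<^sup>J\<close> is small.\<close>

lemma chaining:
  assumes m: "4 ^ Suc J \<le> m" "m < 4 ^ Suc (Suc J)" and "j0 \<le> J"
  shows "likely M (\<Sum>j\<in>{j0..J}. level_prob j)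
    (\<lambda>w. \<forall>j\<in>{j0..J}. \<forall>u. \<bar>wemp {..u} m w - wemp (lo j u) m w\<bar> \<le> 7 * (2/3) ^ j)"
proof -
  have lev: "likely M (level_prob j) (\<lambda>w. \<forall>u. \<bar>wemp (hi j u) m w - wemp (lo j u) m w\<bar> \<le> (2/3) ^ j \<and>
    \<bar>wemp (lo (Suc j) u) m w - wemp (lo j u) m w\<bar> \<le> (2/3) ^ j)" if "j \<in> {j0..J}" for j
  proof (rule level_bound)
    have "(4::nat) ^ Suc j \<le> 4 ^ Suc J" using that by (intro power_increasing) auto
    then show "4 ^ Suc j \<le> m" using m(1) by linarith
  qed
  show ?thesis
  proof (rule likely_mono[OF likely_ball[OF _ lev]])
    fix w assume w: "w \<in> space M"
    assume a: "\<forall>j\<in>{j0..J}. \<forall>u. \<bar>wemp (hi j u) m w - wemp (lo j u) m w\<bar> \<le> (2/3) ^ j \<and>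
      \<bar>wemp (lo (Suc j) u) m w - wemp (lo j u) m w\<bar> \<le> (2/3) ^ j"
    show "\<forall>j\<in>{j0..J}. \<forall>u. \<bar>wemp {..u} m w - wemp (lo j u) m w\<bar> \<le> 7 * (2/3) ^ j"
    proof (intro ballI allI)
      fix j u assume j: "j \<in> {j0..J}"
      have "j \<le> J" using j by simp
      \<comment> \<open>Telescoping: the sum of \<open>(2/3) ^ i\<close> over
        \<open>j \<le> i < J\<close> is \<open>3 * (2/3) ^ j - 3 * (2/3) ^ J\<close>.\<close>
      then have chain: "\<bar>wemp (lo J u) m w - wemp (lo j u) m w\<bar> \<le> 3 * (2/3) ^ j - 3 * (2/3) ^ J"
        using j
      proof (induction j rule: inc_induct)
        case base then show ?case by simp
      next
        case (step n)
        have "n \<in> {j0..J}" using step j by simp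
        then have "\<bar>wemp (lo (Suc n) u) m w - wemp (lo n u) m w\<bar> \<le> (2/3) ^ n" using a by blast
        moreover have "\<bar>wemp (lo J u) m w - wemp (lo (Suc n) u) m w\<bar> \<le> 3 * (2/3) ^ Suc n - 3 * (2/3) ^ J"
          using step by simp
        ultimately show ?case by (simp add: abs_le_iff)
      qed
      \<comment> \<open>The upper bound on \<open>m\<close> turns the drift
        \<open>sqrt m * (1/4) ^ J\<close> into at most \<open>4 * (1/2) ^ J\<close>.\<close>
      have sm: "sqrt m \<le> 4 * 2 ^ J"
      proof (rule real_le_lsqrt)
        have "real m < real (4 ^ Suc (Suc J))" using m(2) by (simp only: of_nat_less_iff)
        also have "\<dots> = (4 * 2 ^ J)\<^sup>2" by (simp add: power2_eq_square flip: power_mult_distrib)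
        finally show "real m \<le> (4 * 2 ^ J)\<^sup>2" by simp
      qed simp
      have "\<bar>wemp {..u} m w - wemp (lo J u) m w\<bar> \<le> \<bar>wemp (hi J u) m w - wemp (lo J u) m w\<bar>
           + sqrt m * measure (distr P borel \<zeta>) (hi J u - lo J u)"
        using lo_sub hi_sup w by (intro wemp_sandwich) auto
      also have "\<dots> \<le> (2/3) ^ J + (4 * 2 ^ J) * (1/4) ^ J"
        using a assms(3) sm brackets_measure by (intro add_mono mult_mono) auto
      also have "(4 * 2 ^ J) * (1/4) ^ J = 4 * (1/2 :: real) ^ J"
        by (simp flip: power_mult_distrib)
      also have "\<dots> \<le> 4 * (2/3) ^ J" by (intro mult_left_mono power_mono) auto
      finally have "\<bar>wemp {..u} m w - wemp (lo J u) m w\<bar> \<le> 5 * (2/3) ^ J" by simp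
      moreover have "(2/3 :: real) ^ J \<le> (2/3) ^ j" using \<open>j \<le> J\<close> by (intro power_decreasing) auto
      \<comment> \<open>The telescoped links and the factor \<open>5\<close> at level
        \<open>J\<close> give at most \<open>5 * (2/3) ^ j\<close>, within the stated
        \<open>7\<close>.\<close>
      ultimately show "\<bar>wemp {..u} m w - wemp (lo j u) m w\<bar> \<le> 7 * (2/3) ^ j"
        using chain zero_le_power[of "2/3::real" j] by linarith
    qed
  qed auto
qed

text \<open>A tail of the series \<open>level_prob\<close> bounds the failure of all levels from
  \<open>j0\<close> on at once, so \<open>j0\<close> depends on \<open>\<eta>\<close> but not on
  \<open>N\<close>. The last level \<open>J\<close> of the chain grows with \<open>m\<close> and
  eventually passes any given \<open>N\<close>.\<close>

lemma asymptotic_equicontinuity: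
  assumes sum: "summable level_prob" and \<eta>: "\<eta> > 0"
  obtains j0 where "\<And>N. N \<ge> j0 \<Longrightarrow> \<forall>\<^sub>F m in sequentially. likely M \<eta>
    (\<lambda>w. \<forall>j\<in>{j0..N}. \<forall>u. \<bar>wemp {..u} m w - wemp (lo j u) m w\<bar> \<le> 7 * (2/3) ^ j)"
proof -
  obtain j0 where j0: "\<And>J n. J \<ge> j0 \<Longrightarrow> norm (sum level_prob {J..<n}) < \<eta>"
    using sum \<eta> unfolding summable_Cauchy by blast
  show ?thesis
  proof (rule that[of j0])
    fix N assume N: "N \<ge> j0"
    show "\<forall>\<^sub>F m in sequentially. likely M \<eta>
      (\<lambda>w. \<forall>j\<in>{j0..N}. \<forall>u. \<bar>wemp {..u} m w - wemp (lo j u) m w\<bar> \<le> 7 * (2/3) ^ j)"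
      using eventually_ge_at_top[of "4 ^ Suc N :: nat"]
    proof eventually_elim
      case (elim m)
      have "1 \<le> m" using elim by (rule order_trans[rotated]) simp
      then obtain i where i: "4 ^ i \<le> m" "m < 4 ^ (i + 1)" using ex_power_ivl1[of 4 m] by auto
      have "(4::nat) ^ Suc N < 4 ^ (i + 1)" using elim i by linarith
      then have "Suc N < i + 1" by (rule power_less_imp_less_exp[rotated]) simp
      then obtain J where J: "i = Suc J" "N \<le> J" by (cases i) auto
      have "likely M (\<Sum>j\<in>{j0..J}. level_prob j)
        (\<lambda>w. \<forall>j\<in>{j0..J}. \<forall>u. \<bar>wemp {..u} m w - wemp (lo j u) m w\<bar> \<le> 7 * (2/3) ^ j)"
        using i J N by (intro chaining) auto
      then show ?case
      proof (rule likely_mono)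
        have "norm (sum level_prob {j0..<Suc J}) < \<eta>" by (rule j0) simp
        then show "(\<Sum>j\<in>{j0..J}. level_prob j) \<le> \<eta>" by (simp add: atLeastLessThanSuc_atLeastAtMost)
      qed (use J in auto)
    qed
  qed
qed

end

section \<open>Hadamard derivatives\<close>

text \<open>Makes explicit the functional \<open>L\<close> that
  \<open>hadamard_differentiable\<close> hides under an existential quantifier.\<close>

definition hadamard_derivative ::
    "(('a \<Rightarrow> real) \<Rightarrow> real) \<Rightarrow> ('a \<Rightarrow> real) set \<Rightarrow> ('a \<Rightarrow> real) \<Rightarrow> (('a \<Rightarrow> real) \<Rightarrow> real) \<Rightarrow> bool" where
  "hadamard_derivative \<Phi> D F L \<longleftrightarrow> sup_norm_bounded_linear L \<and>
     (\<forall>(t :: nat \<Rightarrow> real) h h0.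
        (\<forall>k. t k > 0) \<longrightarrow> t \<longlonglongrightarrow> 0 \<longrightarrow>
        (\<forall>k. bounded_fun (h k)) \<longrightarrow> bounded_fun h0 \<longrightarrow> uniform_limit UNIV h h0 sequentially \<longrightarrow>
        (\<forall>k. (\<lambda>u. F u + t k * h k u) \<in> D) \<longrightarrow>
        (\<lambda>k. (\<Phi> (\<lambda>u. F u + t k * h k u) - \<Phi> F) / t k) \<longlonglongrightarrow> L h0)"

lemma bounded_funI: "(\<And>u. \<bar>h u\<bar> \<le> R) \<Longrightarrow> bounded_fun h"
  unfolding bounded_fun_def bounded_iff by auto

lemma hadamard_derivativeD:
  assumes "hadamard_derivative \<Phi> D F L" "\<And>k. t k > 0" "t \<longlonglongrightarrow> 0" "\<And>k. bounded_fun (h k)"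
    "bounded_fun h0" "uniform_limit UNIV h h0 sequentially" "\<And>k. (\<lambda>u. F u + t k * h k u) \<in> D"
  shows "(\<lambda>k. (\<Phi> (\<lambda>u. F u + t k * h k u) - \<Phi> F) / t k) \<longlonglongrightarrow> L h0"
  using assms unfolding hadamard_derivative_def by simp

text \<open>Trades the supremum for any pointwise bound \<open>R\<close>; the constant
  \<open>\<bar>K\<bar> + 1\<close> is positive whatever the sign of \<open>K\<close>.\<close>

lemma sup_norm_bounded_linear_bound:
  fixes L :: "('a \<Rightarrow> real) \<Rightarrow> real"
  assumes "sup_norm_bounded_linear L"
  obtains K where "K > 0" "\<And>h R. (\<And>u. \<bar>h u\<bar> \<le> R) \<Longrightarrow> \<bar>L h\<bar> \<le> K * R"
proof -
  obtain K where K: "\<And>h. bounded_fun h \<Longrightarrow> \<bar>L h\<bar> \<le> K * (SUP u. \<bar>h u\<bar>)"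
    using assms by (auto simp: sup_norm_bounded_linear_def)
  show ?thesis
  proof (rule that[of "\<bar>K\<bar> + 1"])
    fix h :: "'a \<Rightarrow> real" and R :: real assume h: "\<And>u. \<bar>h u\<bar> \<le> R"
    have s: "(SUP u. \<bar>h u\<bar>) \<le> R" using h by (intro cSUP_least) auto
    have "\<bar>h undefined\<bar> \<le> (SUP u. \<bar>h u\<bar>)" using h by (intro cSUP_upper bdd_aboveI2) auto
    then have s0: "0 \<le> (SUP u. \<bar>h u\<bar>)" by linarith
    have "\<bar>L h\<bar> \<le> K * (SUP u. \<bar>h u\<bar>)" using h by (intro K bounded_funI)
    also have "\<dots> \<le> (\<bar>K\<bar> + 1) * R" using s s0 by (intro mult_mono) auto
    finally show "\<bar>L h\<bar> \<le> (\<bar>K\<bar> + 1) * R" .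
  qed simp
qed

lemma sup_norm_bounded_linear_diff:
  assumes L: "sup_norm_bounded_linear L" and "bounded_fun g" "bounded_fun h"
  shows "L (\<lambda>u. g u - h u) = L g - L h"
proof -
  have m: "L (\<lambda>u. -1 * h u) = -1 * L h"
    using L assms(3) unfolding sup_norm_bounded_linear_def by blast
  have b: "bounded_fun (\<lambda>u. -1 * h u)" using assms(3) by (auto simp: bounded_fun_def bounded_iff)
  have "L (\<lambda>u. g u + -1 * h u) = L g + L (\<lambda>u. -1 * h u)"
    using L assms(2) b unfolding sup_norm_bounded_linear_def by blast
  then show ?thesis using m by simp
qed

lemma sup_norm_bounded_linear_sum:
  assumes L: "sup_norm_bounded_linear L" and h: "\<And>i. i \<in> I \<Longrightarrow> bounded_fun (h i)" and "finite I"
  shows "L (\<lambda>u. \<Sum>i\<in>I. c i * h i u) = (\<Sum>i\<in>I. c i * L (h i)) \<and> bounded_fun (\<lambda>u. \<Sum>i\<in>I. c i * h i u)"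
  using assms(3) h
proof (induction I rule: finite_induct)
  case empty
  have b: "bounded_fun (\<lambda>_. 0)" by (rule bounded_funI[of _ 0]) simp
  have "L (\<lambda>u. 0 * 0) = 0 * L (\<lambda>_. 0)"
    using L b unfolding sup_norm_bounded_linear_def by blast
  then show ?case using b by simp
next
  case (insert i I)
  obtain B where B: "\<And>u. \<bar>h i u\<bar> \<le> B"
    using insert.prems[of i] by (auto simp: bounded_fun_def bounded_iff)
  have b: "bounded_fun (\<lambda>u. c i * h i u)"
    by (rule bounded_funI[of _ "\<bar>c i\<bar> * B"]) (auto simp: abs_mult intro!: mult_left_mono B)
  have IH: "L (\<lambda>u. \<Sum>i\<in>I. c i * h i u) = (\<Sum>i\<in>I. c i * L (h i))"
    "bounded_fun (\<lambda>u. \<Sum>i\<in>I. c i * h i u)" using insert by auto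
  have "L (\<lambda>u. c i * h i u + (\<Sum>i\<in>I. c i * h i u)) = L (\<lambda>u. c i * h i u) + L (\<lambda>u. \<Sum>i\<in>I. c i * h i u)"
    using L b IH(2) unfolding sup_norm_bounded_linear_def by blast
  moreover have "L (\<lambda>u. c i * h i u) = c i * L (h i)"
    using L insert.prems[of i] unfolding sup_norm_bounded_linear_def by blast
  moreover obtain B' where B': "\<And>u. \<bar>\<Sum>i\<in>I. c i * h i u\<bar> \<le> B'"
    using IH(2) by (auto simp: bounded_fun_def bounded_iff)
  have "bounded_fun (\<lambda>u. c i * h i u + (\<Sum>i\<in>I. c i * h i u))"
    by (rule bounded_funI[of _ "\<bar>c i\<bar> * B + B'"])
      (auto simp: abs_mult intro!: mult_left_mono B B' order_trans[OF abs_triangle_ineq] add_mono)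
  ultimately show ?case using insert.hyps IH(1) by simp
qed

text \<open>Functions whose oscillation over finite partitions is controlled at every level form a
  relatively compact set for the supremum norm (Arzela--Ascoli), on which a Hadamard derivative
  approximates uniformly; \<open>N\<close> and \<open>\<delta>\<close> express that only finitely many levels matter.\<close>

lemma hadamard_derivative_uniform:
  fixes cell :: "nat \<Rightarrow> 'a \<Rightarrow> 'c" and e :: "nat \<Rightarrow> real"
  assumes H: "hadamard_derivative \<Phi> D F L"
    and fin: "\<And>j. finite (range (cell j))" and e: "e \<longlonglongrightarrow> 0" and \<epsilon>: "\<epsilon> > 0"
  obtains N \<delta> where "N \<ge> j0" "\<delta> > 0"
    "\<And>t h. 0 < t \<Longrightarrow> t < \<delta> \<Longrightarrow> (\<And>u. \<bar>h u\<bar> \<le> R) \<Longrightarrow>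
      (\<And>j u u'. j \<in> {j0..N} \<Longrightarrow> cell j u = cell j u' \<Longrightarrow> \<bar>h u - h u'\<bar> \<le> e j) \<Longrightarrow>
      (\<lambda>u. F u + t * h u) \<in> D \<Longrightarrow> \<bar>(\<Phi> (\<lambda>u. F u + t * h u) - \<Phi> F) / t - L h\<bar> \<le> \<epsilon>"
proof (rule ccontr)
  assume neg: "\<not> thesis"
  have L: "sup_norm_bounded_linear L" using H by (simp add: hadamard_derivative_def)
  \<comment> \<open>A counterexample for \<open>\<delta> = 1 / (n + 1)\<close> and levels up to
    \<open>max n j0\<close>. A sequence of these is shown to have a uniformly convergent subsequence
    of directions.\<close>
  define bad where "bad n t h \<longleftrightarrow> 0 < t \<and> t < 1 / (real n + 1) \<and> (\<forall>u. \<bar>h u\<bar> \<le> R) \<and>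
      (\<forall>j\<in>{j0..max n j0}. \<forall>u u'. cell j u = cell j u' \<longrightarrow> \<bar>h u - h u'\<bar> \<le> e j) \<and>
      (\<lambda>u. F u + t * h u) \<in> D \<and> \<not> \<bar>(\<Phi> (\<lambda>u. F u + t * h u) - \<Phi> F) / t - L h\<bar> \<le> \<epsilon>" for n t h
  have "\<exists>t h. bad n t h" for n
  proof (rule ccontr)
    assume none: "\<not> ?thesis"
    have thesis
    proof (rule that[of "max n j0" "1 / (real n + 1)"])
      fix t h
      assume "0 < t" "t < 1 / (real n + 1)" "\<And>u. \<bar>h u\<bar> \<le> R"
        "\<And>j u u'. j \<in> {j0..max n j0} \<Longrightarrow> cell j u = cell j u' \<Longrightarrow> \<bar>h u - h u'\<bar> \<le> e j"
        "(\<lambda>u. F u + t * h u) \<in> D"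
      then show "\<bar>(\<Phi> (\<lambda>u. F u + t * h u) - \<Phi> F) / t - L h\<bar> \<le> \<epsilon>"
        using none unfolding bad_def by blast
    qed auto
    with neg show False ..
  qed
  then obtain t h where th: "\<And>n. bad n (t n) (h n)" by metis
  have t: "0 < t n" "t n < 1 / (real n + 1)" and R: "\<bar>h n u\<bar> \<le> R"
    and osc: "j \<in> {j0..max n j0} \<Longrightarrow> cell j u = cell j u' \<Longrightarrow> \<bar>h n u - h n u'\<bar> \<le> e j"
    and D: "(\<lambda>u. F u + t n * h n u) \<in> D"
    and far: "\<not> \<bar>(\<Phi> (\<lambda>u. F u + t n * h n u) - \<Phi> F) / t n - L (h n)\<bar> \<le> \<epsilon>" for n j u u'
    using th[of n] unfolding bad_def by blast+
  \<comment> \<open>One representative per cell and level: countably many points, on which a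
    diagonal subsequence converges.\<close>
  define S where "S = (\<Union>j. inv (cell j) ` range (cell j))"
  have "countable (inv (cell j) ` range (cell j))" for j
    using countable_finite[OF fin[of j]] by (rule countable_image)
  then have "countable S" unfolding S_def by (intro countable_UN) auto
  then obtain k where k: "strict_mono (k :: nat \<Rightarrow> nat)"
    and conv: "\<And>x. x \<in> S \<Longrightarrow> \<exists>l. (\<lambda>n. h (k n) x) \<longlonglongrightarrow> l"
    by (rule function_convergent_subsequence[of S h R]) (auto simp: R intro: that)
  have "uniformly_Cauchy_on UNIV (\<lambda>n. h (k n))"
    unfolding uniformly_Cauchy_on_def
  proof (intro allI impI)
    fix r :: real assume r: "r > 0"
    have "\<forall>\<^sub>F j in sequentially. j \<ge> j0 \<and> dist (e j) 0 < r / 3"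
      using tendstoD[OF e, of "r / 3"] r by (intro eventually_conj eventually_ge_at_top) auto
    then obtain j where j: "j \<ge> j0" "e j < r / 3"
      using eventually_happens'[OF sequentially_bot] by (force simp: dist_real_def)
    have "\<exists>M. \<forall>m\<ge>M. \<forall>n\<ge>M. dist (h (k m) (inv (cell j) c)) (h (k n) (inv (cell j) c)) < r / 3"
      if "c \<in> range (cell j)" for c
    proof -
      have "convergent (\<lambda>n. h (k n) (inv (cell j) c))"
        using conv[of "inv (cell j) c"] that by (auto simp: S_def convergent_def)
      then have "Cauchy (\<lambda>n. h (k n) (inv (cell j) c))" by (rule convergent_Cauchy)
      then show ?thesis using r unfolding Cauchy_def by (metis zero_less_divide_iff zero_less_numeral)
    qed
    then obtain M where M: "\<And>c m n. c \<in> range (cell j) \<Longrightarrow> m \<ge> M c \<Longrightarrow> n \<ge> M c \<Longrightarrow>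
        dist (h (k m) (inv (cell j) c)) (h (k n) (inv (cell j) c)) < r / 3" by metis
    \<comment> \<open>From \<open>j\<close> on the oscillation bound of level \<open>j\<close> is
      available, since \<open>k i \<ge> i\<close>. The maximum makes the Cauchy condition hold at
      all the finitely many representatives; three errors below \<open>r / 3\<close> then add
      up.\<close>
    define M0 where "M0 = max j (Max (M ` range (cell j)))"
    have "dist (h (k m) x) (h (k n) x) < r" if "m \<ge> M0" "n \<ge> M0" for x m n
    proof -
      define y where "y = inv (cell j) (cell j x)"
      have y: "cell j x = cell j y" by (simp add: y_def f_inv_into_f)
      have "M (cell j x) \<le> M0" unfolding M0_def using fin by (intro max.coboundedI2 Max_ge) auto
      then have 1: "dist (h (k m) y) (h (k n) y) < r / 3"
        unfolding y_def using that by (intro M) auto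
      have "j \<le> k i" if "i \<ge> M0" for i
        using seq_suble[OF k, of i] that by (auto simp: M0_def)
      then have "j \<in> {j0..max (k m) j0}" "j \<in> {j0..max (k n) j0}" using that j by force+
      then have "\<bar>h (k m) x - h (k m) y\<bar> \<le> e j" "\<bar>h (k n) x - h (k n) y\<bar> \<le> e j"
        using osc y by blast+
      then show ?thesis using 1 j(2) unfolding dist_real_def by linarith
    qed
    then show "\<exists>M. \<forall>x\<in>UNIV. \<forall>m\<ge>M. \<forall>n\<ge>M. dist (h (k m) x) (h (k n) x) < r" by blast
  qed
  then obtain h0 where h0: "uniform_limit UNIV (\<lambda>n. h (k n)) h0 sequentially"
    using Cauchy_uniformly_convergent uniformly_convergent_on_def by blast
  have h0R: "\<bar>h0 u\<bar> \<le> R" for u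
  proof -
    have "(\<lambda>n. h (k n) u) \<longlonglongrightarrow> h0 u" using h0 by (rule tendsto_uniform_limitI) simp
    then show ?thesis by (intro tendsto_upperbound[OF tendsto_rabs]) (auto simp: R)
  qed
  have tk: "(\<lambda>n. t (k n)) \<longlonglongrightarrow> 0"
  proof -
    have "t \<longlonglongrightarrow> 0"
    proof (rule tendsto_sandwich[of "\<lambda>_. 0" _ _ "\<lambda>n. 1 / (real n + 1)"])
      show "(\<lambda>n. 1 / (real n + 1)) \<longlonglongrightarrow> 0" by real_asymp
    qed (use t less_imp_le in \<open>auto intro!: always_eventually\<close>)
    from LIMSEQ_subseq_LIMSEQ[OF this k] show ?thesis by (simp add: o_def)
  qed
  have "(\<lambda>n. (\<Phi> (\<lambda>u. F u + t (k n) * h (k n) u) - \<Phi> F) / t (k n)) \<longlonglongrightarrow> L h0"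
    by (rule hadamard_derivativeD[OF H t(1) tk bounded_funI[OF R] bounded_funI[OF h0R] h0 D])
  \<comment> \<open>Quotients and values of \<open>L\<close> along the subsequence share the limit
    \<open>L h0\<close>, although every counterexample keeps them more than
    \<open>\<epsilon>\<close> apart.\<close>
  moreover have "(\<lambda>n. L (h (k n))) \<longlonglongrightarrow> L h0"
  proof -
    obtain K where K: "K > 0" "\<And>h R. (\<And>u. \<bar>h u\<bar> \<le> R) \<Longrightarrow> \<bar>L h\<bar> \<le> K * R"
      using sup_norm_bounded_linear_bound[OF L] by blast
    show ?thesis
    proof (rule tendstoI)
      fix r :: real assume r: "r > 0"
      have "\<forall>\<^sub>F n in sequentially. \<forall>u\<in>UNIV. dist (h (k n) u) (h0 u) < r / (2 * K)"
        using h0 r K by (intro uniform_limitD) auto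
      then show "\<forall>\<^sub>F n in sequentially. dist (L (h (k n))) (L h0) < r"
      proof eventually_elim
        case (elim n)
        have "\<bar>L (\<lambda>u. h (k n) u - h0 u)\<bar> \<le> K * (r / (2 * K))"
          by (rule K(2)) (use elim in \<open>auto simp: dist_real_def less_imp_le\<close>)
        also have "L (\<lambda>u. h (k n) u - h0 u) = L (h (k n)) - L h0"
          by (intro sup_norm_bounded_linear_diff L bounded_funI[OF R] bounded_funI[OF h0R])
        finally show ?case using K(1) r by (simp add: dist_real_def)
      qed
    qed
  qed
  ultimately have "(\<lambda>n. (\<Phi> (\<lambda>u. F u + t (k n) * h (k n) u) - \<Phi> F) / t (k n) - L (h (k n))) \<longlonglongrightarrow> L h0 - L h0"
    by (rule tendsto_diff)
  then have "\<forall>\<^sub>F n in sequentially. dist ((\<Phi> (\<lambda>u. F u + t (k n) * h (k n) u) - \<Phi> F) / t (k n) - L (h (k n))) 0 < \<epsilon>"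
    using \<epsilon> by (intro tendstoD) auto
  then obtain n where "dist ((\<Phi> (\<lambda>u. F u + t (k n) * h (k n) u) - \<Phi> F) / t (k n) - L (h (k n))) 0 < \<epsilon>"
    by (auto simp: eventually_sequentially)
  then show False using far[of "k n"] by (simp add: dist_real_def)
qed

section \<open>Weighted plug-in estimators\<close>

lemma cdfs_bounds:
  assumes "F \<in> cdfs"
  shows "0 \<le> F u" "F u \<le> 1"
  using assms by (auto simp: cdfs_def prob_space.prob_le_1)

text \<open>Draw from the point mass at \<open>z\<close> with probability \<open>t\<close> and from
  the law of \<open>F\<close> otherwise. This keeps the one-sided quotients of the influence
  function inside the domain.\<close>

lemma cdfs_mixture:
  assumes F: "F \<in> cdfs" and t: "0 \<le> t" "t \<le> 1"
  shows "(\<lambda>u. F u + t * (of_bool (z \<le> u) - F u)) \<in> cdfs"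
proof -
  obtain \<mu> where \<mu>: "prob_space \<mu>" "sets \<mu> = sets borel" "F = (\<lambda>u. measure \<mu> {..u})"
    using F by (auto simp: cdfs_def)
  define \<kappa> where "\<kappa> b = (if b then return borel z else \<mu>)" for b
  have \<kappa>: "prob_space (\<kappa> b)" "sets (\<kappa> b) = sets borel" for b
    using \<mu> by (auto simp: \<kappa>_def prob_space_return)
  have m: "\<kappa> \<in> measurable (measure_pmf (bernoulli_pmf t)) (subprob_algebra borel)"
    using \<kappa> by (auto simp: measurable_pmf_measure1 space_subprob_algebra prob_space_imp_subprob_space)
  let ?N = "measure_pmf (bernoulli_pmf t) \<bind> \<kappa>"
  have N: "prob_space ?N" "sets ?N = sets borel"
    using m \<kappa> by (auto intro!: measure_pmf.prob_space_bind sets_bind[where N=borel])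
  have "measure ?N {..u} = F u + t * (of_bool (z \<le> u) - F u)" for u
  proof -
    have "measure ?N {..u} = (LINT b|measure_pmf (bernoulli_pmf t). measure (\<kappa> b) {..u})"
      by (rule measure_pmf.measure_bind[OF m]) simp
    also have "\<dots> = measure (\<kappa> True) {..u} * t + measure (\<kappa> False) {..u} * (1 - t)"
      using t by (simp add: integral_bernoulli_pmf)
    also have "\<dots> = F u + t * (of_bool (z \<le> u) - F u)"
      by (simp add: \<kappa>_def \<mu>(3) measure_return indicator_def algebra_simps)
    finally show ?thesis .
  qed
  then show ?thesis unfolding cdfs_def using N by (auto intro!: exI[of _ ?N])
qed

text \<open>It is the CDF of \<open>z i\<close> for an index \<open>i\<close> drawn with probability
  proportional to \<open>v i\<close>.\<close>

lemma weighted_ecdf_in_cdfs: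
  assumes v: "\<And>i. i < m \<Longrightarrow> 0 \<le> v i" and s: "(\<Sum>i<m. v i) > 0"
  shows "weighted_ecdf v z m \<in> cdfs"
proof -
  define S where "S = (\<Sum>i<m. v i)"
  have S: "S > 0" using s by (simp add: S_def)
  define N where "N = point_measure {..<m} (\<lambda>i. ennreal (v i / S))"
  have em: "emeasure N X = ennreal (\<Sum>i\<in>X. v i / S)" if "X \<subseteq> {..<m}" for X
    unfolding N_def using that v S by (subst emeasure_point_measure_finite) (auto simp: sum_ennreal subset_eq)
  have sp: "space N = {..<m}" "sets N = Pow {..<m}"
    by (simp_all add: N_def space_point_measure sets_point_measure)
  have pN: "prob_space N"
    using S by (intro prob_spaceI) (simp add: em sp S_def flip: sum_divide_distrib)
  have mz: "z \<in> measurable N borel" by (auto simp: measurable_def sp)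
  have "measure (distr N borel z) {..u} = weighted_ecdf v z m u" for u
  proof -
    have "measure (distr N borel z) {..u} = measure N {i. i < m \<and> z i \<le> u}"
      using mz by (subst measure_distr) (auto simp: sp intro!: arg_cong[where f="measure N"])
    also have "\<dots> = (\<Sum>i | i < m \<and> z i \<le> u. v i / S)"
      unfolding measure_def using v S by (subst em) (auto intro!: enn2real_ennreal sum_nonneg)
    also have "\<dots> = (\<Sum>i<m. v i * of_bool (z i \<le> u)) / S"
      by (simp add: sum_divide_distrib of_bool_def if_distrib sum.If_cases Int_def conj_commute
          cong: if_cong)
    finally show ?thesis by (simp add: weighted_ecdf_def S_def)
  qed
  then have "weighted_ecdf v z m = (\<lambda>u. measure (distr N borel z) {..u})" by auto
  then show ?thesis unfolding cdfs_def
    using prob_space.prob_space_distr[OF pN mz] by (auto intro!: exI[of _ "distr N borel z"])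
qed

lemma hadamard_differentiableE:
  assumes "hadamard_differentiable \<Phi> D F"
  obtains L where "F \<in> D" "sup_norm_bounded_linear L" "hadamard_derivative \<Phi> D F L"
  using assms unfolding hadamard_differentiable_def hadamard_derivative_def by blast

text \<open>The Gateaux quotient is a Hadamard quotient along a constant sequence of
  directions.\<close>

lemma influence_function_eq:
  assumes H: "hadamard_derivative \<Phi> cdfs F L" and F: "F \<in> cdfs"
  shows "influence_function \<Phi> F z = L (\<lambda>u. of_bool (z \<le> u) - F u)"
proof -
  let ?h = "\<lambda>u. of_bool (z \<le> u) - F u"
  have bh: "bounded_fun ?h"
  proof (rule bounded_funI)
    show "\<bar>of_bool (z \<le> u) - F u\<bar> \<le> 1" for u
      using cdfs_bounds[OF F, of u] by (simp add: abs_le_iff)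
  qed
  have "((\<lambda>t. (\<Phi> (\<lambda>u. F u + t * ?h u) - \<Phi> F) / t) \<longlongrightarrow> L ?h) (at_right 0)"
  proof (rule tendsto_at_right_sequentially[of 0 1])
    fix S :: "nat \<Rightarrow> real" assume S: "\<And>n. 0 < S n" "\<And>n. S n < 1" "S \<longlonglongrightarrow> 0"
    show "(\<lambda>n. (\<Phi> (\<lambda>u. F u + S n * ?h u) - \<Phi> F) / S n) \<longlonglongrightarrow> L ?h"
      by (rule hadamard_derivativeD[OF H S(1,3) bh bh])
        (use S in \<open>auto intro!: cdfs_mixture F less_imp_le uniform_limit_const\<close>)
  qed simp
  then show ?thesis
    unfolding influence_function_def gateaux_derivative_def by (intro tendsto_Lim) auto
qed

lemma summable_power_exp_neg_exp:
  fixes B c :: real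
  assumes "B > 1" "c > 1"
  shows "summable (\<lambda>j. B ^ j * exp (- (c ^ j)))"
proof (rule summable_comparison_test_bigo)
  show "summable (\<lambda>j. norm ((1/2 :: real) ^ j))" by (simp add: summable_geometric)
  show "(\<lambda>j. B ^ j * exp (- (c ^ j))) \<in> O(\<lambda>j. (1/2) ^ j)"
    using assms by real_asymp
qed

lemma exists_bracketed_orthants:
  fixes \<zeta> :: "'s \<Rightarrow> 'e::ordered_euclidean_space"
  assumes iid: "iid_sample M P W"
    and v: "v \<in> borel_measurable P" "\<And>z. z \<in> space P \<Longrightarrow> 0 \<le> v z" "\<And>z. z \<in> space P \<Longrightarrow> v z \<le> 1"
    and \<zeta>: "\<zeta> \<in> borel_measurable P"
  obtains lo hi K where "bracketed_orthants M P W v \<zeta> lo hi K"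
    "summable (bracketed_orthants.level_prob K)"
proof -
  interpret iid_sample M P W by fact
  interpret \<mu>: prob_space "distr P borel \<zeta>" using \<zeta> by (rule P.prob_space_distr)
  define D where "D = DIM('e)"
  have D: "D > 0" by (simp add: D_def)
  \<comment> \<open>With \<open>N = D * 4 ^ j\<close> steps per coordinate, the bracket mass
    \<open>DIM('e) / N\<close> becomes \<open>(1/4) ^ j\<close>.\<close>
  define K where "K j = (D * 4 ^ j + 1) ^ D" for j
  define good where "good j p \<longleftrightarrow> finite (range p) \<and> card (range p) \<le> K j \<and>
    (\<forall>u. fst (p u) \<in> sets borel \<and> snd (p u) \<in> sets borel \<and> fst (p u) \<subseteq> {..u} \<and> {..u} \<subseteq> snd (p u) \<and>
      measure (distr P borel \<zeta>) (snd (p u) - fst (p u)) \<le> (1/4) ^ j)" for j and p :: "'e \<Rightarrow> 'e set \<times> 'e set"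
  have "\<exists>p. good j p" for j
  proof -
    have N: "D * 4 ^ j > 0" using D by simp
    obtain l h :: "'e \<Rightarrow> 'e set" where lh: "finite (range (\<lambda>u. (l u, h u)))"
      "card (range (\<lambda>u. (l u, h u))) \<le> (D * 4 ^ j + 1) ^ DIM('e)"
      "\<And>u. l u \<in> sets borel" "\<And>u. h u \<in> sets borel" "\<And>u. l u \<subseteq> {..u}" "\<And>u. {..u} \<subseteq> h u"
      "\<And>u. measure (distr P borel \<zeta>) (h u - l u) \<le> DIM('e) / (D * 4 ^ j)"
      by (rule orthant_brackets[OF \<mu>.prob_space_axioms sets_distr N]) (rule that)
    have "good j (\<lambda>u. (l u, h u))"
      using lh D unfolding good_def by (simp add: K_def power_divide flip: D_def)
    then show ?thesis by blast
  qed
  then obtain p where p: "\<And>j. good j (p j)" by metis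
  define lo hi where "lo j u = fst (p j u)" and "hi j u = snd (p j u)" for j u
  have peq: "(\<lambda>u. (lo j u, hi j u)) = p j" for j by (simp add: lo_def hi_def fun_eq_iff)
  interpret bracketed_orthants M P W v \<zeta> lo hi K
  proof
    show "finite (range (\<lambda>u. (lo j u, hi j u)))" "card (range (\<lambda>u. (lo j u, hi j u))) \<le> K j"
      "lo j u \<in> sets borel" "hi j u \<in> sets borel" "lo j u \<subseteq> {..u}" "{..u} \<subseteq> hi j u"
      "measure (distr P borel \<zeta>) (hi j u - lo j u) \<le> (1/4) ^ j" for j u
      using p[of j] unfolding peq good_def by (auto simp: lo_def hi_def)
  qed (use v \<zeta> in auto)
  have Kj: "real (K j) \<le> (2 * D) ^ D * (4 ^ D) ^ j" for j
  proof -
    have "real (K j) = (real D * 4 ^ j + 1) ^ D" by (simp add: K_def add.commute)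
    also have "\<dots> \<le> (2 * real D * 4 ^ j) ^ D"
    proof (rule power_mono)
      have "1 * 1 \<le> real D * 4 ^ j" using D by (intro mult_mono) auto
      then show "real D * 4 ^ j + 1 \<le> 2 * real D * 4 ^ j" by simp
    qed simp
    also have "\<dots> = (2 * D) ^ D * (4 ^ D) ^ j"
      by (simp add: power_mult_distrib flip: power_mult)
    finally show ?thesis .
  qed
  define A where "A = real ((2 * D) ^ D)"
  define B where "B = (4::real) ^ D"
  have AB: "A \<ge> 0" "B > 1" using D by (auto simp: A_def B_def one_less_power)
  \<comment> \<open>\<open>K j\<close> is of order \<open>B ^ j\<close>, and the links multiply two
    such counts, whence \<open>(B * B) ^ j\<close>; the doubly exponential factor still
    dominates.\<close>
  have bound: "level_prob j \<le> (A + A * A * B) * (2 * exp 2) * ((B * B) ^ j * exp (- ((4/3) ^ j)))" for j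
  proof -
    have 1: "real (K j) \<le> A * B ^ j" for j using Kj[of j] by (simp add: A_def B_def)
    have "real (K j) + real (K j) * real (K (Suc j)) \<le> A * B ^ j + (A * B ^ j) * (A * B ^ Suc j)"
      using 1[of j] 1[of "Suc j"] AB by (intro add_mono mult_mono) auto
    also have "\<dots> \<le> A * (B * B) ^ j + (A * B ^ j) * (A * B ^ Suc j)"
      using AB by (intro add_mono mult_left_mono power_mono order_refl) (auto intro: mult_left_le)
    also have "\<dots> = (A + A * A * B) * (B * B) ^ j" by (simp add: algebra_simps power_mult_distrib)
    finally have "real (K j) + real (K j) * real (K (Suc j)) \<le> (A + A * A * B) * (B * B) ^ j" .
    then have "level_prob j \<le> (A + A * A * B) * (B * B) ^ j * (2 * exp (2 - (4/3) ^ j))"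
      unfolding level_prob_def by (intro mult_right_mono) auto
    also have "\<dots> = (A + A * A * B) * (2 * exp 2) * ((B * B) ^ j * exp (- ((4/3) ^ j)))"
      using exp_add[of 2 "- ((4/3 :: real) ^ j)"] by (simp add: mult_ac)
    finally show ?thesis .
  qed
  have "summable level_prob"
  proof (rule summable_comparison_test'[where N=0])
    have "1 < B * B" using AB by (simp add: less_1_mult)
    then show "summable (\<lambda>j. (A + A * A * B) * (2 * exp 2) * ((B * B) ^ j * exp (- ((4/3) ^ j))))"
      by (intro summable_mult summable_power_exp_neg_exp) auto
    show "norm (level_prob j) \<le> (A + A * A * B) * (2 * exp 2) * ((B * B) ^ j * exp (- ((4/3) ^ j)))" for j
      using bound[of j] by (simp add: level_prob_def)
  qed
  then show ?thesis using that bracketed_orthants_axioms by blast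
qed

section \<open>Asymptotic linearity of a weighted plug-in estimator\<close>

lemma (in prob_space) prob_bounded_finite_family:
  assumes "finite I" "\<And>i. i \<in> I \<Longrightarrow> prob_bounded M (Z i)" "\<eta> > 0"
  obtains R where "\<forall>\<^sub>F m in sequentially. likely M \<eta> (\<lambda>w. \<forall>i\<in>I. \<bar>Z i m w\<bar> \<le> R)"
proof -
  define c where "c = \<eta> / (card I + 1)"
  have c: "c > 0" "card I * c \<le> \<eta>" using assms(3) by (auto simp: c_def field_simps)
  have "\<forall>i\<in>I. \<exists>R. \<forall>\<^sub>F m in sequentially. likely M c (\<lambda>w. \<bar>Z i m w\<bar> \<le> R)"
    using assms(2) c(1) by (auto simp: prob_bounded_def)
  then obtain R where R: "\<And>i. i \<in> I \<Longrightarrow> \<forall>\<^sub>F m in sequentially. likely M c (\<lambda>w. \<bar>Z i m w\<bar> \<le> R i)"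
    by metis
  have "\<forall>\<^sub>F m in sequentially. \<forall>i\<in>I. likely M c (\<lambda>w. \<bar>Z i m w\<bar> \<le> R i)"
    using assms(1) R by (simp add: eventually_ball_finite)
  then have "\<forall>\<^sub>F m in sequentially. likely M \<eta> (\<lambda>w. \<forall>i\<in>I. \<bar>Z i m w\<bar> \<le> Max (R ` I))"
  proof eventually_elim
    case (elim m)
    have "likely M (\<Sum>i\<in>I. c) (\<lambda>w. \<forall>i\<in>I. \<bar>Z i m w\<bar> \<le> R i)"
      using elim by (intro likely_ball assms(1)) auto
    then show ?case
    proof (rule likely_mono)
      fix w assume a: "\<forall>i\<in>I. \<bar>Z i m w\<bar> \<le> R i"
      show "\<forall>i\<in>I. \<bar>Z i m w\<bar> \<le> Max (R ` I)"
        using a assms(1) by (auto intro: order_trans[OF _ Max_ge])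
    qed (use c in simp)
  qed
  then show ?thesis by (rule that)
qed

text \<open>An exceptional event of mass at most \<open>1/2\<close> leaves a sample point, so for a
  deterministic sequence boundedness in probability is genuine boundedness. This is what forces the
  weighted influence function to have mean zero.\<close>

lemma (in prob_space) prob_bounded_sqrt_imp_zero:
  assumes "prob_bounded M (\<lambda>m w. sqrt m * c)"
  shows "c = 0"
proof (rule ccontr)
  assume c: "c \<noteq> 0"
  obtain R where "\<forall>\<^sub>F m in sequentially. likely M (1/2) (\<lambda>w. \<bar>sqrt (real m) * c\<bar> \<le> R)"
    using prob_boundedE[OF assms, of "1/2"] by auto
  then have "\<forall>\<^sub>F m in sequentially. sqrt (real m) \<le> R / \<bar>c\<bar>"
  proof eventually_elim
    case (elim m)
    then obtain A where A: "A \<in> events" "prob A \<le> 1/2" "\<forall>w\<in>space M - A. \<bar>sqrt (real m) * c\<bar> \<le> R"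
      by (auto simp: likely_def)
    have "A \<noteq> space M" using A(2) prob_space by auto
    then obtain w where "w \<in> space M - A" using sets.sets_into_space[OF A(1)] by auto
    then have "sqrt m * \<bar>c\<bar> \<le> R" using A(3) by (auto simp: abs_mult)
    then show ?case using c by (simp add: field_simps)
  qed
  moreover have "filterlim (\<lambda>m. sqrt (real m)) at_top sequentially" by real_asymp
  then have "\<forall>\<^sub>F m in sequentially. sqrt (real m) > R / \<bar>c\<bar>" by (simp add: filterlim_at_top_dense)
  ultimately have "\<forall>\<^sub>F m :: nat in sequentially. False" by eventually_elim simp
  then show False by simp
qed

text \<open>\<open>F_eq\<close> says that \<open>p * F\<close> is the \<open>v\<close>-weighted law
  of \<open>\<zeta>\<close>. It ties the weights to the target, and different weights may thus share
  one \<open>F\<close>.\<close>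

locale weighted_plugin = iid_sample M P W
  for M :: "'w measure" and P :: "'s measure" and W +
  fixes v :: "'s \<Rightarrow> real" and \<zeta> :: "'s \<Rightarrow> (real^'d) \<times> real"
    and \<Phi> :: "((real^'d) \<times> real \<Rightarrow> real) \<Rightarrow> real" and F :: "(real^'d) \<times> real \<Rightarrow> real" and p :: real
  assumes v_meas [measurable]: "v \<in> borel_measurable P"
    and v01: "\<And>z. z \<in> space P \<Longrightarrow> 0 \<le> v z" "\<And>z. z \<in> space P \<Longrightarrow> v z \<le> 1"
    and \<zeta>_meas [measurable]: "\<zeta> \<in> borel_measurable P"
    and p: "p = (LINT z|P. v z)" "p > 0"
    and F_eq: "\<And>u. p * F u = (LINT z|P. v z * indicator {..u} (\<zeta> z))"
    and differentiable: "hadamard_differentiable \<Phi> cdfs F"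
    and influence_meas [measurable]: "(\<lambda>z. influence_function \<Phi> F (\<zeta> z)) \<in> borel_measurable P"
begin

definition \<phi> :: "'s \<Rightarrow> real" where
  "\<phi> z = influence_function \<Phi> F (\<zeta> z)"

definition ecdf :: "nat \<Rightarrow> 'w \<Rightarrow> (real^'d) \<times> real \<Rightarrow> real" where
  "ecdf m w = weighted_ecdf (\<lambda>i. v (W i w)) (\<lambda>i. \<zeta> (W i w)) m"

definition mean_wgt :: "nat \<Rightarrow> 'w \<Rightarrow> real" where
  "mean_wgt m w = (\<Sum>i<m. v (W i w)) / m"

definition lin :: "nat \<Rightarrow> 'w \<Rightarrow> real" where
  "lin m w = (\<Sum>i<m. v (W i w) * \<phi> (W i w)) / sqrt m"

text \<open>The direction in which \<open>\<Phi>\<close> is expanded, written as a finite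
  combination of the directions that define the influence function.\<close>

definition fluct :: "nat \<Rightarrow> 'w \<Rightarrow> (real^'d) \<times> real \<Rightarrow> real" where
  "fluct m w u = (\<Sum>i<m. (v (W i w) / sqrt m) * (of_bool (\<zeta> (W i w) \<le> u) - F u))"

lemma \<phi>_meas [measurable]: "\<phi> \<in> borel_measurable P"
  unfolding \<phi>_def[abs_def] by measurable

lemma mean_wgt_null: "prob_null M (\<lambda>m w. mean_wgt m w - p)"
proof -
  have "prob_null M (\<lambda>m w. 1 / sqrt (real m) * emp v m w)"
  proof (rule prob_null_mult)
    show "prob_null M (\<lambda>m w. 1 / sqrt (real m))" by (rule prob_null_tendsto) real_asymp
    show "prob_bounded M (emp v)"
      by (rule emp_bounded[where B=1]) (use v01 in \<open>auto simp: abs_le_iff intro: order_trans[of _ 0]\<close>)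
  qed
  then show ?thesis
  proof (rule prob_null_cong_likely)
    fix \<eta> :: real assume \<eta>: "\<eta> > 0"
    have "mean_wgt m w - p = 1 / sqrt (real m) * emp v m w" if "m > 0" for m w
      using that by (simp add: mean_wgt_def emp_def p(1) sum_subtractf field_simps)
    then show "\<forall>\<^sub>F m in sequentially. likely M \<eta> (\<lambda>w. mean_wgt m w - p = 1 / sqrt (real m) * emp v m w)"
      using \<eta> by (intro eventually_mono[OF eventually_gt_at_top[of 0]] AE_likely) auto
  qed
qed

text \<open>Off an event of mass \<open>\<eta>\<close>, \<open>fluct\<close> is bounded by
  \<open>R\<close> and oscillates by at most \<open>e j\<close> over the \<open>u\<close> with equal
  \<open>lo j u\<close>, so the uniform Hadamard approximation applies with the random step
  \<open>t\<close>. The bound on \<open>lin\<close> comes along because \<open>lin\<close> is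
  \<open>L\<close> of \<open>fluct\<close>.\<close>

lemma remainder:
  assumes L: "sup_norm_bounded_linear L" "hadamard_derivative \<Phi> cdfs F L" and F: "F \<in> cdfs"
    and \<epsilon>: "\<epsilon> > 0" and \<eta>: "\<eta> > 0"
  shows "\<exists>R. \<forall>\<^sub>F m in sequentially. likely M \<eta> (\<lambda>w. \<bar>lin m w\<bar> \<le> R \<and>
    \<bar>sqrt m * mean_wgt m w * (\<Phi> (ecdf m w) - \<Phi> F) - lin m w\<bar> \<le> \<epsilon>)"
proof -
  obtain lo hi K where br: "bracketed_orthants M P W v \<zeta> lo hi K"
    and sm: "summable (bracketed_orthants.level_prob K)"
    by (rule exists_bracketed_orthants[OF iid_sample_axioms v_meas v01 \<zeta>_meas])
  interpret bracketed_orthants M P W v \<zeta> lo hi K by fact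
  have F01: "0 \<le> F u" "F u \<le> 1" for u using cdfs_bounds[OF F] by auto
  obtain KL where KL: "KL > 0" "\<And>h R. (\<And>u. \<bar>h u\<bar> \<le> R) \<Longrightarrow> \<bar>L h\<bar> \<le> KL * R"
    using sup_norm_bounded_linear_bound[OF L(1)] by blast
  \<comment> \<open>Four exceptional events: chaining, lower brackets at level \<open>j0\<close>,
    fluctuation of the total weight, and the mean weight.\<close>
  define \<eta>' where "\<eta>' = \<eta> / 4"
  have \<eta>': "\<eta>' > 0" using \<eta> by (simp add: \<eta>'_def)
  have Iwgt: "(LINT z|P. wgt {..u} z) = p * F u" for u by (simp add: wgt_def F_eq)
  obtain j0 where j0: "\<And>N. N \<ge> j0 \<Longrightarrow> \<forall>\<^sub>F m in sequentially. likely M \<eta>'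
    (\<lambda>w. \<forall>j\<in>{j0..N}. \<forall>u. \<bar>wemp {..u} m w - wemp (lo j u) m w\<bar> \<le> 7 * (2/3) ^ j)"
    by (rule asymptotic_equicontinuity[OF sm \<eta>']) (rule that)
  have fin_lo: "finite (range (lo j))" for j
  proof -
    have "range (lo j) = fst ` range (\<lambda>u. (lo j u, hi j u))" by (auto simp: image_image)
    then show ?thesis using brackets_finite[of j] by simp
  qed
  have bd: "prob_bounded M (wemp A)" if "A \<in> range (lo j0)" for A
  proof -
    have [measurable]: "A \<in> sets borel" using that by auto
    show ?thesis unfolding wemp_def
      by (rule emp_bounded[where B=1])
        (use wgt_bounds in \<open>auto simp: abs_le_iff intro: order_trans[of _ 0]\<close>)
  qed
  obtain R1 where R1: "\<forall>\<^sub>F m in sequentially. likely M \<eta>' (\<lambda>w. \<forall>A\<in>range (lo j0). \<bar>wemp A m w\<bar> \<le> R1)"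
    by (rule prob_bounded_finite_family[where Z=wemp, OF fin_lo[of j0] bd \<eta>']) (assumption, rule that)
  have bS: "prob_bounded M (emp v)"
    by (rule emp_bounded[where B=1]) (use v01 in \<open>auto simp: abs_le_iff intro: order_trans[of _ 0]\<close>)
  obtain RS where RS: "RS > 0" "\<forall>\<^sub>F m in sequentially. likely M \<eta>' (\<lambda>w. \<bar>emp v m w\<bar> \<le> RS)"
    by (rule prob_boundedE[OF bS \<eta>']) (rule that)
  have vb: "\<forall>\<^sub>F m in sequentially. likely M \<eta>' (\<lambda>w. \<bar>mean_wgt m w - p\<bar> \<le> p / 2)"
    using mean_wgt_null p(2) \<eta>' by (intro prob_nullD) auto
  \<comment> \<open>First term: two orthants with the same lower bracket, each within
    \<open>7 * (2/3) ^ j\<close> of it. Second term: the variation of \<open>F\<close> over a cell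
    times the bound \<open>RS\<close> for \<open>emp v\<close>.\<close>
  define e where "e j = 14 * (2/3) ^ j + 2 * RS / p * (1/4) ^ j" for j :: nat
  have e: "e \<longlonglongrightarrow> 0" unfolding e_def by real_asymp
  \<comment> \<open>\<open>7\<close> bounds the chaining error at level \<open>j0\<close>,
    \<open>R1\<close> the lower brackets, and \<open>RS\<close> the term
    \<open>F u * emp v m w\<close>.\<close>
  define R where "R = 7 + R1 + RS"
  obtain N \<delta> where N: "N \<ge> j0" and \<delta>: "\<delta> > 0" and appr:
    "\<And>t h. 0 < t \<Longrightarrow> t < \<delta> \<Longrightarrow> (\<And>u. \<bar>h u\<bar> \<le> R) \<Longrightarrow>
      (\<And>j u u'. j \<in> {j0..N} \<Longrightarrow> lo j u = lo j u' \<Longrightarrow> \<bar>h u - h u'\<bar> \<le> e j) \<Longrightarrow>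
      (\<lambda>u. F u + t * h u) \<in> cdfs \<Longrightarrow> \<bar>(\<Phi> (\<lambda>u. F u + t * h u) - \<Phi> F) / t - L h\<bar> \<le> \<epsilon>"
    by (rule hadamard_derivative_uniform[where cell=lo and R=R and ?j0.0=j0, OF L(2) fin_lo e \<epsilon>]) (rule that; blast)
  \<comment> \<open>The step \<open>t\<close> is at most \<open>2 / (p * sqrt m)\<close> once the
    mean weight is at least \<open>p / 2\<close>.\<close>
  have large: "\<forall>\<^sub>F m in sequentially. 2 / (p * sqrt (real m)) < \<delta>"
  proof -
    have "(\<lambda>m. 2 / (p * sqrt (real m))) \<longlonglongrightarrow> 0" using p(2) by real_asymp
    then show ?thesis using \<delta> by (rule order_tendstoD)
  qed
  \<comment> \<open>\<open>p * F u\<close> is the mean weight of an orthant, trapped between those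
    of its brackets; a common \<open>lo j\<close> leaves at most twice the bracket mass.\<close>
  have F_osc: "\<bar>F u - F u'\<bar> \<le> 2 / p * (1/4) ^ j" if "lo j u = lo j u'" for j u u'
  proof -
    have near: "\<bar>p * F u - (LINT z|P. wgt (lo j u) z)\<bar> \<le> (1/4) ^ j" for u
    proof -
      have [measurable]: "{..u} \<in> sets borel" by simp
      have "(LINT z|P. wgt (lo j u) z) \<le> (LINT z|P. wgt {..u} z)"
        using lo_sub by (intro integral_mono wgt_integrable wgt_mono) auto
      moreover have "(LINT z|P. wgt {..u} z) \<le> (LINT z|P. wgt (hi j u) z)"
        using hi_sup by (intro integral_mono wgt_integrable wgt_mono) auto
      moreover have "(LINT z|P. wgt (hi j u) z) - (LINT z|P. wgt (lo j u) z) \<le> (1/4) ^ j"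
        by (rule order_trans[OF wgt_integral_diff[OF order_trans[OF lo_sub hi_sup] lo_meas hi_meas]
              brackets_measure])
      ultimately show ?thesis unfolding Iwgt by linarith
    qed
    have "p * \<bar>F u - F u'\<bar> = \<bar>p * F u - p * F u'\<bar>"
      using p(2) by (simp add: abs_mult flip: right_diff_distrib)
    also have "\<dots> \<le> 2 * (1/4) ^ j" using near[of u] near[of u'] that by simp
    finally show ?thesis using p(2) by (simp add: field_simps)
  qed
  have fluct_eq: "fluct m w u = wemp {..u} m w - F u * emp v m w" for m w u
  proof -
    have "wemp {..u} m w - F u * emp v m w
      = (\<Sum>i<m. ((wgt {..u} (W i w) - p * F u) - F u * (v (W i w) - p)) / sqrt m)"
      by (simp add: wemp_def emp_def Iwgt p(1)[symmetric] sum_subtractf sum_distrib_left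
          sum_divide_distrib diff_divide_distrib right_diff_distrib)
    also have "\<dots> = fluct m w u"
      unfolding fluct_def
      by (intro sum.cong) (auto simp: wgt_def indicator_def of_bool_def algebra_simps divide_simps)
    finally show ?thesis ..
  qed
  have L_fluct: "L (fluct m w) = lin m w" for m w
  proof -
    have b: "bounded_fun (\<lambda>u. of_bool (z \<le> u) - F u)" for z
    proof (rule bounded_funI)
      show "\<bar>of_bool (z \<le> u) - F u\<bar> \<le> 1" for u
        using F01[of u] by (simp add: abs_le_iff)
    qed
    have "L (fluct m w) = (\<Sum>i<m. (v (W i w) / sqrt m) * L (\<lambda>u. of_bool (\<zeta> (W i w) \<le> u) - F u))"
      unfolding fluct_def[abs_def] using b by (subst sup_norm_bounded_linear_sum[OF L(1), THEN conjunct1]) auto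
    also have "\<dots> = lin m w"
      by (simp add: lin_def \<phi>_def influence_function_eq[OF L(2) F] sum_divide_distrib)
    finally show ?thesis .
  qed
  show ?thesis
  proof (intro exI)
    show "\<forall>\<^sub>F m in sequentially. likely M \<eta> (\<lambda>w. \<bar>lin m w\<bar> \<le> KL * R \<and>
      \<bar>sqrt m * mean_wgt m w * (\<Phi> (ecdf m w) - \<Phi> F) - lin m w\<bar> \<le> \<epsilon>)"
      using j0[OF N] R1 RS(2) vb large eventually_gt_at_top[of 0]
    proof eventually_elim
      case (elim m)
      have "likely M (\<eta>' + (\<eta>' + (\<eta>' + \<eta>')))
        (\<lambda>w. (\<forall>j\<in>{j0..N}. \<forall>u. \<bar>wemp {..u} m w - wemp (lo j u) m w\<bar> \<le> 7 * (2/3) ^ j) \<and>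
          (\<forall>A\<in>range (lo j0). \<bar>wemp A m w\<bar> \<le> R1) \<and> \<bar>emp v m w\<bar> \<le> RS \<and> \<bar>mean_wgt m w - p\<bar> \<le> p / 2)"
        by (intro likely_conj elim)
      then show ?case
      proof (rule likely_mono)
        fix w assume w: "w \<in> space M" and "(\<forall>j\<in>{j0..N}. \<forall>u. \<bar>wemp {..u} m w - wemp (lo j u) m w\<bar> \<le> 7 * (2/3) ^ j) \<and>
          (\<forall>A\<in>range (lo j0). \<bar>wemp A m w\<bar> \<le> R1) \<and> \<bar>emp v m w\<bar> \<le> RS \<and> \<bar>mean_wgt m w - p\<bar> \<le> p / 2"
        then have a: "\<And>j u. j \<in> {j0..N} \<Longrightarrow> \<bar>wemp {..u} m w - wemp (lo j u) m w\<bar> \<le> 7 * (2/3) ^ j"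
          and b: "\<And>u. \<bar>wemp (lo j0 u) m w\<bar> \<le> R1" and c: "\<bar>emp v m w\<bar> \<le> RS"
          and d: "\<bar>mean_wgt m w - p\<bar> \<le> p / 2" by auto
        have mw: "mean_wgt m w \<ge> p / 2" using d unfolding abs_le_iff by linarith
        have m: "sqrt (real m) > 0" using elim by simp
        define t where "t = 1 / (sqrt m * mean_wgt m w)"
        have mw0: "mean_wgt m w > 0" using mw p(2) by linarith
        have t0: "t > 0" using mw0 m by (simp add: t_def)
        have "t \<le> 1 / (sqrt m * (p / 2))" unfolding t_def
          using mw p(2) m mw0 by (intro divide_left_mono mult_left_mono) auto
        also have "\<dots> = 2 / (p * sqrt m)" by (simp add: field_simps)
        also have "\<dots> < \<delta>" using elim by simp
        finally have t1: "t < \<delta>" .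
        have hR: "\<bar>fluct m w u\<bar> \<le> R" for u
        proof -
          have "\<bar>wemp {..u} m w - wemp (lo j0 u) m w\<bar> \<le> 7 * (2/3) ^ j0" using N by (intro a) auto
          also have "\<dots> \<le> 7 * 1" by (intro mult_left_mono power_le_one) auto
          finally have 1: "\<bar>wemp {..u} m w - wemp (lo j0 u) m w\<bar> \<le> 7" by simp
          have "\<bar>F u * emp v m w\<bar> \<le> 1 * RS"
            using F01[of u] c RS(1) unfolding abs_mult by (intro mult_mono) auto
          then show ?thesis using 1 b[of u] unfolding fluct_eq R_def by linarith
        qed
        have osc: "\<bar>fluct m w u - fluct m w u'\<bar> \<le> e j" if j: "j \<in> {j0..N}" and eq: "lo j u = lo j u'" for j u u'
        proof -
          have 1: "\<bar>wemp {..u} m w - wemp {..u'} m w\<bar> \<le> 14 * (2/3) ^ j"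
            using a[OF j, of u] a[OF j, of u'] eq by simp
          have "\<bar>(F u - F u') * emp v m w\<bar> \<le> (2 / p * (1/4) ^ j) * RS"
            unfolding abs_mult using F_osc[OF eq] c p(2) by (intro mult_mono) auto
          then have "\<bar>F u * emp v m w - F u' * emp v m w\<bar> \<le> 2 * RS / p * (1/4) ^ j"
            by (simp add: left_diff_distrib mult_ac)
          then show ?thesis using 1 unfolding fluct_eq e_def by linarith
        qed
        have sv: "(\<Sum>i<m. v (W i w)) > 0"
          using mw0 elim by (simp add: mean_wgt_def zero_less_divide_iff)
        have step: "(\<lambda>u. F u + t * fluct m w u) = ecdf m w"
        proof
          fix u
          define S where "S = (\<Sum>i<m. v (W i w))"
          have "t = (m / sqrt m) / S" by (simp add: t_def mean_wgt_def S_def)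
          then have t: "t = sqrt m / S" by (simp add: real_div_sqrt)
          have "fluct m w u = (\<Sum>i<m. v (W i w) * of_bool (\<zeta> (W i w) \<le> u) - F u * v (W i w)) / sqrt m"
            unfolding fluct_def sum_divide_distrib
            by (intro sum.cong refl) (simp add: right_diff_distrib diff_divide_distrib mult_ac)
          also have "\<dots> = ((\<Sum>i<m. v (W i w) * of_bool (\<zeta> (W i w) \<le> u)) - F u * S) / sqrt m"
            by (simp only: sum_subtractf S_def sum_distrib_left)
          finally have "fluct m w u = ((\<Sum>i<m. v (W i w) * of_bool (\<zeta> (W i w) \<le> u)) - F u * S) / sqrt m" .
          then have "t * fluct m w u = ((\<Sum>i<m. v (W i w) * of_bool (\<zeta> (W i w) \<le> u)) - F u * S) / S"
            using m by (simp add: t)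
          then show "F u + t * fluct m w u = ecdf m w u"
            using sv by (simp add: ecdf_def weighted_ecdf_def S_def diff_divide_distrib)
        qed
        have cdf: "(\<lambda>u. F u + t * fluct m w u) \<in> cdfs"
          unfolding step ecdf_def using sv v01 W_space[OF w] by (intro weighted_ecdf_in_cdfs) auto
        have "\<bar>(\<Phi> (\<lambda>u. F u + t * fluct m w u) - \<Phi> F) / t - L (fluct m w)\<bar> \<le> \<epsilon>"
          by (rule appr[OF t0 t1 hR osc cdf])
        moreover have "\<bar>L (fluct m w)\<bar> \<le> KL * R" by (rule KL(2)[OF hR])
        ultimately show "\<bar>lin m w\<bar> \<le> KL * R \<and>
          \<bar>sqrt m * mean_wgt m w * (\<Phi> (ecdf m w) - \<Phi> F) - lin m w\<bar> \<le> \<epsilon>"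
          unfolding step L_fluct by (simp add: t_def mult.commute)
      qed (simp add: \<eta>'_def)
    qed
  qed
qed

theorem asymptotic_linearity:
  shows "prob_null M (\<lambda>m w. sqrt m * (\<Phi> (ecdf m w) - \<Phi> F) - lin m w / p)"
    and influence_mean_zero: "(LINT z|P. v z * \<phi> z) = 0"
    and influence_bounded: "\<exists>B. \<forall>z. \<bar>\<phi> z\<bar> \<le> B"
    and lin_bounded: "prob_bounded M lin"
proof -
  obtain L where F: "F \<in> cdfs" and L: "sup_norm_bounded_linear L" "hadamard_derivative \<Phi> cdfs F L"
    by (rule hadamard_differentiableE[OF differentiable]) (rule that)
  note rem = remainder[OF L F]
  define r where "r m w = sqrt m * mean_wgt m w * (\<Phi> (ecdf m w) - \<Phi> F) - lin m w" for m w
  show lin: "prob_bounded M lin" unfolding prob_bounded_def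
  proof (intro allI impI)
    fix \<eta> :: real assume "\<eta> > 0"
    from rem[OF zero_less_one this] obtain R where "\<forall>\<^sub>F m in sequentially. likely M \<eta> (\<lambda>w. \<bar>lin m w\<bar> \<le> R \<and>
      \<bar>sqrt m * mean_wgt m w * (\<Phi> (ecdf m w) - \<Phi> F) - lin m w\<bar> \<le> 1)" by (rule exE)
    then have "\<forall>\<^sub>F m in sequentially. likely M \<eta> (\<lambda>w. \<bar>lin m w\<bar> \<le> R)"
      by eventually_elim (erule likely_mono, auto)
    then show "\<exists>R. \<forall>\<^sub>F m in sequentially. likely M \<eta> (\<lambda>w. \<bar>lin m w\<bar> \<le> R)" ..
  qed
  have r: "prob_null M r" unfolding prob_null_def
  proof (intro allI impI)
    fix \<epsilon> \<eta> :: real assume "\<epsilon> > 0" "\<eta> > 0"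
    from rem[OF this] obtain R where "\<forall>\<^sub>F m in sequentially. likely M \<eta> (\<lambda>w. \<bar>lin m w\<bar> \<le> R \<and>
      \<bar>sqrt m * mean_wgt m w * (\<Phi> (ecdf m w) - \<Phi> F) - lin m w\<bar> \<le> \<epsilon>)" by (rule exE)
    then show "\<forall>\<^sub>F m in sequentially. likely M \<eta> (\<lambda>w. \<bar>r m w\<bar> \<le> \<epsilon>)"
      by eventually_elim (erule likely_mono, auto simp: r_def)
  qed
  obtain K where K: "K > 0" "\<And>h R. (\<And>u. \<bar>h u\<bar> \<le> R) \<Longrightarrow> \<bar>L h\<bar> \<le> K * R"
    using sup_norm_bounded_linear_bound[OF L(1)] by blast
  have \<phi>K: "\<bar>\<phi> z\<bar> \<le> K * 1" for z
    unfolding \<phi>_def influence_function_eq[OF L(2) F]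
  proof (rule K(2))
    show "\<bar>of_bool (\<zeta> z \<le> u) - F u\<bar> \<le> 1" for u
      using cdfs_bounds[OF F, of u] by (simp add: abs_le_iff)
  qed
  then show "\<exists>B. \<forall>z. \<bar>\<phi> z\<bar> \<le> B" by blast
  define c where "c = (LINT z|P. v z * \<phi> z)"
  \<comment> \<open>\<open>lin\<close> differs from its centred version by \<open>sqrt m\<close>
    times the mean, and both are bounded in probability.\<close>
  have "prob_bounded M (\<lambda>m w. lin m w - emp (\<lambda>z. v z * \<phi> z) m w)"
  proof (intro prob_bounded_diff lin emp_bounded[where B="1 * (K * 1)"])
    show "\<bar>v z * \<phi> z\<bar> \<le> 1 * (K * 1)" if "z \<in> space P" for z
      unfolding abs_mult using v01[OF that] \<phi>K by (intro mult_mono) auto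
  qed auto
  moreover have "lin m w - emp (\<lambda>z. v z * \<phi> z) m w = sqrt m * c" for m w
    by (cases "m = 0") (simp_all add: lin_def emp_def c_def sum_subtractf diff_divide_distrib real_div_sqrt
        flip: times_divide_eq_left)
  ultimately have "prob_bounded M (\<lambda>m w. sqrt m * c)" by simp
  then show "(LINT z|P. v z * \<phi> z) = 0" unfolding c_def by (rule prob_bounded_sqrt_imp_zero)
  \<comment> \<open>Where the mean weight is nonzero, the scaled error is
    \<open>(lin + r) / mean_wgt\<close>; subtracting \<open>lin / p\<close> leaves these two
    terms.\<close>
  have "prob_null M (\<lambda>m w. (inverse (mean_wgt m w) - inverse p) * (lin m w + r m w) + r m w * inverse p)"
    by (rule prob_null_add[OF prob_null_mult[OF prob_null_inverse[OF mean_wgt_null p(2)]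
          prob_bounded_add[OF lin prob_null_imp_bounded[OF r]]] prob_null_mult[OF r prob_bounded_const]])
  then show "prob_null M (\<lambda>m w. sqrt m * (\<Phi> (ecdf m w) - \<Phi> F) - lin m w / p)"
  proof (rule prob_null_cong_likely)
    fix \<eta> :: real assume "\<eta> > 0"
    then have "\<forall>\<^sub>F m in sequentially. likely M \<eta> (\<lambda>w. \<bar>mean_wgt m w - p\<bar> \<le> p / 2)"
      using mean_wgt_null p(2) by (intro prob_nullD) auto
    then show "\<forall>\<^sub>F m in sequentially. likely M \<eta> (\<lambda>w. sqrt m * (\<Phi> (ecdf m w) - \<Phi> F) - lin m w / p
      = (inverse (mean_wgt m w) - inverse p) * (lin m w + r m w) + r m w * inverse p)"
    proof eventually_elim
      case (elim m)
      then show ?case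
      proof (rule likely_mono)
        fix w assume "\<bar>mean_wgt m w - p\<bar> \<le> p / 2"
        then have "mean_wgt m w \<noteq> 0" using p(2) by (auto simp: abs_if)
        then show "sqrt m * (\<Phi> (ecdf m w) - \<Phi> F) - lin m w / p
          = (inverse (mean_wgt m w) - inverse p) * (lin m w + r m w) + r m w * inverse p"
          using p(2) by (simp add: r_def field_simps)
      qed simp
    qed
  qed
qed

end

lemma weighted_ecdf_scale:
  assumes "B \<noteq> 0" "\<And>i. i < m \<Longrightarrow> v' i = v i / B"
  shows "weighted_ecdf v' z m = weighted_ecdf v z m"
proof
  fix u
  have "(\<Sum>i<m. v' i * of_bool (z i \<le> u)) = (\<Sum>i<m. v i * of_bool (z i \<le> u)) / B"
    unfolding sum_divide_distrib by (intro sum.cong) (auto simp: assms(2))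
  moreover have "(\<Sum>i<m. v' i) = (\<Sum>i<m. v i) / B"
    unfolding sum_divide_distrib by (intro sum.cong) (auto simp: assms(2))
  ultimately show "weighted_ecdf v' z m u = weighted_ecdf v z m u"
    using assms(1) by (simp add: weighted_ecdf_def)
qed

lemma (in iid_sample) AE_sample:
  assumes "AE z in P. R z"
  shows "AE w in M. \<forall>i. R (W i w)"
proof -
  have "AE w in M. R (W i w)" for i
    by (rule AE_distrD[OF W_measurable]) (unfold distr_W, rule assms)
  then show ?thesis by (simp add: AE_all_countable)
qed

text \<open>Odds are bounded only almost surely, and by a constant other than \<open>1\<close>. The
  weighted CDF and the ratio \<open>S / p\<close> do not change when weights and \<open>p\<close>
  are divided by \<open>B\<close>, so the normalised locale covers this case.\<close>

theorem (in iid_sample) plugin_expansion: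
  fixes \<zeta> :: "'s \<Rightarrow> (real^'d) \<times> real"
  assumes [measurable]: "v \<in> borel_measurable P" and v: "AE z in P. 0 \<le> v z \<and> v z \<le> B" and B: "B > 0"
    and [measurable]: "\<zeta> \<in> borel_measurable P"
    and p: "p = (LINT z|P. v z)" "p > 0"
    and F_eq: "\<And>u. p * F u = (LINT z|P. v z * indicator {..u} (\<zeta> z))"
    and diff: "hadamard_differentiable \<Phi> cdfs F"
    and [measurable]: "(\<lambda>z. influence_function \<Phi> F (\<zeta> z)) \<in> borel_measurable P"
  defines "S \<equiv> \<lambda>m w. (\<Sum>i<m. v (W i w) * influence_function \<Phi> F (\<zeta> (W i w))) / sqrt m"
  shows "prob_null M (\<lambda>m w. sqrt m * (\<Phi> (weighted_ecdf (\<lambda>i. v (W i w)) (\<lambda>i. \<zeta> (W i w)) m) - \<Phi> F) - S m w / p)"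
    and "(LINT z|P. v z * influence_function \<Phi> F (\<zeta> z)) = 0"
    and "\<exists>K. \<forall>z. \<bar>influence_function \<Phi> F (\<zeta> z)\<bar> \<le> K"
    and "prob_bounded M S"
proof -
  \<comment> \<open>Truncation forces the range \<open>[0, 1]\<close> everywhere and alters
    \<open>v / B\<close> only on a null set.\<close>
  define v' where "v' z = max 0 (min 1 (v z / B))" for z
  have [measurable]: "v' \<in> borel_measurable P" unfolding v'_def[abs_def] by measurable
  have v': "AE z in P. v' z = v z / B"
    using v by eventually_elim (use B in \<open>auto simp: v'_def field_simps min_def max_def\<close>)
  have I: "(LINT z|P. v' z * h z) = (LINT z|P. v z * h z) / B" if "h \<in> borel_measurable P" for h
  proof -
    have [measurable]: "h \<in> borel_measurable P" by fact
    have "(LINT z|P. v' z * h z) = (LINT z|P. v z * h z / B)"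
      using v' by (intro integral_cong_AE) auto
    then show ?thesis by simp
  qed
  interpret wp: weighted_plugin M P W v' \<zeta> \<Phi> F "p / B"
  proof
    show "p / B = (LINT z|P. v' z)" using I[of "\<lambda>_. 1"] p(1) by simp
    show "p / B * F u = (LINT z|P. v' z * indicator {..u} (\<zeta> z))" for u
      using I[of "\<lambda>z. indicator {..u} (\<zeta> z)"] F_eq[of u] by simp
  qed (use p B diff in \<open>auto simp: v'_def\<close>)
  have smp: "AE w in M. \<forall>i. v' (W i w) = v (W i w) / B" by (rule AE_sample[OF v'])
  have lin: "wp.lin m w = S m w / B" if "\<forall>i. v' (W i w) = v (W i w) / B" for m w
    using that by (simp add: wp.lin_def wp.\<phi>_def S_def sum_divide_distrib mult.commute)
  have ecdf: "wp.ecdf m w = weighted_ecdf (\<lambda>i. v (W i w)) (\<lambda>i. \<zeta> (W i w)) m"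
    if "\<forall>i. v' (W i w) = v (W i w) / B" for m w
    unfolding wp.ecdf_def using that B by (intro weighted_ecdf_scale[of B]) auto
  show "prob_null M (\<lambda>m w. sqrt m * (\<Phi> (weighted_ecdf (\<lambda>i. v (W i w)) (\<lambda>i. \<zeta> (W i w)) m) - \<Phi> F) - S m w / p)"
  proof (rule prob_null_cong_likely[OF wp.asymptotic_linearity(1)], rule always_eventually, rule allI)
    fix m and \<eta> :: real assume "\<eta> > 0"
    show "likely M \<eta> (\<lambda>w. sqrt m * (\<Phi> (weighted_ecdf (\<lambda>i. v (W i w)) (\<lambda>i. \<zeta> (W i w)) m) - \<Phi> F) - S m w / p
      = sqrt m * (\<Phi> (wp.ecdf m w) - \<Phi> F) - wp.lin m w / (p / B))"
    proof (rule AE_likely)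
      show "AE w in M. sqrt m * (\<Phi> (weighted_ecdf (\<lambda>i. v (W i w)) (\<lambda>i. \<zeta> (W i w)) m) - \<Phi> F) - S m w / p
        = sqrt m * (\<Phi> (wp.ecdf m w) - \<Phi> F) - wp.lin m w / (p / B)"
        using smp by eventually_elim (use B in \<open>simp add: lin ecdf\<close>)
    qed (use \<open>\<eta> > 0\<close> in simp)
  qed
  show "(LINT z|P. v z * influence_function \<Phi> F (\<zeta> z)) = 0"
    using wp.influence_mean_zero I[of wp.\<phi>] B by (simp add: wp.\<phi>_def)
  show "\<exists>K. \<forall>z. \<bar>influence_function \<Phi> F (\<zeta> z)\<bar> \<le> K"
    using wp.influence_bounded by (simp add: wp.\<phi>_def)
  show "prob_bounded M S"
    unfolding prob_bounded_def
  proof (intro allI impI)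
    fix \<eta> :: real assume \<eta>: "\<eta> > 0"
    obtain R where "\<forall>\<^sub>F m in sequentially. likely M (\<eta>/2) (\<lambda>w. \<bar>wp.lin m w\<bar> \<le> R)"
      using prob_boundedE[OF wp.lin_bounded, of "\<eta>/2"] \<eta> by auto
    then have "\<forall>\<^sub>F m in sequentially. likely M \<eta> (\<lambda>w. \<bar>S m w\<bar> \<le> B * R)"
    proof eventually_elim
      case (elim m)
      have "likely M (\<eta>/2) (\<lambda>w. \<forall>i. v' (W i w) = v (W i w) / B)"
        using smp \<eta> by (intro AE_likely) auto
      from likely_conj[OF elim this] show ?case
        by (rule likely_mono) (use B in \<open>auto simp: lin field_simps\<close>)
    qed
    then show "\<exists>R. \<forall>\<^sub>F m in sequentially. likely M \<eta> (\<lambda>w. \<bar>S m w\<bar> \<le> R)" ..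
  qed
qed

section \<open>Central limit theorem with a possibly degenerate limit\<close>

lemma real_distribution_normal_law: "real_distribution (normal_law a s)"
proof -
  interpret std_normal: prob_space std_normal_distribution
    by (rule prob_space_normal_density) simp
  show ?thesis unfolding normal_law_def by (rule std_normal.real_distribution_distr) simp
qed

lemma (in prob_space) weak_conv_scale:
  assumes [measurable]: "\<And>n. Z n \<in> borel_measurable M" and N: "real_distribution N"
    and Z: "weak_conv_m (\<lambda>n. distr M borel (Z n)) N"
  shows "weak_conv_m (\<lambda>n. distr M borel (\<lambda>w. a * Z n w)) (distr N borel (\<lambda>x. a * x))"
proof -
  interpret N: real_distribution N by fact
  have rd: "real_distribution (distr M borel (Z n))" for n by (rule real_distribution_distr) simp
  have c: "char (distr M borel (\<lambda>w. a * Z n w)) t = char (distr M borel (Z n)) (a * t)" for n t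
    by (simp add: char_def integral_distr mult_ac)
  have d: "char (distr N borel (\<lambda>x. a * x)) t = char N (a * t)" for t
    by (simp add: char_def integral_distr mult_ac)
  show ?thesis
  proof (rule levy_continuity)
    show "(\<lambda>n. char (distr M borel (\<lambda>w. a * Z n w)) t) \<longlonglongrightarrow> char (distr N borel (\<lambda>x. a * x)) t" for t
      unfolding c d by (rule levy_continuity1[OF rd N Z])
    show "real_distribution (distr M borel (\<lambda>w. a * Z n w))" for n
      by (rule real_distribution_distr) simp
    show "real_distribution (distr N borel (\<lambda>x. a * x))"
      by (rule N.real_distribution_distr) simp
  qed
qed

text \<open>If \<open>s = 0\<close>, the summands vanish almost surely and the limit is the point
  mass at \<open>0\<close>. Otherwise the standardised limit is rescaled by
  \<open>a * s\<close>.\<close>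

lemma (in iid_sample) clt:
  assumes [measurable]: "\<psi> \<in> borel_measurable P" and sq: "integrable P (\<lambda>z. (\<psi> z)\<^sup>2)"
    and mean: "(LINT z|P. \<psi> z) = 0" and a: "a \<ge> 0"
  shows "weak_conv_m (\<lambda>m. distr M borel (\<lambda>w. a * ((\<Sum>i<m. \<psi> (W i w)) / sqrt m)))
           (normal_law 0 (a\<^sup>2 * (LINT z|P. (\<psi> z)\<^sup>2)))"
proof -
  define s where "s = sqrt (LINT z|P. (\<psi> z)\<^sup>2)"
  have s0: "s \<ge> 0" and s2: "s\<^sup>2 = (LINT z|P. (\<psi> z)\<^sup>2)" by (simp_all add: s_def)
  interpret std_normal: prob_space std_normal_distribution
    by (rule prob_space_normal_density) simp
  have nl: "normal_law 0 (a\<^sup>2 * (LINT z|P. (\<psi> z)\<^sup>2)) = distr std_normal_distribution borel (\<lambda>x. (a * s) * x)"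
    using a s0 by (simp add: normal_law_def s2[symmetric] real_sqrt_mult)
  show ?thesis
  proof (cases "s = 0")
    case True
    have "AE z in P. (\<psi> z)\<^sup>2 = 0"
      using integral_nonneg_eq_0_iff_AE[OF sq] s2 True by simp
    then have "AE z in P. \<psi> z = 0" by simp
    then have AE0: "AE w in M. \<forall>i. \<psi> (W i w) = 0" by (rule AE_sample)
    have "weak_conv_m (\<lambda>m. distr M borel (\<lambda>w. 0)) (normal_law 0 (a\<^sup>2 * (LINT z|P. (\<psi> z)\<^sup>2)))"
      by (simp add: weak_conv_m_def weak_conv_def nl True distr_const std_normal.distr_const)
    then show ?thesis
    proof (rule slutsky[rotated 3])
      show "prob_null M (\<lambda>m w. a * ((\<Sum>i<m. \<psi> (W i w)) / sqrt m) - 0)"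
        unfolding prob_null_def
      proof (intro allI impI, rule always_eventually, intro allI AE_likely)
        fix e :: real and m :: nat assume "e > 0"
        then show "AE w in M. \<bar>a * ((\<Sum>i<m. \<psi> (W i w)) / sqrt m) - 0\<bar> \<le> e"
          using AE0 by (auto elim!: eventually_mono)
      qed auto
    qed (auto intro: real_distribution_normal_law)
  next
    case False
    then have sp: "s > 0" using s0 by simp
    have ind: "indep_vars (\<lambda>_. borel) (\<lambda>i w. \<psi> (W i w)) UNIV"
      by (rule indep_vars_compose2[OF indep]) simp
    have m0: "expectation (\<lambda>w. \<psi> (W i w)) = 0" for i
      using mean by (simp add: integral_W)
    have "weak_conv_m (\<lambda>m. distr M borel (\<lambda>w. (\<Sum>i<m. \<psi> (W i w)) / sqrt (m * s\<^sup>2))) std_normal_distribution"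
    proof (rule central_limit_theorem_zero_mean[OF ind m0 sp])
      show "integrable M (\<lambda>w. (\<psi> (W n w))\<^sup>2)" for n
        by (rule integrable_distr[OF W_measurable]) (simp add: distr_W sq)
      show "variance (\<lambda>w. \<psi> (W n w)) = s\<^sup>2" for n
        using integral_W[where h="\<lambda>z. (\<psi> z)\<^sup>2" and i=n] by (simp add: m0 s2)
      show "distr M borel (\<lambda>w. \<psi> (W n w)) = distr P borel \<psi>" for n
        using distr_distr[of \<psi> P borel "W n" M] by (simp add: distr_W o_def)
    qed
    then have "weak_conv_m (\<lambda>m. distr M borel (\<lambda>w. (a * s) * ((\<Sum>i<m. \<psi> (W i w)) / sqrt (m * s\<^sup>2))))
      (distr std_normal_distribution borel (\<lambda>x. (a * s) * x))"
      by (intro weak_conv_scale) (auto simp: std_normal.real_distribution_distr real_distribution_def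
          real_distribution_axioms_def std_normal.prob_space_axioms)
    moreover have "(a * s) * ((\<Sum>i<m. \<psi> (W i w)) / sqrt (m * s\<^sup>2)) = a * ((\<Sum>i<m. \<psi> (W i w)) / sqrt m)" for m w
      using sp by (simp add: real_sqrt_mult)
    ultimately show ?thesis unfolding nl by simp
  qed
qed

section \<open>The missing-data model\<close>

locale missing_data =
  fixes Q :: "((real^'d) \<times> bool \<times> real) measure" and \<pi> :: "real^'d \<Rightarrow> real" and \<epsilon> :: real
  assumes prob_Q: "prob_space Q" and sets_Q [measurable_cong]: "sets Q = sets triple_space"
    and propensity: "is_propensity Q \<pi>"
    and overlap: "\<epsilon> > 0" "AE (x, c, y) in Q. \<epsilon> < \<pi> x \<and> \<pi> x < 1 - \<epsilon>"
    and cond_indep: "cond_indep_var Q (sigma_X Q)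
                       (count_space UNIV) (\<lambda>(x, c, y). c) borel (\<lambda>(x, c, y). y)"
begin

sublocale prob_space Q by (rule prob_Q)

lemma space_Q [simp]: "space Q = UNIV"
  using sets_eq_imp_space_eq[OF sets_Q] by (simp add: triple_space_def space_pair_measure)

lemma X_meas [measurable]: "fst \<in> borel_measurable Q"
  and C_meas [measurable]: "(\<lambda>z. fst (snd z)) \<in> measurable Q (count_space UNIV)"
  and Y_meas [measurable]: "(\<lambda>z. snd (snd z)) \<in> borel_measurable Q"
  unfolding measurable_cong_sets[OF sets_Q refl] triple_space_def by measurable

lemma \<pi>_meas [measurable]: "\<pi> \<in> borel_measurable borel"
  using propensity by (simp add: is_propensity_def)

lemma odds_meas [measurable]: "odds \<pi> \<in> borel_measurable borel"
  unfolding odds_def[abs_def] by measurable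

lemma overlap_AE: "AE z in Q. \<epsilon> < \<pi> (fst z) \<and> \<pi> (fst z) < 1 - \<epsilon>"
  using overlap(2) by (simp add: case_prod_beta)

lemma subalgebra_X: "subalgebra Q (sigma_X Q)"
  unfolding subalgebra_def sigma_X_def using measurable_sets[OF X_meas]
  by (auto simp: sets_vimage_algebra2)

sublocale X: finite_measure_subalgebra Q "sigma_X Q"
  by unfold_locales (rule subalgebra_X)

lemma X_meas_sigma [measurable]: "fst \<in> borel_measurable (sigma_X Q)"
  unfolding sigma_X_def by (rule measurable_vimage_algebra1) auto

lemma cond_exp_C: "AE z in Q. real_cond_exp Q (sigma_X Q) (\<lambda>z. of_bool (fst (snd z))) z = \<pi> (fst z)"
  using propensity by (simp add: is_propensity_def case_prod_beta')

lemma cond_exp_C_Y: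
  assumes b: "b \<in> sets borel"
  shows "AE z in Q. real_cond_exp Q (sigma_X Q) (\<lambda>z. of_bool (fst (snd z)) * indicator b (snd (snd z))) z
    = \<pi> (fst z) * real_cond_exp Q (sigma_X Q) (\<lambda>z. indicator b (snd (snd z))) z"
proof -
  have "AE z in Q. real_cond_exp Q (sigma_X Q) (\<lambda>z. indicator {True} (fst (snd z)) * indicator b (snd (snd z))) z
    = real_cond_exp Q (sigma_X Q) (\<lambda>z. indicator {True} (fst (snd z))) z
      * real_cond_exp Q (sigma_X Q) (\<lambda>z. indicator b (snd (snd z))) z"
    using cond_indep b unfolding cond_indep_var_def by (simp add: case_prod_beta')
  moreover have "indicator {True} c = (of_bool c :: real)" for c by (cases c) auto
  ultimately have "AE z in Q. real_cond_exp Q (sigma_X Q) (\<lambda>z. of_bool (fst (snd z)) * indicator b (snd (snd z))) z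
    = real_cond_exp Q (sigma_X Q) (\<lambda>z. of_bool (fst (snd z))) z
      * real_cond_exp Q (sigma_X Q) (\<lambda>z. indicator b (snd (snd z))) z" by simp
  then show ?thesis using cond_exp_C by eventually_elim simp
qed

section \<open>Reweighting identities for the unlabelled law\<close>

lemma integrable_AE_bounded:
  fixes g :: "_ \<Rightarrow> real"
  assumes "g \<in> borel_measurable Q" "AE z in Q. \<bar>g z\<bar> \<le> B"
  shows "integrable Q g"
  using assms by (intro integrable_const_bound[where B=B]) auto

text \<open>Conditioning on \<open>X\<close> replaces \<open>C\<close> by \<open>\<pi>\<close>, by
  conditional independence; integrating the conditional expectation of the
  \<open>Y\<close>-indicator then restores the indicator itself.\<close>

lemma integral_C_Y:
  assumes [measurable]: "g \<in> borel_measurable borel" "b \<in> sets borel"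
    and g: "AE z in Q. \<bar>g (fst z)\<bar> \<le> B"
  shows "(LINT z|Q. g (fst z) * (of_bool (fst (snd z)) * indicator b (snd (snd z))))
    = (LINT z|Q. (g (fst z) * \<pi> (fst z)) * indicator b (snd (snd z)))"
proof -
  let ?E = "real_cond_exp Q (sigma_X Q) (\<lambda>z. indicator b (snd (snd z)))"
  have "(LINT z|Q. g (fst z) * (of_bool (fst (snd z)) * indicator b (snd (snd z))))
    = (LINT z|Q. g (fst z) * real_cond_exp Q (sigma_X Q) (\<lambda>z. of_bool (fst (snd z)) * indicator b (snd (snd z))) z)"
  proof (rule X.real_cond_exp_intg(2)[symmetric])
    show "integrable Q (\<lambda>z. g (fst z) * (of_bool (fst (snd z)) * indicator b (snd (snd z))))"
    proof (rule integrable_AE_bounded)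
      show "AE z in Q. \<bar>g (fst z) * (of_bool (fst (snd z)) * indicator b (snd (snd z)))\<bar> \<le> \<bar>B\<bar>"
        using g by eventually_elim (auto simp: indicator_def)
    qed measurable
  qed measurable
  also have "\<dots> = (LINT z|Q. (g (fst z) * \<pi> (fst z)) * ?E z)"
    using cond_exp_C_Y[of b]
    by (intro integral_cong_AE) (measurable, auto simp: mult_ac elim!: eventually_mono)
  also have "\<dots> = (LINT z|Q. (g (fst z) * \<pi> (fst z)) * indicator b (snd (snd z)))"
  proof (rule X.real_cond_exp_intg(2))
    show "integrable Q (\<lambda>z. (g (fst z) * \<pi> (fst z)) * indicator b (snd (snd z)))"
    proof (rule integrable_AE_bounded)
      show "AE z in Q. \<bar>g (fst z) * \<pi> (fst z) * indicator b (snd (snd z))\<bar> \<le> \<bar>B\<bar> * 1"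
        using g overlap_AE
      proof eventually_elim
        case (elim z)
        have "\<bar>g (fst z)\<bar> * \<bar>\<pi> (fst z) * indicator b (snd (snd z))\<bar> \<le> \<bar>B\<bar> * 1"
          using elim overlap(1) by (intro mult_mono) (auto simp: indicator_def)
        then show ?case by (simp add: abs_mult mult_ac)
      qed
    qed measurable
  qed measurable
  finally show ?thesis .
qed

lemma odds_\<pi>: "AE z in Q. odds \<pi> (fst z) * \<pi> (fst z) = 1 - \<pi> (fst z)"
  using overlap_AE by eventually_elim (use overlap(1) in \<open>simp add: odds_def\<close>)

lemma odds_bounds: "AE z in Q. 0 \<le> odds \<pi> (fst z) \<and> odds \<pi> (fst z) \<le> 1 / \<epsilon>"
  using overlap_AE
proof eventually_elim
  case (elim z)
  then show ?case using overlap(1) unfolding odds_def by (auto intro!: frac_le divide_nonneg_pos)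
qed

lemma odds_C_bounds:
  "AE z in Q. 0 \<le> odds \<pi> (fst z) * of_bool (fst (snd z)) \<and> odds \<pi> (fst z) * of_bool (fst (snd z)) \<le> 1 / \<epsilon>"
  using odds_bounds by eventually_elim (use overlap(1) in auto)

lemma one_minus_\<pi>_bounds: "AE z in Q. 0 \<le> 1 - \<pi> (fst z) \<and> 1 - \<pi> (fst z) \<le> 1"
  using overlap_AE by eventually_elim (use overlap(1) in auto)

text \<open>The indicator of \<open>C = 0\<close> is \<open>1\<close> minus that of
  \<open>C = 1\<close>, and the second part is handled by \<open>integral_C_Y\<close>.\<close>

lemma integral_unlabeled:
  assumes [measurable]: "A \<in> sets borel" "b \<in> sets borel"
  shows "(LINT z|Q. (1 - \<pi> (fst z)) * indicator A (fst z) * indicator b (snd (snd z)))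
    = prob {z. fst z \<in> A \<and> snd (snd z) \<in> b \<and> \<not> fst (snd z)}"
proof -
  have "prob {z. fst z \<in> A \<and> snd (snd z) \<in> b \<and> \<not> fst (snd z)}
    = (LINT z|Q. indicator {z. fst z \<in> A \<and> snd (snd z) \<in> b \<and> \<not> fst (snd z)} z)"
    by simp
  also have "\<dots> = (LINT z|Q. indicator A (fst z) * indicator b (snd (snd z))
      - indicator A (fst z) * (of_bool (fst (snd z)) * indicator b (snd (snd z))))"
    by (intro Bochner_Integration.integral_cong) (auto simp: indicator_def)
  also have "\<dots> = (LINT z|Q. indicator A (fst z) * indicator b (snd (snd z)))
      - (LINT z|Q. indicator A (fst z) * (of_bool (fst (snd z)) * indicator b (snd (snd z))))"
    by (intro Bochner_Integration.integral_diff integrable_AE_bounded[where B=1]) (auto simp: indicator_def)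
  also have "(LINT z|Q. indicator A (fst z) * (of_bool (fst (snd z)) * indicator b (snd (snd z))))
    = (LINT z|Q. (indicator A (fst z) * \<pi> (fst z)) * indicator b (snd (snd z)))"
    by (rule integral_C_Y[where B=1]) (auto simp: indicator_def)
  also have "(LINT z|Q. indicator A (fst z) * indicator b (snd (snd z))) - \<dots>
    = (LINT z|Q. indicator A (fst z) * indicator b (snd (snd z)) - (indicator A (fst z) * \<pi> (fst z)) * indicator b (snd (snd z)))"
  proof (rule Bochner_Integration.integral_diff[symmetric])
    show "integrable Q (\<lambda>z. indicator A (fst z) * indicator b (snd (snd z)) :: real)"
      by (rule integrable_AE_bounded[where B=1]) (auto simp: indicator_def)
    show "integrable Q (\<lambda>z. indicator A (fst z) * \<pi> (fst z) * indicator b (snd (snd z)))"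
    proof (rule integrable_AE_bounded)
      show "AE z in Q. \<bar>indicator A (fst z) * \<pi> (fst z) * indicator b (snd (snd z))\<bar> \<le> 1"
        using overlap_AE by eventually_elim (use overlap(1) in \<open>auto simp: indicator_def\<close>)
    qed measurable
  qed
  finally show ?thesis by (simp add: algebra_simps)
qed

text \<open>Odds weighting: averaging out \<open>C\<close> multiplies the odds by
  \<open>\<pi>\<close>, which leaves \<open>1 - \<pi>\<close>, so reweighted labelled points
  represent the unlabelled law.\<close>

lemma integral_odds_C:
  assumes [measurable]: "A \<in> sets borel" "b \<in> sets borel"
  shows "(LINT z|Q. odds \<pi> (fst z) * of_bool (fst (snd z)) * (indicator A (fst z) * indicator b (snd (snd z))))
    = prob {z. fst z \<in> A \<and> snd (snd z) \<in> b \<and> \<not> fst (snd z)}"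
proof -
  have "(LINT z|Q. odds \<pi> (fst z) * of_bool (fst (snd z)) * (indicator A (fst z) * indicator b (snd (snd z))))
    = (LINT z|Q. (odds \<pi> (fst z) * indicator A (fst z)) * (of_bool (fst (snd z)) * indicator b (snd (snd z))))"
    by (simp add: mult_ac)
  also have "\<dots> = (LINT z|Q. (odds \<pi> (fst z) * indicator A (fst z)) * \<pi> (fst z) * indicator b (snd (snd z)))"
  proof (rule integral_C_Y[where B="1 / \<epsilon>" and g="\<lambda>x. odds \<pi> x * indicator A x"])
    show "AE z in Q. \<bar>odds \<pi> (fst z) * indicator A (fst z)\<bar> \<le> 1 / \<epsilon>"
      using odds_bounds by eventually_elim (use overlap(1) in \<open>auto simp: indicator_def\<close>)
  qed measurable
  also have "\<dots> = (LINT z|Q. (1 - \<pi> (fst z)) * indicator A (fst z) * indicator b (snd (snd z)))"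
    using odds_\<pi> by (intro integral_cong_AE) (measurable, auto simp: indicator_def elim!: eventually_mono)
  finally show ?thesis by (simp add: integral_unlabeled)
qed

lemma prob_unlabeled_eq:
  "prob_unlabeled Q = (LINT z|Q. odds \<pi> (fst z) * of_bool (fst (snd z)))"
  "prob_unlabeled Q = (LINT z|Q. 1 - \<pi> (fst z))"
  using integral_odds_C[of UNIV UNIV] integral_unlabeled[of UNIV UNIV] by (simp_all add: prob_unlabeled_def)

lemma prob_unlabeled_pos: "prob_unlabeled Q > 0"
proof -
  have "(LINT z|Q. \<epsilon>) \<le> (LINT z|Q. 1 - \<pi> (fst z))"
  proof (rule integral_mono_AE)
    show "integrable Q (\<lambda>z. 1 - \<pi> (fst z))"
    proof (rule integrable_AE_bounded)
      show "AE z in Q. \<bar>1 - \<pi> (fst z)\<bar> \<le> 1" using one_minus_\<pi>_bounds by eventually_elim auto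
    qed measurable
    show "AE z in Q. \<epsilon> \<le> 1 - \<pi> (fst z)" using overlap_AE by eventually_elim auto
  qed simp
  then show ?thesis using overlap(1) prob_space by (simp add: prob_unlabeled_eq(2))
qed

lemma target_cdf_eq:
  "prob_unlabeled Q * target_cdf Q u
     = (LINT z|Q. odds \<pi> (fst z) * of_bool (fst (snd z)) * indicator {..u} (fst z, snd (snd z)))"
proof -
  have "(LINT z|Q. odds \<pi> (fst z) * of_bool (fst (snd z)) * indicator {..u} (fst z, snd (snd z)))
    = (LINT z|Q. odds \<pi> (fst z) * of_bool (fst (snd z)) * (indicator {..fst u} (fst z) * indicator {..snd u} (snd (snd z))))"
    by (intro Bochner_Integration.integral_cong) (auto simp: indicator_def less_eq_prod_def)
  also have "\<dots> = prob {z. fst z \<in> {..fst u} \<and> snd (snd z) \<in> {..snd u} \<and> \<not> fst (snd z)}"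
    by (rule integral_odds_C) auto
  also have "\<dots> = prob_unlabeled Q * target_cdf Q u"
    using prob_unlabeled_pos
    by (simp add: target_cdf_def cond_prob_def prob_unlabeled_def less_eq_prod_def conj_assoc)
  finally show ?thesis ..
qed

text \<open>As \<open>f\<close> depends on \<open>X\<close> alone, the orthant event is
  \<open>X \<in> A\<close>, and the identities apply with \<open>b = UNIV\<close>. Both weightings
  have the same target, so the two auxiliary estimators share their centring.\<close>

lemma target_cdf_f_eq:
  assumes [measurable]: "f \<in> borel_measurable borel"
  shows "prob_unlabeled Q * target_cdf_f Q f u
     = (LINT z|Q. odds \<pi> (fst z) * of_bool (fst (snd z)) * indicator {..u} (fst z, f (fst z)))"
    and "prob_unlabeled Q * target_cdf_f Q f u
     = (LINT z|Q. (1 - \<pi> (fst z)) * indicator {..u} (fst z, f (fst z)))"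
proof -
  define A where "A = {x. (x, f x) \<le> u}"
  have [measurable]: "A \<in> sets borel"
  proof -
    have "A = (\<lambda>x. (x, f x)) -` {..u} \<inter> space borel" by (auto simp: A_def)
    also have "\<dots> \<in> sets borel" by (rule measurable_sets[where A=borel]) auto
    finally show ?thesis .
  qed
  have ind: "indicator {..u} (x, f x) = (indicator A x :: real)" for x by (simp add: A_def indicator_def)
  have eq: "prob_unlabeled Q * target_cdf_f Q f u = prob {z. fst z \<in> A \<and> \<not> fst (snd z)}"
    using prob_unlabeled_pos by (simp add: target_cdf_f_def cond_prob_def prob_unlabeled_def A_def)
  show "prob_unlabeled Q * target_cdf_f Q f u
     = (LINT z|Q. odds \<pi> (fst z) * of_bool (fst (snd z)) * indicator {..u} (fst z, f (fst z)))"
    using integral_odds_C[of A UNIV] by (simp add: eq ind)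
  show "prob_unlabeled Q * target_cdf_f Q f u
     = (LINT z|Q. (1 - \<pi> (fst z)) * indicator {..u} (fst z, f (fst z)))"
    using integral_unlabeled[of A UNIV] by (simp add: eq ind)
qed

end

section \<open>Combination of the three expansions\<close>

theorem theorem3p2:
  fixes Q :: "((real^'d) \<times> bool \<times> real) measure"
    and \<pi> f :: "real^'d \<Rightarrow> real"
    and \<Phi> :: "((real^'d) \<times> real \<Rightarrow> real) \<Rightarrow> real"
    and M :: "'w measure"
    and X :: "nat \<Rightarrow> 'w \<Rightarrow> real^'d"
    and C :: "nat \<Rightarrow> 'w \<Rightarrow> bool"
    and Y :: "nat \<Rightarrow> 'w \<Rightarrow> real"
    and \<omega>hat :: "nat \<Rightarrow> 'w \<Rightarrow> real"
    and \<epsilon> :: real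
  assumes Q: "prob_space Q" "sets Q = sets triple_space"
    and propensity: "is_propensity Q \<pi>"
    and overlap: "\<epsilon> > 0" "AE (x, c, y) in Q. \<epsilon> < \<pi> x \<and> \<pi> x < 1 - \<epsilon>"
    and cond_indep: "cond_indep_var Q (sigma_X Q)
                       (count_space UNIV) (\<lambda>(x, c, y). c) borel (\<lambda>(x, c, y). y)"
    and f: "f \<in> borel_measurable borel"
    and hadamard: "hadamard_differentiable \<Phi> cdfs (target_cdf Q)"
                  "hadamard_differentiable \<Phi> cdfs (target_cdf_f Q f)"
    and influence_measurable: "(\<lambda>(x, c, y). phi \<Phi> Q x y) \<in> borel_measurable Q"
                              "(\<lambda>(x, c, y). phi_f \<Phi> Q f x) \<in> borel_measurable Q"
    and var_pos: "prob_space.variance Q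
                    (\<lambda>(x, c, y). (1 - \<pi> x - odds \<pi> x * of_bool c) * phi_f \<Phi> Q f x) > 0"
    and M: "prob_space M"
    and indep: "prob_space.indep_vars M (\<lambda>_. Q) (\<lambda>i w. (X i w, C i w, Y i w)) UNIV"
    and identically_distributed: "\<And>i. distr M Q (\<lambda>w. (X i w, C i w, Y i w)) = Q"
    and estimators_measurable:
      "\<And>m. (\<lambda>w. theta_qC \<Phi> \<pi> (\<lambda>i. X i w) (\<lambda>i. C i w) (\<lambda>i. Y i w) m) \<in> borel_measurable M"
      "\<And>m. (\<lambda>w. theta_f_qC \<Phi> \<pi> f (\<lambda>i. X i w) (\<lambda>i. C i w) m) \<in> borel_measurable M"
      "\<And>m. (\<lambda>w. theta_f_pi \<Phi> \<pi> f (\<lambda>i. X i w) m) \<in> borel_measurable M"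
      "\<And>m. \<omega>hat m \<in> borel_measurable M"
    and \<omega>hat: "converges_in_prob M \<omega>hat (omega \<Phi> Q \<pi> f)"
  shows "weak_conv_m
           (\<lambda>m. distr M borel (\<lambda>w. sqrt (real m) *
              (theta_qC \<Phi> \<pi> (\<lambda>i. X i w) (\<lambda>i. C i w) (\<lambda>i. Y i w) m
               + \<omega>hat m w * (theta_f_pi \<Phi> \<pi> f (\<lambda>i. X i w) m
                             - theta_f_qC \<Phi> \<pi> f (\<lambda>i. X i w) (\<lambda>i. C i w) m)
               - \<Phi> (target_cdf Q))))
           (normal_law 0 (asymptotic_variance \<Phi> Q \<pi> f))"
proof -
  interpret Qm: missing_data Q \<pi> \<epsilon>
    by (rule missing_data.intro[OF Q propensity overlap cond_indep])
  define W where "W i w = (X i w, C i w, Y i w)" for i w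
  interpret iid_sample M Q W
    using M indep identically_distributed
    by (simp add: iid_sample_def iid_sample_axioms_def W_def[abs_def])
  note [measurable] = f estimators_measurable
  define v1 where "v1 z = odds \<pi> (fst z) * of_bool (fst (snd z))" for z :: "(real^'d) \<times> bool \<times> real"
  define v2 where "v2 z = 1 - \<pi> (fst z)" for z :: "(real^'d) \<times> bool \<times> real"
  define \<zeta>1 where "\<zeta>1 z = (fst z, snd (snd z))" for z :: "(real^'d) \<times> bool \<times> real"
  define \<zeta>2 where "\<zeta>2 z = (fst z, f (fst z))" for z :: "(real^'d) \<times> bool \<times> real"
  define g1 where "g1 z = influence_function \<Phi> (target_cdf Q) (\<zeta>1 z)" for z
  define g2 where "g2 z = influence_function \<Phi> (target_cdf_f Q f) (\<zeta>2 z)" for z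
  define p where "p = prob_unlabeled Q"
  have p: "p > 0" unfolding p_def by (rule Qm.prob_unlabeled_pos)
  have v1_meas [measurable]: "v1 \<in> borel_measurable Q" unfolding v1_def[abs_def] by measurable
  have v2_meas [measurable]: "v2 \<in> borel_measurable Q" unfolding v2_def[abs_def] by measurable
  have \<zeta>1_meas [measurable]: "\<zeta>1 \<in> borel_measurable Q" unfolding \<zeta>1_def[abs_def] by measurable
  have \<zeta>2_meas [measurable]: "\<zeta>2 \<in> borel_measurable Q" unfolding \<zeta>2_def[abs_def] by measurable
  have g1_meas: "(\<lambda>z. influence_function \<Phi> (target_cdf Q) (\<zeta>1 z)) \<in> borel_measurable Q"
    using influence_measurable(1) by (simp add: \<zeta>1_def phi_def case_prod_beta')
  have g2_meas: "(\<lambda>z. influence_function \<Phi> (target_cdf_f Q f) (\<zeta>2 z)) \<in> borel_measurable Q"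
    using influence_measurable(2) by (simp add: \<zeta>2_def phi_f_def case_prod_beta')
  have [measurable]: "g1 \<in> borel_measurable Q" "g2 \<in> borel_measurable Q"
    unfolding g1_def[abs_def] g2_def[abs_def] using g1_meas g2_meas by auto
  have b1: "AE z in Q. 0 \<le> v1 z \<and> v1 z \<le> 1 / \<epsilon>" unfolding v1_def by (rule Qm.odds_C_bounds)
  have b2: "AE z in Q. 0 \<le> v2 z \<and> v2 z \<le> 1" unfolding v2_def by (rule Qm.one_minus_\<pi>_bounds)
  have \<epsilon>1: "1 / \<epsilon> > 0" using overlap(1) by simp
  have p1: "p = (LINT z|Q. v1 z)" and p2: "p = (LINT z|Q. v2 z)"
    unfolding p_def v1_def v2_def by (rule Qm.prob_unlabeled_eq)+
  have F1: "p * target_cdf Q u = (LINT z|Q. v1 z * indicator {..u} (\<zeta>1 z))" for u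
    unfolding p_def v1_def \<zeta>1_def by (rule Qm.target_cdf_eq)
  have F2: "p * target_cdf_f Q f u = (LINT z|Q. v1 z * indicator {..u} (\<zeta>2 z))"
    and F3: "p * target_cdf_f Q f u = (LINT z|Q. v2 z * indicator {..u} (\<zeta>2 z))" for u
    unfolding p_def v1_def v2_def \<zeta>2_def by (rule Qm.target_cdf_f_eq[OF f])+
  note E1 = plugin_expansion[OF v1_meas b1 \<epsilon>1 \<zeta>1_meas p1 p F1 hadamard(1) g1_meas, folded g1_def]
  note E2 = plugin_expansion[OF v1_meas b1 \<epsilon>1 \<zeta>2_meas p1 p F2 hadamard(2) g2_meas, folded g2_def]
  note E3 = plugin_expansion[OF v2_meas b2 zero_less_one \<zeta>2_meas p2 p F3 hadamard(2) g2_meas, folded g2_def]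

  define S1 where "S1 m w = (\<Sum>i<m. v1 (W i w) * g1 (W i w)) / sqrt m" for m w
  define S2 where "S2 m w = (\<Sum>i<m. v1 (W i w) * g2 (W i w)) / sqrt m" for m w
  define S3 where "S3 m w = (\<Sum>i<m. v2 (W i w) * g2 (W i w)) / sqrt m" for m w
  define T1 where "T1 m w = theta_qC \<Phi> \<pi> (\<lambda>i. X i w) (\<lambda>i. C i w) (\<lambda>i. Y i w) m" for m w
  define T2 where "T2 m w = theta_f_qC \<Phi> \<pi> f (\<lambda>i. X i w) (\<lambda>i. C i w) m" for m w
  define T3 where "T3 m w = theta_f_pi \<Phi> \<pi> f (\<lambda>i. X i w) m" for m w
  define r1 where "r1 m w = sqrt m * (T1 m w - \<Phi> (target_cdf Q)) - S1 m w / p" for m w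
  define r2 where "r2 m w = sqrt m * (T2 m w - \<Phi> (target_cdf_f Q f)) - S2 m w / p" for m w
  define r3 where "r3 m w = sqrt m * (T3 m w - \<Phi> (target_cdf_f Q f)) - S3 m w / p" for m w
  have r1: "prob_null M r1" using E1(1)
    by (simp add: r1_def[abs_def] T1_def theta_qC_def S1_def v1_def \<zeta>1_def W_def)
  have r2: "prob_null M r2" using E2(1)
    by (simp add: r2_def[abs_def] T2_def theta_f_qC_def S2_def v1_def \<zeta>2_def W_def)
  have r3: "prob_null M r3" using E3(1)
    by (simp add: r3_def[abs_def] T3_def theta_f_pi_def S3_def v2_def \<zeta>2_def W_def)
  have S2: "prob_bounded M S2" using E2(4) by (simp add: S2_def[abs_def])
  have S3: "prob_bounded M S3" using E3(4) by (simp add: S3_def[abs_def])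

  define \<omega> where "\<omega> = omega \<Phi> Q \<pi> f"
  define a where "a z = v1 z * g1 z" for z
  \<comment> \<open>Up to the factor \<open>1 / p\<close>, the influence of the difference of the
    auxiliary estimators; their common centring cancels.\<close>
  define d where "d z = (v2 z - v1 z) * g2 z" for z
  define \<psi> where "\<psi> z = a z + \<omega> * d z" for z
  have [measurable]: "a \<in> borel_measurable Q" "d \<in> borel_measurable Q"
    unfolding a_def[abs_def] d_def[abs_def] by measurable
  then have [measurable]: "\<psi> \<in> borel_measurable Q" unfolding \<psi>_def[abs_def] by measurable
  obtain K1 K2 where K1: "\<And>z. \<bar>g1 z\<bar> \<le> K1" and K2: "\<And>z. \<bar>g2 z\<bar> \<le> K2"
    using E1(3) E2(3) by blast
  have a_bound: "AE z in Q. \<bar>a z\<bar> \<le> 1 / \<epsilon> * K1"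
    using b1
  proof eventually_elim
    case (elim z)
    then show ?case unfolding a_def abs_mult using \<epsilon>1 by (intro mult_mono K1) auto
  qed
  have d_bound: "AE z in Q. \<bar>d z\<bar> \<le> (1 + 1 / \<epsilon>) * K2"
    using b1 b2
  proof eventually_elim
    case (elim z)
    then show ?case unfolding d_def abs_mult using \<epsilon>1 by (intro mult_mono K2) auto
  qed
  have sq: "integrable Q (\<lambda>z. h z * k z)"
    if "AE z in Q. \<bar>h z\<bar> \<le> A" "AE z in Q. \<bar>k z\<bar> \<le> B" "h \<in> borel_measurable Q" "k \<in> borel_measurable Q"
    for h k :: "_ \<Rightarrow> real" and A B
  proof (rule Qm.integrable_AE_bounded)
    show "AE z in Q. \<bar>h z * k z\<bar> \<le> A * B"
      using that(1,2)
    proof eventually_elim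
      case (elim z)
      then show ?case unfolding abs_mult by (intro mult_mono) auto
    qed
  qed (use that in measurable)
  have int_a: "integrable Q a" and int_d: "integrable Q d"
    using a_bound d_bound by (auto intro: Qm.integrable_AE_bounded)
  have int_aa: "integrable Q (\<lambda>z. a z * a z)" and int_ad: "integrable Q (\<lambda>z. a z * d z)"
    and int_dd: "integrable Q (\<lambda>z. d z * d z)"
    using sq[OF a_bound a_bound] sq[OF a_bound d_bound] sq[OF d_bound d_bound] by auto
  have mean_a: "(LINT z|Q. a z) = 0" using E1(2) by (simp add: a_def)
  have mean_d: "(LINT z|Q. d z) = 0"
  proof -
    have bg2: "AE z in Q. \<bar>g2 z\<bar> \<le> K2" using K2 by simp
    have "AE z in Q. \<bar>v2 z\<bar> \<le> 1" using b2 by eventually_elim simp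
    from sq[OF this bg2] have i2: "integrable Q (\<lambda>z. v2 z * g2 z)" by simp
    have "AE z in Q. \<bar>v1 z\<bar> \<le> 1 / \<epsilon>" using b1 by eventually_elim simp
    from sq[OF this bg2] have i1: "integrable Q (\<lambda>z. v1 z * g2 z)" by simp
    have "(LINT z|Q. d z) = (LINT z|Q. v2 z * g2 z) - (LINT z|Q. v1 z * g2 z)"
      unfolding d_def left_diff_distrib using i1 i2 by simp
    then show ?thesis using E2(2) E3(2) by simp
  qed
  have mean_\<psi>: "(LINT z|Q. \<psi> z) = 0"
    unfolding \<psi>_def using int_a int_d mean_a mean_d by simp
  define Vd where "Vd = (LINT z|Q. d z * d z)"
  define c where "c = (LINT z|Q. a z * d z)"
  have sq_\<psi>: "(\<psi> z)\<^sup>2 = a z * a z + 2 * \<omega> * (a z * d z) + \<omega>\<^sup>2 * (d z * d z)" for z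
    by (simp add: \<psi>_def power2_eq_square algebra_simps)
  have int_\<psi>: "integrable Q (\<lambda>z. (\<psi> z)\<^sup>2)"
    unfolding sq_\<psi> using int_aa int_ad int_dd by simp
  have E\<psi>: "(LINT z|Q. (\<psi> z)\<^sup>2) = (LINT z|Q. a z * a z) + 2 * \<omega> * c + \<omega>\<^sup>2 * Vd"
    unfolding sq_\<psi> c_def Vd_def using int_aa int_ad int_dd by simp

  have a_eq: "(\<lambda>(x, c, y). odds \<pi> x * of_bool c * phi \<Phi> Q x y) = a"
    by (auto simp: a_def v1_def g1_def \<zeta>1_def phi_def)
  have d_eq: "(\<lambda>(x, c, y). (1 - \<pi> x - odds \<pi> x * of_bool c) * phi_f \<Phi> Q f x) = d"
    by (auto simp: d_def v1_def v2_def g2_def \<zeta>2_def phi_f_def)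
  have d'_eq: "(\<lambda>(x, c, y). (odds \<pi> x * of_bool c - (1 - \<pi> x)) * phi_f \<Phi> Q f x) = (\<lambda>z. - d z)"
    by (auto simp: d_def v1_def v2_def g2_def \<zeta>2_def phi_f_def algebra_simps)
  \<comment> \<open>Both influences have mean zero, so variances and covariances are plain second
    moments.\<close>
  have var_d: "Qm.variance d = Vd" and var_a: "Qm.variance a = (LINT z|Q. a z * a z)"
    by (simp_all add: mean_a mean_d Vd_def power2_eq_square)
  have Vd: "Vd > 0" using var_pos unfolding d_eq var_d .
  have cov: "covariance Q a d = c" "covariance Q a (\<lambda>z. - d z) = - c"
    by (simp_all add: covariance_def mean_a mean_d c_def)
  \<comment> \<open>\<open>omega\<close> uses \<open>- d\<close> in its covariance, hence the sign.
    This value minimises the quadratic in \<open>E\<psi>\<close> and lowers the second moment of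
    \<open>a\<close> by \<open>c^2 / Vd\<close>.\<close>
  have \<omega>_eq: "\<omega> = - c / Vd"
    unfolding \<omega>_def omega_def a_eq d_eq d'_eq var_d cov ..
  have av: "asymptotic_variance \<Phi> Q \<pi> f = (1 / p)\<^sup>2 * (LINT z|Q. (\<psi> z)\<^sup>2)"
    unfolding asymptotic_variance_def a_eq d_eq var_d var_a cov E\<psi> \<omega>_eq p_def[symmetric]
    using Vd p by (simp add: field_simps power2_eq_square)

  define Z where "Z m w = 1 / p * ((\<Sum>i<m. \<psi> (W i w)) / sqrt m)" for m w
  have Z_eq: "Z m w = S1 m w / p + \<omega> * (S3 m w / p - S2 m w / p)" for m w
    by (simp add: Z_def S1_def S2_def S3_def \<psi>_def a_def d_def sum.distrib sum_subtractf
        left_diff_distrib sum_distrib_left[symmetric] add_divide_distrib diff_divide_distrib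
        right_diff_distrib mult_ac)
  define T where "T m w = sqrt m * (T1 m w + \<omega>hat m w * (T3 m w - T2 m w) - \<Phi> (target_cdf Q))" for m w
  have "weak_conv_m (\<lambda>m. distr M borel (Z m)) (normal_law 0 (asymptotic_variance \<Phi> Q \<pi> f))"
    unfolding Z_def[abs_def] av using mean_\<psi> int_\<psi> p by (intro clt) auto
  then have "weak_conv_m (\<lambda>m. distr M borel (T m)) (normal_law 0 (asymptotic_variance \<Phi> Q \<pi> f))"
  proof (rule slutsky[rotated 3])
    show "T m \<in> borel_measurable M" for m
      unfolding T_def[abs_def] T1_def T2_def T3_def by measurable
    show "Z m \<in> borel_measurable M" for m unfolding Z_def[abs_def] by measurable
    show "real_distribution (normal_law 0 (asymptotic_variance \<Phi> Q \<pi> f))"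
      by (rule real_distribution_normal_law)
    have \<omega>0: "prob_null M (\<lambda>m w. \<omega>hat m w - \<omega>)"
      unfolding \<omega>_def using \<omega>hat by (rule converges_in_prob_imp_null) simp
    have \<omega>1: "prob_bounded M \<omega>hat"
      using prob_bounded_add[OF prob_null_imp_bounded[OF \<omega>0] prob_bounded_const[of \<omega>]] by simp
    \<comment> \<open>The estimated coefficient multiplies null remainders, where its boundedness is
      enough; its own error multiplies a fluctuation that is bounded in probability.\<close>
    have "prob_null M (\<lambda>m w. r1 m w + (r3 m w - r2 m w) * \<omega>hat m w
        + (\<omega>hat m w - \<omega>) * ((S3 m w - S2 m w) * (1 / p)))"
      by (rule prob_null_add[OF prob_null_add[OF r1 prob_null_mult[OF prob_null_diff[OF r3 r2] \<omega>1]]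
            prob_null_mult[OF \<omega>0 prob_bounded_mult[OF prob_bounded_diff[OF S3 S2] prob_bounded_const]]])
    moreover have "T m w - Z m w = r1 m w + (r3 m w - r2 m w) * \<omega>hat m w
        + (\<omega>hat m w - \<omega>) * ((S3 m w - S2 m w) * (1 / p))" for m w
      by (simp add: T_def Z_eq r1_def r2_def r3_def algebra_simps diff_divide_distrib)
    ultimately show "prob_null M (\<lambda>m w. T m w - Z m w)" by simp
  qed
  then show ?thesis by (simp add: T_def[abs_def] T1_def T2_def T3_def)
qed

end
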